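(* Let $F^{\alpha\rho\sigma}$ be a smooth real Fierz tensor field on Minkowski space, i.e. $F^{\alpha\rho\sigma}=-F^{\alpha\sigma\rho}$, $\eta_{\alpha\rho}F^{\alpha\rho\sigma}=0$ and $\epsilon_{\alpha\rho\sigma\tau}F^{\alpha\rho\sigma}=0$, and let $\theta_\alpha=X_\alpha:=\eta_{\alpha\beta}F^{\beta\rho\sigma}\Theta_{\rho\sigma}$. Then $$L_V=-32\,F_{\alpha\beta\rho\sigma}F^{\alpha\beta\rho\sigma},\qquad F_{\alpha\beta\rho\sigma}:=\partial_\alpha F_{\beta\rho\sigma}-\partial_\beta F_{\alpha\rho\sigma}+4\bigl({F_{\alpha\rho}}^\nu F_{\beta\nu\sigma}-{F_{\beta\rho}}^\nu F_{\alpha\nu\sigma}\bigr).$$ If $\tau\neq0$ is a real constant, then the field equation obtained by varying $L=L_K-\tau L_V$ with respect to $F^{\alpha\rho\sigma}$, subject to the Fierz constraints, is $$\begin{aligned}&\xi_{\alpha\rho\sigma}-\tfrac13\eta_{\alpha\rho}{\xi^\beta}_{\beta\sigma}+\tfrac13\eta_{\alpha\sigma}{\xi^\beta}_{\beta\rho}-\tfrac16\epsilon_{\alpha\rho\sigma\omega}\epsilon^{\lambda\mu\nu\omega}\xi_{\lambda\mu\nu}\\&\quad=\chi_{\alpha\rho\sigma}-\tfrac13\eta_{\alpha\rho}{\chi^\beta}_{\beta\sigma}+\tfrac13\eta_{\alpha\sigma}{\chi^\beta}_{\beta\rho}-\tfrac16\epsilon_{\alpha\rho\sigma\omega}\epsilon^{\lambda\mu\nu\omega}\chi_{\lambda\mu\nu},\end{aligned}$$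 where $\xi_{\alpha\rho\sigma}=\frac12(\tilde\xi_{\alpha\rho\sigma}-\tilde\xi_{\alpha\sigma\rho})$, $$\begin{aligned}\tilde\xi_{\alpha\rho\sigma}=\;&8\bigl(2{F^{\beta\nu}}_\rho\,\partial_\beta F_{\alpha\sigma\nu}+{F^{\beta\nu}}_\rho\,\partial_\alpha F_{\beta\nu\sigma}+{F_{\alpha\rho}}^\nu\,\partial_\beta{F^\beta}_{\sigma\nu}\bigr)\\&-32\bigl(F_{\beta\rho\mu}{F_\alpha}^{\mu\nu}{F^\beta}_{\nu\sigma}-F_{\beta\rho\mu}F^{\beta\mu\nu}F_{\alpha\nu\sigma}\bigr)+\partial_\beta\partial^\beta F_{\alpha\rho\sigma}-\partial_\beta\partial_\alpha{F^\beta}_{\rho\sigma},\end{aligned}$$ and $\chi_{\alpha\rho\sigma}=\frac{1}{128\tau}\psi^\dagger\hat\eta\gamma_\alpha\Theta_{\rho\sigma}\psi$.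
   Context: Minkowski space is $\mathbb R^4$ with coordinates $x^\alpha$ and constant metric $\eta=\mathrm{diag}(1,-1,-1,-1)$; all indices, including those of $\epsilon$, are raised and lowered with $\eta$, and repeated indices are summed (over all values). $\epsilon_{\alpha\rho\sigma\omega}$ is the totally antisymmetric Levi-Civita symbol with $\epsilon_{0123}=1$, and $\epsilon^{\lambda\mu\nu\omega}$ is obtained from it by raising all indices with $\eta$ (so $\epsilon^{0123}=-1$). The complex exterior algebra $\bigwedge_*$ of $\mathbb R^4$ has basis $\mathbf e_I=\mathbf e_{\alpha_1}\wedge\cdots\wedge\mathbf e_{\alpha_k}$, $\alpha_1<\dots<\alpha_k$, $|I|=k$ ($\mathbf e_\emptyset=1$), and $\mathbf e_I$ is defined by the same formula for any multi-index; $16\times16$ matrices are operators on it in this basis and $\dagger$ is conjugate transpose. Gamma matrices: $\gamma_\alpha\psi=\mathbf e_\alpha\wedge\psi-\iota_\alpha\psi$, where $\iota_\alpha$ is the linear operator with $\iota_\alpha\mathbf e_\emptyset=0$, $\iota_\alpha\mathbf e_\beta=\eta_{\alpha\beta}\mathbf e_\emptyset$, $\iota_\alpha(\mathbf e_I\wedge\mathbf e_J)=(\iota_\alpha\mathbf e_I)\wedge\mathbf e_J+(-1)^{|I|}\mathbf e_I\wedge\iota_\alpha\mathbf e_J$. Extended metric: $\hat\eta_{IJ}=0$ if $|I|\ne|J|$, and $\hat\eta_{IJ}=\det(\eta_{\alpha_i\beta_j})$ if $I=\alpha_1\cdots\alpha_k$, $J=\beta_1\cdots\beta_k$. $\Theta_I$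 is the $16\times16$ matrix that commutes with all gamma matrices and satisfies $\Theta_I\mathbf e_\emptyset=\mathbf e_I$ (so $\Theta_{\rho\sigma}=-\Theta_{\sigma\rho}$). Given four matrix-valued fields $\theta_\alpha$, put $\Omega_{\alpha\beta}=\partial_\alpha\theta_\beta-\partial_\beta\theta_\alpha+\theta_\alpha\theta_\beta-\theta_\beta\theta_\alpha$ and $$L_V=\tfrac12\,\mathrm{tr}(\Omega_{\alpha\beta}\Omega^{\alpha\beta})+c.c.$$ For a smooth field $\psi:\mathbb R^4\to\bigwedge_*\cong\mathbb C^{16}$ and a real constant $m$, put $D\psi=\gamma^\alpha(\partial_\alpha\psi+\theta_\alpha\psi)$ and $$L_K=\tfrac12\psi^\dagger\hat\eta D\psi+c.c.-m\,\psi^\dagger\hat\eta\psi ,$$ where $c.c.$ is the complex conjugate of the preceding term. The (constrained) field equation means: stationarity of $\int L\,d^4x$ under compactly supported variations of $F^{\alpha\rho\sigma}$ through Fierz tensor fields, with $\psi$ fixed.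
   Formalization: The coefficient −1/6 of the ε-terms on both sides of the field equation is corrected to +1/6: with ε^{0123}=−1 the printed sign doubles the totally antisymmetric part instead of removing it, and the claim fails for F=0, ψ=e_∅+e_{023}. *)

theory Defs
  imports "HOL-Analysis.Analysis"
begin

section \<open>Minkowski space and smooth fields\<close>

text \<open>Indices are the elements \<open>0 < 1 < 2 < 3\<close> of the numeral type \<open>4\<close>.\<close>

type_synonym spacetime = "real ^ 4"

text \<open>\<open>eta\<close> is its own inverse, so it denotes both \<open>\<eta>\<^sub>\<alpha>\<^sub>\<beta>\<close> and \<open>\<eta>\<close> with upper indices.\<close>

definition eta :: "4 \<Rightarrow> 4 \<Rightarrow> real" where
  "eta \<alpha> \<beta> = (if \<alpha> \<noteq> \<beta> then 0 else if \<alpha> = 0 then 1 else -1)"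

text \<open>\<open>shift \<alpha> T\<close> is component \<open>\<alpha>\<close> of \<open>T\<close> after one index has been raised or lowered.\<close>

definition shift :: "4 \<Rightarrow> (4 \<Rightarrow> 'a::real_vector) \<Rightarrow> 'a" where
  "shift \<alpha> T = (\<Sum>\<beta>\<in>UNIV. eta \<alpha> \<beta> *\<^sub>R T \<beta>)"

definition pd :: "4 \<Rightarrow> (spacetime \<Rightarrow> 'b::real_normed_vector) \<Rightarrow> spacetime \<Rightarrow> 'b" where
  "pd \<alpha> f x = frechet_derivative f (at x) (axis \<alpha> 1)"

text \<open>\<open>C\<^sup>\<infinity>\<close>: all iterated partial derivatives exist and are (Frechet) differentiable, hence
  continuous.\<close>

definition smooth :: "(spacetime \<Rightarrow> 'b::real_normed_vector) \<Rightarrow> bool" where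
  "smooth f \<longleftrightarrow> (\<forall>\<alpha>s x. foldr pd \<alpha>s f differentiable (at x))"

definition order_sign :: "4 \<Rightarrow> 4 \<Rightarrow> real" where
  "order_sign a b = (if a < b then 1 else if a = b then 0 else -1)"

text \<open>The Levi-Civita symbol is the product of the order signs of all pairs of its indices.\<close>

definition eps :: "4 \<Rightarrow> 4 \<Rightarrow> 4 \<Rightarrow> 4 \<Rightarrow> real" where
  "eps \<alpha> \<rho> \<sigma> \<omega> =
     order_sign \<alpha> \<rho> * order_sign \<alpha> \<sigma> * order_sign \<alpha> \<omega> *
     order_sign \<rho> \<sigma> * order_sign \<rho> \<omega> * order_sign \<sigma> \<omega>"

definition eps_up :: "4 \<Rightarrow> 4 \<Rightarrow> 4 \<Rightarrow> 4 \<Rightarrow> real" where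
  "eps_up \<alpha> \<rho> \<sigma> \<omega> =
     shift \<alpha> (\<lambda>\<alpha>. shift \<rho> (\<lambda>\<rho>. shift \<sigma> (\<lambda>\<sigma>. shift \<omega> (\<lambda>\<omega>. eps \<alpha> \<rho> \<sigma> \<omega>))))"

lemma less_index4: "(0::4) < 1" "(0::4) < 2" "(0::4) < 3" "(1::4) < 2" "(1::4) < 3" "(2::4) < 3"
  unfolding less_bit0_def by (simp_all add: bit0.Rep_0 bit0.Rep_1 bit0.Rep_numeral)

lemma all_index4: "(\<forall>x::4. P x) \<longleftrightarrow> P 0 \<and> P 1 \<and> P 2 \<and> P 3"
proof -
  have "(0::4) = 4" by simp
  then show ?thesis using forall_4[of P] by metis
qed

lemma distinct_index4: "(0::4) \<noteq> 1" "(0::4) \<noteq> 2" "(0::4) \<noteq> 3" "(1::4) \<noteq> 2" "(1::4) \<noteq> 3" "(2::4) \<noteq> 3"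
  using less_index4 by (metis less_irrefl)+

lemmas order_sign_simps = order_sign_def less_index4 distinct_index4 distinct_index4[symmetric]
  less_not_sym[OF less_index4(1)] less_not_sym[OF less_index4(2)]
  less_not_sym[OF less_index4(3)] less_not_sym[OF less_index4(4)]
  less_not_sym[OF less_index4(5)] less_not_sym[OF less_index4(6)]

lemma eps_0123: "eps 0 1 2 3 = 1" by (simp add: eps_def order_sign_simps)

lemma eps_swap: "eps \<rho> \<alpha> \<sigma> \<omega> = - eps \<alpha> \<rho> \<sigma> \<omega>" "eps \<alpha> \<sigma> \<rho> \<omega> = - eps \<alpha> \<rho> \<sigma> \<omega>"
   "eps \<alpha> \<rho> \<omega> \<sigma> = - eps \<alpha> \<rho> \<sigma> \<omega>"
  by (auto simp: eps_def order_sign_def)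

lemma shift_eq: "shift \<alpha> f = eta \<alpha> \<alpha> *\<^sub>R f \<alpha>"
proof -
  have "(\<Sum>\<beta>\<in>UNIV. eta \<alpha> \<beta> *\<^sub>R f \<beta>) = (\<Sum>\<beta>\<in>UNIV. if \<beta> = \<alpha> then eta \<alpha> \<beta> *\<^sub>R f \<beta> else 0)"
    by (rule sum.cong) (auto simp: eta_def)
  then show ?thesis by (simp add: shift_def)
qed

lemma eps_up_eq: "eps_up \<alpha> \<rho> \<sigma> \<omega> = - eps \<alpha> \<rho> \<sigma> \<omega>"
proof -
  have "\<forall>\<alpha> \<rho> \<sigma> \<omega>. eps_up \<alpha> \<rho> \<sigma> \<omega> = - eps \<alpha> \<rho> \<sigma> \<omega>"
    by (simp add: all_index4 eps_up_def shift_eq eps_def order_sign_simps eta_def)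
  then show ?thesis by blast
qed


section \<open>The exterior algebra\<close>

text \<open>Increasing multi-indices are encoded as subsets of the index set.\<close>

type_synonym form = "complex ^ (4 set)"
type_synonym op16 = "complex ^ (4 set) ^ (4 set)"

text \<open>\<open>e\<^sub>A\<close> wedge \<open>e\<^sub>B\<close> is \<open>shuffle_sign A B\<close> times \<open>e\<close> of the union of \<open>A\<close> and \<open>B\<close>.\<close>

definition shuffle_sign :: "4 set \<Rightarrow> 4 set \<Rightarrow> real" where
  "shuffle_sign A B = (\<Prod>a\<in>A. \<Prod>b\<in>B. order_sign a b)"

definition wedge :: "form \<Rightarrow> form \<Rightarrow> form" where
  "wedge \<psi> \<phi> = (\<chi> C. \<Sum>A\<in>Pow C. of_real (shuffle_sign A (C - A)) * \<psi> $ A * \<phi> $ (C - A))"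

definition bas :: "4 list \<Rightarrow> form" where
  "bas I = foldr (\<lambda>\<alpha>. wedge (axis {\<alpha>} 1)) I (axis {} 1)"

definition is_contraction :: "4 \<Rightarrow> op16 \<Rightarrow> bool" where
  "is_contraction \<alpha> M \<longleftrightarrow>
     M *v bas [] = 0 \<and>
     (\<forall>\<beta>. M *v bas [\<beta>] = eta \<alpha> \<beta> *\<^sub>R bas []) \<and>
     (\<forall>I J. M *v wedge (bas I) (bas J) =
        wedge (M *v bas I) (bas J) + (-1) ^ length I *\<^sub>R wedge (bas I) (M *v bas J))"

definition iota :: "4 \<Rightarrow> op16" where
  "iota \<alpha> = (THE M. is_contraction \<alpha> M)"

definition gamma :: "4 \<Rightarrow> op16" where
  "gamma \<alpha> = matrix (\<lambda>\<psi>. wedge (bas [\<alpha>]) \<psi> - iota \<alpha> *v \<psi>)"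

definition is_Theta :: "4 list \<Rightarrow> op16 \<Rightarrow> bool" where
  "is_Theta I T \<longleftrightarrow> (\<forall>\<alpha>. T ** gamma \<alpha> = gamma \<alpha> ** T) \<and> T *v bas [] = bas I"

definition Theta :: "4 list \<Rightarrow> op16" where
  "Theta I = (THE T. is_Theta I T)"

text \<open>The extended metric: the determinant of \<open>\<eta>(\<alpha>\<^sub>i, \<beta>\<^sub>j)\<close>, by the Leibniz formula because its size
  varies.\<close>

definition eta_list :: "4 list \<Rightarrow> 4 list \<Rightarrow> real" where
  "eta_list I J =
     (if length I = length J
      then \<Sum>p | p permutes {..<length I}.
             of_int (sign p) * (\<Prod>i<length I. eta (I ! i) (J ! p i))
      else 0)"

definition eta_hat :: op16 where
  "eta_hat = (\<chi> A B. of_real (eta_list (sorted_list_of_set A) (sorted_list_of_set B)))"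

definition dagger_prod :: "form \<Rightarrow> form \<Rightarrow> complex" where
  "dagger_prod \<psi> \<phi> = (\<Sum>A\<in>UNIV. cnj (\<psi> $ A) * \<phi> $ A)"


section \<open>Lagrangians\<close>

definition plus_cc :: "complex \<Rightarrow> complex" where
  "plus_cc z = z + cnj z"

definition Omega :: "(4 \<Rightarrow> spacetime \<Rightarrow> op16) \<Rightarrow> 4 \<Rightarrow> 4 \<Rightarrow> spacetime \<Rightarrow> op16" where
  "Omega \<theta> \<alpha> \<beta> x =
     pd \<alpha> (\<theta> \<beta>) x - pd \<beta> (\<theta> \<alpha>) x + \<theta> \<alpha> x ** \<theta> \<beta> x - \<theta> \<beta> x ** \<theta> \<alpha> x"

definition L_V :: "(4 \<Rightarrow> spacetime \<Rightarrow> op16) \<Rightarrow> spacetime \<Rightarrow> complex" where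
  "L_V \<theta> x = plus_cc (1/2 *
     trace (\<Sum>\<alpha>\<in>UNIV. \<Sum>\<beta>\<in>UNIV.
       Omega \<theta> \<alpha> \<beta> x ** shift \<alpha> (\<lambda>\<alpha>. shift \<beta> (\<lambda>\<beta>. Omega \<theta> \<alpha> \<beta> x))))"

definition Dirac :: "(4 \<Rightarrow> spacetime \<Rightarrow> op16) \<Rightarrow> (spacetime \<Rightarrow> form) \<Rightarrow> spacetime \<Rightarrow> form" where
  "Dirac \<theta> \<psi> x = (\<Sum>\<alpha>\<in>UNIV. shift \<alpha> gamma *v (pd \<alpha> \<psi> x + \<theta> \<alpha> x *v \<psi> x))"

definition L_K ::
    "real \<Rightarrow> (4 \<Rightarrow> spacetime \<Rightarrow> op16) \<Rightarrow> (spacetime \<Rightarrow> form) \<Rightarrow> spacetime \<Rightarrow> complex" where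
  "L_K m \<theta> \<psi> x =
     plus_cc (1/2 * dagger_prod (\<psi> x) (eta_hat *v Dirac \<theta> \<psi> x))
     - of_real m * dagger_prod (\<psi> x) (eta_hat *v \<psi> x)"


section \<open>Fierz tensor fields\<close>

text \<open>A field \<open>F\<close> of this type holds the components with all three indices up. The letters
  \<open>u\<close> and \<open>d\<close> below give the index positions after lowering.\<close>

type_synonym field3 = "4 \<Rightarrow> 4 \<Rightarrow> 4 \<Rightarrow> spacetime \<Rightarrow> real"

definition smooth_field :: "field3 \<Rightarrow> bool" where
  "smooth_field F \<longleftrightarrow> (\<forall>\<alpha> \<rho> \<sigma>. smooth (F \<alpha> \<rho> \<sigma>))"

definition Fierz :: "field3 \<Rightarrow> bool" where
  "Fierz F \<longleftrightarrow> (\<forall>x.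
     (\<forall>\<alpha> \<rho> \<sigma>. F \<alpha> \<rho> \<sigma> x = - F \<alpha> \<sigma> \<rho> x) \<and>
     (\<forall>\<sigma>. (\<Sum>\<alpha>\<in>UNIV. \<Sum>\<rho>\<in>UNIV. eta \<alpha> \<rho> * F \<alpha> \<rho> \<sigma> x) = 0) \<and>
     (\<forall>\<tau>. (\<Sum>\<alpha>\<in>UNIV. \<Sum>\<rho>\<in>UNIV. \<Sum>\<sigma>\<in>UNIV. eps \<alpha> \<rho> \<sigma> \<tau> * F \<alpha> \<rho> \<sigma> x) = 0))"

definition F_uud :: "field3 \<Rightarrow> field3" where
  "F_uud F \<alpha> \<rho> \<sigma> x = shift \<sigma> (\<lambda>\<sigma>. F \<alpha> \<rho> \<sigma> x)"

definition F_udd :: "field3 \<Rightarrow> field3" where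
  "F_udd F \<alpha> \<rho> \<sigma> x = shift \<rho> (\<lambda>\<rho>. shift \<sigma> (\<lambda>\<sigma>. F \<alpha> \<rho> \<sigma> x))"

definition F_duu :: "field3 \<Rightarrow> field3" where
  "F_duu F \<alpha> \<rho> \<sigma> x = shift \<alpha> (\<lambda>\<alpha>. F \<alpha> \<rho> \<sigma> x)"

definition F_ddu :: "field3 \<Rightarrow> field3" where
  "F_ddu F \<alpha> \<rho> \<sigma> x = shift \<alpha> (\<lambda>\<alpha>. shift \<rho> (\<lambda>\<rho>. F \<alpha> \<rho> \<sigma> x))"

definition F_ddd :: "field3 \<Rightarrow> field3" where
  "F_ddd F \<alpha> \<rho> \<sigma> x = shift \<alpha> (\<lambda>\<alpha>. shift \<rho> (\<lambda>\<rho>. shift \<sigma> (\<lambda>\<sigma>. F \<alpha> \<rho> \<sigma> x)))"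

definition X_field :: "field3 \<Rightarrow> 4 \<Rightarrow> spacetime \<Rightarrow> op16" where
  "X_field F \<alpha> x = (\<Sum>\<beta>\<in>UNIV. \<Sum>\<rho>\<in>UNIV. \<Sum>\<sigma>\<in>UNIV. (eta \<alpha> \<beta> * F \<beta> \<rho> \<sigma> x) *\<^sub>R Theta [\<rho>, \<sigma>])"

definition curv :: "field3 \<Rightarrow> 4 \<Rightarrow> 4 \<Rightarrow> 4 \<Rightarrow> 4 \<Rightarrow> spacetime \<Rightarrow> real" where
  "curv F \<alpha> \<beta> \<rho> \<sigma> x =
     pd \<alpha> (F_ddd F \<beta> \<rho> \<sigma>) x - pd \<beta> (F_ddd F \<alpha> \<rho> \<sigma>) x
     + 4 * (\<Sum>\<nu>\<in>UNIV. F_ddu F \<alpha> \<rho> \<nu> x * F_ddd F \<beta> \<nu> \<sigma> x - F_ddu F \<beta> \<rho> \<nu> x * F_ddd F \<alpha> \<nu> \<sigma> x)"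

definition curv_up :: "field3 \<Rightarrow> 4 \<Rightarrow> 4 \<Rightarrow> 4 \<Rightarrow> 4 \<Rightarrow> spacetime \<Rightarrow> real" where
  "curv_up F \<alpha> \<beta> \<rho> \<sigma> x =
     shift \<alpha> (\<lambda>\<alpha>. shift \<beta> (\<lambda>\<beta>. shift \<rho> (\<lambda>\<rho>. shift \<sigma> (\<lambda>\<sigma>. curv F \<alpha> \<beta> \<rho> \<sigma> x))))"

definition xi_tilde :: "field3 \<Rightarrow> field3" where
  "xi_tilde F \<alpha> \<rho> \<sigma> x =
     8 * (2 * (\<Sum>\<beta>\<in>UNIV. \<Sum>\<nu>\<in>UNIV. F_uud F \<beta> \<nu> \<rho> x * pd \<beta> (F_ddd F \<alpha> \<sigma> \<nu>) x)
          + (\<Sum>\<beta>\<in>UNIV. \<Sum>\<nu>\<in>UNIV. F_uud F \<beta> \<nu> \<rho> x * pd \<alpha> (F_ddd F \<beta> \<nu> \<sigma>) x)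
          + (\<Sum>\<beta>\<in>UNIV. \<Sum>\<nu>\<in>UNIV. F_ddu F \<alpha> \<rho> \<nu> x * pd \<beta> (F_udd F \<beta> \<sigma> \<nu>) x))
     - 32 * ((\<Sum>\<beta>\<in>UNIV. \<Sum>\<mu>\<in>UNIV. \<Sum>\<nu>\<in>UNIV.
                F_ddd F \<beta> \<rho> \<mu> x * F_duu F \<alpha> \<mu> \<nu> x * F_udd F \<beta> \<nu> \<sigma> x)
             - (\<Sum>\<beta>\<in>UNIV. \<Sum>\<mu>\<in>UNIV. \<Sum>\<nu>\<in>UNIV.
                F_ddd F \<beta> \<rho> \<mu> x * F \<beta> \<mu> \<nu> x * F_ddd F \<alpha> \<nu> \<sigma> x))
     + (\<Sum>\<beta>\<in>UNIV. pd \<beta> (\<lambda>y. shift \<beta> (\<lambda>\<mu>. pd \<mu> (F_ddd F \<alpha> \<rho> \<sigma>) y)) x)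
     - (\<Sum>\<beta>\<in>UNIV. pd \<beta> (pd \<alpha> (F_udd F \<beta> \<rho> \<sigma>)) x)"

definition xi :: "field3 \<Rightarrow> field3" where
  "xi F \<alpha> \<rho> \<sigma> x = 1/2 * (xi_tilde F \<alpha> \<rho> \<sigma> x - xi_tilde F \<alpha> \<sigma> \<rho> x)"

definition chi ::
    "real \<Rightarrow> (spacetime \<Rightarrow> form) \<Rightarrow> 4 \<Rightarrow> 4 \<Rightarrow> 4 \<Rightarrow> spacetime \<Rightarrow> complex" where
  "chi \<tau> \<psi> \<alpha> \<rho> \<sigma> x = of_real (1 / (128 * \<tau>)) *
     dagger_prod (\<psi> x) (eta_hat *v (gamma \<alpha> *v (Theta [\<rho>, \<sigma>] *v \<psi> x)))"

text \<open>For \<open>T\<close> antisymmetric in its last two (lower) indices, \<open>fierz_part T\<close> is \<open>T\<close> without its trace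
  and totally antisymmetric parts. Since upper \<open>\<epsilon>\<close> has the opposite sign of lower \<open>\<epsilon>\<close>, the product
  \<open>eps\<close> \<open>eps_up\<close> contracted with \<open>T\<close> is \<open>-6\<close> times the totally antisymmetric part; hence the
  sign \<open>+1/6\<close> here. With upper \<open>\<epsilon>\<^sup>0\<^sup>1\<^sup>2\<^sup>3 = 1\<close> it would be \<open>-1/6\<close>.\<close>

definition fierz_part :: "(4 \<Rightarrow> 4 \<Rightarrow> 4 \<Rightarrow> complex) \<Rightarrow> 4 \<Rightarrow> 4 \<Rightarrow> 4 \<Rightarrow> complex" where
  "fierz_part T \<alpha> \<rho> \<sigma> =
     T \<alpha> \<rho> \<sigma>
     - 1/3 * of_real (eta \<alpha> \<rho>) * (\<Sum>\<beta>\<in>UNIV. shift \<beta> (\<lambda>\<mu>. T \<mu> \<beta> \<sigma>))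
     + 1/3 * of_real (eta \<alpha> \<sigma>) * (\<Sum>\<beta>\<in>UNIV. shift \<beta> (\<lambda>\<mu>. T \<mu> \<beta> \<rho>))
     + 1/6 * (\<Sum>\<omega>\<in>UNIV. \<Sum>\<kappa>\<in>UNIV. \<Sum>\<mu>\<in>UNIV. \<Sum>\<nu>\<in>UNIV.
                of_real (eps \<alpha> \<rho> \<sigma> \<omega> * eps_up \<kappa> \<mu> \<nu> \<omega>) * T \<kappa> \<mu> \<nu>)"


section \<open>The constrained field equation\<close>

text \<open>Stationarity at \<open>F\<close> of the integral of \<open>L\<close>. The variation vanishes outside \<open>K\<close>, so only
  the integral over \<open>K\<close> can change; the integral over the whole space need not exist.\<close>

definition stationary :: "(field3 \<Rightarrow> spacetime \<Rightarrow> complex) \<Rightarrow> field3 \<Rightarrow> bool" where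
  "stationary L F \<longleftrightarrow> (\<forall>f K.
     smooth_field f \<longrightarrow> Fierz f \<longrightarrow> compact K \<longrightarrow> (\<forall>\<alpha> \<rho> \<sigma>. \<forall>x. x \<notin> K \<longrightarrow> f \<alpha> \<rho> \<sigma> x = 0) \<longrightarrow>
     ((\<lambda>s. LINT x:K|lborel. L (\<lambda>\<alpha> \<rho> \<sigma> x. F \<alpha> \<rho> \<sigma> x + s * f \<alpha> \<rho> \<sigma> x) x)
        has_vector_derivative 0) (at 0))"

definition Lagrangian ::
    "real \<Rightarrow> real \<Rightarrow> (spacetime \<Rightarrow> form) \<Rightarrow> field3 \<Rightarrow> spacetime \<Rightarrow> complex" where
  "Lagrangian m \<tau> \<psi> F x = L_K m (X_field F) \<psi> x - of_real \<tau> * L_V (X_field F) x"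

end

theory Submission
  imports Defs
begin

text \<open>Write \<open>W\<^sub>\<alpha>\<close> for the wedge product with \<open>e\<^sub>\<alpha>\<close>, so that \<open>\<gamma>\<^sub>\<alpha> = W\<^sub>\<alpha> - \<iota>\<^sub>\<alpha>\<close>, and put \<open>\<delta>\<^sub>\<alpha> = W\<^sub>\<alpha> + \<iota>\<^sub>\<alpha>\<close>.
  The \<open>\<delta>\<^sub>\<alpha>\<close> anticommute with the gamma matrices and form a Clifford algebra for \<open>\<eta>\<close>, whence
  \<open>\<Theta>\<^sub>\<rho>\<^sub>\<sigma> = \<delta>\<^sub>\<rho> \<delta>\<^sub>\<sigma> - \<eta>\<^sub>\<rho>\<^sub>\<sigma>\<close>. Their commutators and traces turn \<open>\<Omega>\<close> into the curvature of an
  so(1,3) connection and give \<open>L\<^sub>V\<close>. Under the form \<open>\<psi>\<^sup>\<dagger> \<eta>\<close>-hat \<open>\<phi>\<close> the contraction is the adjoint of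
  the wedge operator, so \<open>\<gamma>\<^sub>\<alpha> \<Theta>\<^sub>\<rho>\<^sub>\<sigma>\<close> is self-adjoint and \<open>\<chi>\<close> is real. Along \<open>F + s f\<close> the Lagrangian is
  a polynomial in \<open>s\<close>; up to a divergence its linear coefficient pairs \<open>f\<close> with \<open>128 \<tau> (\<chi> - \<xi>)\<close>, since
  \<open>\<xi>\<close> is the covariant divergence of the curvature. Only the Fierz projection of \<open>\<chi> - \<xi>\<close> is seen by Fierz
  fields \<open>f\<close>, and the fundamental lemma makes it vanish.\<close>

section \<open>Wedge and contraction operators\<close>

text \<open>The constant 128 in \<chi> is a product of four effects. The identity on sixteen
  dimensions has trace 16. Of the three ways to contract a product of two antisymmetric pairs, two
  survive and agree, which gives 32. The curvature enters the Lagrangian squared, which gives 64 on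
  linearizing. Its antisymmetry in the first two indices lets both halves of its linearization
  contribute equally, which gives 128. The 4 in the curvature arises similarly: the commutator of
  two products of Clifford generators has four terms, equal in pairs, each with the 2 of the
  Clifford relation. The contraction and \<Theta> are specified only by their properties, so each
  explicit matrix needs existence and uniqueness before it can be used. The other obstacle is the
  constraint: admissible variations fill only a linear subspace at each point, so a vanishing first
  variation determines the field expression only up to what that subspace annihilates.\<close>

definition wedge_sign :: "4 \<Rightarrow> 4 set \<Rightarrow> real" where
  "wedge_sign \<alpha> B = (\<Prod>b\<in>B. order_sign \<alpha> b)"

text \<open>Row \<open>C\<close> is the output and column \<open>A\<close> the input. Each element
  of \<open>A\<close> below \<alpha> is a transposition needed to carry the new factor to its place
  in the increasing order, and \<open>wedge_sign \<alpha> A\<close> collects the signs.\<close>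

definition wedge_op :: "4 \<Rightarrow> op16" where
  "wedge_op \<alpha> = (\<chi> C A. if \<alpha> \<in> C \<and> A = C - {\<alpha>} then of_real (wedge_sign \<alpha> A) else 0)"

text \<open>The candidate for \<open>iota \<alpha>\<close>. The removed factor first has to be moved
  to the front, hence the same sign as in \<open>wedge_op\<close>; since the metric is diagonal,
  only the factor \<alpha> itself can be removed.\<close>

definition contr_op :: "4 \<Rightarrow> op16" where
  "contr_op \<alpha> = (\<chi> C A. if \<alpha> \<notin> C \<and> A = insert \<alpha> C then of_real (eta \<alpha> \<alpha> * wedge_sign \<alpha> C) else 0)"

lemma wedge_op_nth: "(wedge_op \<alpha> *v \<psi>) $ C = (if \<alpha> \<in> C then of_real (wedge_sign \<alpha> (C - {\<alpha>})) * \<psi> $ (C - {\<alpha>}) else 0)"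
proof -
  have "(\<Sum>A\<in>UNIV. (if \<alpha> \<in> C \<and> A = C - {\<alpha>} then of_real (wedge_sign \<alpha> A) else 0) * \<psi> $ A)
     = (\<Sum>A\<in>UNIV. if A = C - {\<alpha>} then (if \<alpha> \<in> C then of_real (wedge_sign \<alpha> (C - {\<alpha>})) * \<psi> $ (C - {\<alpha>}) else 0) else 0)"
    by (rule sum.cong) auto
  then show ?thesis by (simp add: wedge_op_def matrix_vector_mult_def)
qed

lemma contr_op_nth: "(contr_op \<alpha> *v \<psi>) $ C = (if \<alpha> \<notin> C then of_real (eta \<alpha> \<alpha> * wedge_sign \<alpha> C) * \<psi> $ (insert \<alpha> C) else 0)"
proof -
  have "(\<Sum>A\<in>UNIV. (if \<alpha> \<notin> C \<and> A = insert \<alpha> C then of_real (eta \<alpha> \<alpha> * wedge_sign \<alpha> C) else 0) * \<psi> $ A)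
     = (\<Sum>A\<in>UNIV. if A = insert \<alpha> C then (if \<alpha> \<notin> C then of_real (eta \<alpha> \<alpha> * wedge_sign \<alpha> C) * \<psi> $ (insert \<alpha> C) else 0) else (0::complex))"
    by (rule sum.cong) auto
  then show ?thesis by (simp add: contr_op_def matrix_vector_mult_def)
qed

lemma wedge_sign_remove: "\<beta> \<in> C \<Longrightarrow> wedge_sign \<alpha> C = order_sign \<alpha> \<beta> * wedge_sign \<alpha> (C - {\<beta>})"
  unfolding wedge_sign_def by (rule prod.remove) auto

lemma wedge_sign_insert: "\<beta> \<notin> C \<Longrightarrow> wedge_sign \<alpha> (insert \<beta> C) = order_sign \<alpha> \<beta> * wedge_sign \<alpha> C"
  unfolding wedge_sign_def by (rule prod.insert) auto

lemma order_sign_antisym: "order_sign a b = - order_sign b a"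
  by (auto simp: order_sign_def)

lemma order_sign_sq: "a \<noteq> b \<Longrightarrow> order_sign a b * order_sign a b = 1"
  by (auto simp: order_sign_def)

lemma wedge_sign_sq: "\<alpha> \<notin> C \<Longrightarrow> wedge_sign \<alpha> C * wedge_sign \<alpha> C = 1"
  unfolding wedge_sign_def prod.distrib[symmetric]
  by (rule prod.neutral) (metis order_sign_sq)

lemma wedge_axis: "wedge (axis {\<alpha>} 1) \<psi> = wedge_op \<alpha> *v \<psi>"
proof (unfold vec_eq_iff, rule allI)
  fix C
  have "(\<Sum>A\<in>Pow C. of_real (shuffle_sign A (C - A)) * (axis {\<alpha>} 1 :: form) $ A * \<psi> $ (C - A)) =
    (\<Sum>A\<in>Pow C. if A = {\<alpha>} then of_real (wedge_sign \<alpha> (C - {\<alpha>})) * \<psi> $ (C - {\<alpha>}) else 0)"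
    by (rule sum.cong) (auto simp: axis_def shuffle_sign_def wedge_sign_def)
  then show "wedge (axis {\<alpha>} 1) \<psi> $ C = (wedge_op \<alpha> *v \<psi>) $ C"
    by (simp add: wedge_def wedge_op_nth)
qed

lemma bas_Nil: "bas [] = axis {} 1" by (simp add: bas_def)
lemma bas_Cons: "bas (\<alpha> # I) = wedge_op \<alpha> *v bas I" by (simp add: bas_def wedge_axis)

lemma bas_single: "bas [\<alpha>] = axis {\<alpha>} 1"
  unfolding vec_eq_iff
  by (auto simp: bas_Cons bas_Nil wedge_op_nth axis_def wedge_sign_def)

lemma wedge_bas: "wedge (bas [\<alpha>]) \<psi> = wedge_op \<alpha> *v \<psi>"
  by (simp add: bas_single wedge_axis)

text \<open>For distinct indices the two orders insert the same factors and differ only in whether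
  \<alpha> is compared with \<beta> or \<beta> with \<alpha>, and these order signs are
  opposite.\<close>

lemma wedge_op_wedge_op: "wedge_op \<alpha> *v (wedge_op \<beta> *v \<psi>) = - (wedge_op \<beta> *v (wedge_op \<alpha> *v \<psi>))"
proof (cases "\<alpha> = \<beta>")
  case True then show ?thesis by (auto simp: vec_eq_iff wedge_op_nth)
next
  case False
  have "(wedge_op \<alpha> *v (wedge_op \<beta> *v \<psi>)) $ C = - (wedge_op \<beta> *v (wedge_op \<alpha> *v \<psi>)) $ C" for C
  proof (cases "\<alpha> \<in> C \<and> \<beta> \<in> C")
    case True
    have "wedge_sign \<alpha> (C - {\<alpha>}) = order_sign \<alpha> \<beta> * wedge_sign \<alpha> (C - {\<alpha>} - {\<beta>})"
      "wedge_sign \<beta> (C - {\<beta>}) = - order_sign \<alpha> \<beta> * wedge_sign \<beta> (C - {\<beta>} - {\<alpha>})"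
      using wedge_sign_remove[of \<beta> "C - {\<alpha>}" \<alpha>] wedge_sign_remove[of \<alpha> "C - {\<beta>}" \<beta>] True False
        order_sign_antisym[of \<beta> \<alpha>] by auto
    moreover have "C - {\<beta>} - {\<alpha>} = C - {\<alpha>} - {\<beta>}" by auto
    ultimately show ?thesis using True False by (simp add: wedge_op_nth)
  qed (auto simp: wedge_op_nth)
  then show ?thesis by (simp add: vec_eq_iff)
qed

lemma contr_op_contr_op: "contr_op \<alpha> *v (contr_op \<beta> *v \<psi>) = - (contr_op \<beta> *v (contr_op \<alpha> *v \<psi>))"
proof (cases "\<alpha> = \<beta>")
  case True then show ?thesis by (auto simp: vec_eq_iff contr_op_nth)
next
  case False
  have "(contr_op \<alpha> *v (contr_op \<beta> *v \<psi>)) $ C = - (contr_op \<beta> *v (contr_op \<alpha> *v \<psi>)) $ C" for C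
  proof (cases "\<alpha> \<notin> C \<and> \<beta> \<notin> C")
    case True
    have "wedge_sign \<alpha> (insert \<beta> C) = order_sign \<alpha> \<beta> * wedge_sign \<alpha> C"
      "wedge_sign \<beta> (insert \<alpha> C) = - order_sign \<alpha> \<beta> * wedge_sign \<beta> C"
      using wedge_sign_insert[of \<beta> "C" \<alpha>] wedge_sign_insert[of \<alpha> "C" \<beta>] True False
        order_sign_antisym[of \<beta> \<alpha>] by auto
    then show ?thesis using True False by (simp add: contr_op_nth insert_commute)
  qed (auto simp: contr_op_nth)
  then show ?thesis by (simp add: vec_eq_iff)
qed

text \<open>For equal indices exactly one of the two products acts nontrivially on a given
  component, depending on whether it contains \<alpha>, and there the sign occurs squared. For
  distinct indices the factor inserted by one operator flips the sign of the other.\<close>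

lemma contr_op_wedge_op: "contr_op \<alpha> *v (wedge_op \<beta> *v \<psi>) = eta \<alpha> \<beta> *\<^sub>R \<psi> - wedge_op \<beta> *v (contr_op \<alpha> *v \<psi>)"
proof -
  have "(contr_op \<alpha> *v (wedge_op \<beta> *v \<psi>)) $ C = eta \<alpha> \<beta> *\<^sub>R \<psi> $ C - (wedge_op \<beta> *v (contr_op \<alpha> *v \<psi>)) $ C" for C
  proof (cases "\<alpha> = \<beta>")
    case True
    have "wedge_sign \<alpha> (C - {\<alpha>}) * wedge_sign \<alpha> (C - {\<alpha>}) = 1" by (rule wedge_sign_sq) auto
    then show ?thesis using True
      by (auto simp: wedge_op_nth contr_op_nth insert_absorb scaleR_conv_of_real simp flip: of_real_mult)
  next
    case ne: False
    show ?thesis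
    proof (cases "\<beta> \<in> C \<and> \<alpha> \<notin> C")
      case True
      have "wedge_sign \<alpha> C = order_sign \<alpha> \<beta> * wedge_sign \<alpha> (C - {\<beta>})"
        using wedge_sign_remove[of \<beta> "C" \<alpha>] True by simp
      moreover have "wedge_sign \<beta> (insert \<alpha> (C - {\<beta>})) = - order_sign \<alpha> \<beta> * wedge_sign \<beta> (C - {\<beta>})"
        using wedge_sign_insert[of \<alpha> "C - {\<beta>}" \<beta>] True ne order_sign_antisym[of \<beta> \<alpha>] by auto
      moreover have "insert \<alpha> C - {\<beta>} = insert \<alpha> (C - {\<beta>})" using ne by auto
      moreover have "order_sign \<alpha> \<beta> * order_sign \<alpha> \<beta> = 1" using ne by (rule order_sign_sq)
      moreover have "eta \<alpha> \<beta> = 0" using ne by (simp add: eta_def)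
      ultimately show ?thesis using True ne
        by (simp add: wedge_op_nth contr_op_nth flip: of_real_mult)
    qed (use ne in \<open>auto simp: wedge_op_nth contr_op_nth eta_def\<close>)
  qed
  then show ?thesis by (simp add: vec_eq_iff)
qed

lemma contr_op_one: "contr_op \<alpha> *v axis {} 1 = 0"
  by (auto simp: vec_eq_iff contr_op_nth axis_def)

text \<open>Linear maps in finite dimension are bounded, so the locale of bounded bilinear maps
  applies. It supplies the rules for sums, scalars and signs used in all later matrix computations,
  and for \<open>op_apply\<close> also continuity.\<close>

lemma op_mult_bilinear: "bounded_bilinear ((**) :: op16 \<Rightarrow> op16 \<Rightarrow> op16)"
  unfolding bilinear_conv_bounded_bilinear[symmetric] bilinear_def
  by (intro conjI allI linearI; simp add: vec_eq_iff matrix_matrix_mult_def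
      algebra_simps sum.distrib scaleR_sum_right)

interpretation op_mult: bounded_bilinear "(**) :: op16 \<Rightarrow> op16 \<Rightarrow> op16" by (rule op_mult_bilinear)

lemma op_apply_bilinear: "bounded_bilinear ((*v) :: op16 \<Rightarrow> form \<Rightarrow> form)"
  unfolding bilinear_conv_bounded_bilinear[symmetric] bilinear_def
  by (intro conjI allI linearI; simp add: vec_eq_iff matrix_vector_mult_def
      algebra_simps sum.distrib scaleR_sum_right)

interpretation op_apply: bounded_bilinear "(*v) :: op16 \<Rightarrow> form \<Rightarrow> form" by (rule op_apply_bilinear)


section \<open>The Leibniz rule and the uniqueness of the contraction\<close>

lemma shuffle_sign_insert:
  "\<beta> \<notin> A \<Longrightarrow> shuffle_sign (insert \<beta> A) B = wedge_sign \<beta> B * shuffle_sign A B"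
  by (simp add: shuffle_sign_def wedge_sign_def)

text \<open>Associativity with a one-form in front, which suffices because monomials are built one
  factor at a time. Only subsets containing \<beta> contribute; removing \<beta> from them leaves
  the subsets of the smaller set, and the sign of \<beta> against that set splits over a subset and
  its complement.\<close>

lemma wedge_wedge_op: "wedge (wedge_op \<beta> *v a) b = wedge_op \<beta> *v wedge a b"
proof (unfold vec_eq_iff, rule allI)
  fix C
  let ?g = "\<lambda>A. of_real (shuffle_sign A (C - A)) * (wedge_op \<beta> *v a) $ A * b $ (C - A)"
  show "wedge (wedge_op \<beta> *v a) b $ C = (wedge_op \<beta> *v wedge a b) $ C"
  proof (cases "\<beta> \<in> C")
    case False
    have "?g A = 0" if "A \<in> Pow C" for A
      using that False by (auto simp: wedge_op_nth)
    then have "sum ?g (Pow C) = 0" by (rule sum.neutral[OF ballI])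
    then show ?thesis using False by (simp add: wedge_def wedge_op_nth)
  next
    case True
    let ?D = "C - {\<beta>}"
    have P: "Pow C = Pow ?D \<union> insert \<beta> ` Pow ?D"
      using Pow_insert[of \<beta> ?D] True by (simp add: insert_absorb)
    have inj: "inj_on (insert \<beta>) (Pow ?D)"
      by (rule inj_onI) (metis Diff_insert_absorb Pow_iff insert_Diff_single insert_absorb subset_Diff_insert subset_insert_iff)
    have "sum ?g (Pow C) = sum ?g (Pow ?D) + sum ?g (insert \<beta> ` Pow ?D)"
      unfolding P by (rule sum.union_disjoint) auto
    also have "sum ?g (Pow ?D) = 0"
      by (rule sum.neutral) (auto simp: wedge_op_nth)
    also have "sum ?g (insert \<beta> ` Pow ?D) = (\<Sum>A\<in>Pow ?D. ?g (insert \<beta> A))"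
      using inj by (simp add: sum.reindex)
    also have "\<dots> = (\<Sum>A\<in>Pow ?D. of_real (wedge_sign \<beta> ?D) * (of_real (shuffle_sign A (?D - A)) * a $ A * b $ (?D - A)))"
    proof (rule sum.cong)
      fix A assume A: "A \<in> Pow ?D"
      then have nb: "\<beta> \<notin> A" by auto
      have D: "C - insert \<beta> A = ?D - A" by auto
      have "wedge_sign \<beta> ?D = wedge_sign \<beta> (?D - A) * wedge_sign \<beta> A"
        unfolding wedge_sign_def using A by (intro prod.subset_diff) auto
      then show "?g (insert \<beta> A) = of_real (wedge_sign \<beta> ?D) * (of_real (shuffle_sign A (?D - A)) * a $ A * b $ (?D - A))"
        using nb by (simp add: D wedge_op_nth shuffle_sign_insert)
    qed simp
    finally show ?thesis using True by (simp add: wedge_def wedge_op_nth sum_distrib_left)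
  qed
qed

lemma wedge_add_left: "wedge (a + b) c = wedge a c + wedge b c"
  by (simp add: vec_eq_iff wedge_def algebra_simps sum.distrib)
lemma wedge_scaleR_left: "wedge (r *\<^sub>R a) c = r *\<^sub>R wedge a c"
  by (simp add: vec_eq_iff wedge_def scaleR_sum_right)
lemma wedge_diff_left: "wedge (a - b) c = wedge a c - wedge b c"
  using wedge_add_left[of "a-b" b c] by (simp add: algebra_simps)
lemma wedge_scaleR_right: "wedge c (r *\<^sub>R a) = r *\<^sub>R wedge c a"
  by (simp add: vec_eq_iff wedge_def scaleR_sum_right)

lemma wedge_one_left: "wedge (axis {} 1) \<psi> = \<psi>"
proof -
  have "(\<Sum>A\<in>Pow C. of_real (shuffle_sign A (C - A)) * (axis {} 1 :: form) $ A * \<psi> $ (C - A)) =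
    (\<Sum>A\<in>Pow C. if A = {} then \<psi> $ C else 0)" for C
    by (rule sum.cong) (auto simp: axis_def shuffle_sign_def)
  then show ?thesis by (simp add: vec_eq_iff wedge_def)
qed

lemma wedge_zero_left: "wedge 0 \<psi> = 0"
  by (simp add: vec_eq_iff wedge_def)

text \<open>Each factor of the monomial that the contraction passes costs one sign by
  \<open>contr_op_wedge_op\<close>; the induction runs over these factors and leaves the right
  factor arbitrary.\<close>

lemma contr_op_wedge_bas:
  "contr_op \<alpha> *v wedge (bas I) \<phi> = wedge (contr_op \<alpha> *v bas I) \<phi> + (-1) ^ length I *\<^sub>R wedge (bas I) (contr_op \<alpha> *v \<phi>)"
proof (induction I)
  case Nil
  then show ?case by (simp add: bas_Nil wedge_one_left contr_op_one wedge_zero_left)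
next
  case (Cons \<beta> I)
  have "contr_op \<alpha> *v wedge (bas (\<beta> # I)) \<phi> = eta \<alpha> \<beta> *\<^sub>R wedge (bas I) \<phi> - wedge_op \<beta> *v (contr_op \<alpha> *v wedge (bas I) \<phi>)"
    by (simp add: bas_Cons wedge_wedge_op contr_op_wedge_op)
  also have "wedge_op \<beta> *v (contr_op \<alpha> *v wedge (bas I) \<phi>) =
      wedge (wedge_op \<beta> *v (contr_op \<alpha> *v bas I)) \<phi> + (-1) ^ length I *\<^sub>R wedge (wedge_op \<beta> *v bas I) (contr_op \<alpha> *v \<phi>)"
    by (simp add: Cons.IH wedge_wedge_op matrix_vector_right_distrib op_apply.scaleR_right)
  finally show ?case
    by (simp add: bas_Cons contr_op_wedge_op wedge_diff_left wedge_scaleR_left)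
qed

text \<open>The monomials exhaust the basis up to scalars, so a linear operator is determined by its
  values on them. The scalar is moved across with \<open>wedge_sign\<close>, which is its own
  inverse off its zeros.\<close>

lemma axis_span_bas: "\<exists>I. \<exists>r::real. axis A 1 = r *\<^sub>R bas I"
proof (induction rule: finite_induct[OF finite[of A]])
  case 1
  show ?case by (rule exI[of _ "[]"], rule exI[of _ 1]) (simp add: bas_Nil)
next
  case (2 a A)
  then obtain I r where Ir: "axis A 1 = r *\<^sub>R bas I" by blast
  have "wedge_op a *v axis A 1 = wedge_sign a A *\<^sub>R axis (insert a A) 1"
    using 2 by (auto simp: vec_eq_iff wedge_op_nth axis_def scaleR_conv_of_real[where 'a=complex])
  then have "axis (insert a A) 1 = wedge_sign a A *\<^sub>R (wedge_op a *v axis A 1)"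
    using wedge_sign_sq[OF 2(2)] by simp
  also have "\<dots> = (wedge_sign a A * r) *\<^sub>R bas (a # I)"
    by (simp add: Ir bas_Cons op_apply.scaleR_right)
  finally show ?case by blast
qed

lemma op16_mult_axis: "((M::op16) *v axis C 1) $ i = M $ i $ C"
  by (simp add: matrix_vector_mult_def axis_def if_distrib cong: if_cong)

lemma op16_eqI: "(\<And>C. (M::op16) *v axis C 1 = N *v axis C 1) \<Longrightarrow> M = N"
  by (simp only: vec_eq_iff op16_mult_axis) blast

lemma is_contraction_contr_op: "is_contraction \<alpha> (contr_op \<alpha>)"
  unfolding is_contraction_def
  by (simp add: bas_Nil contr_op_one contr_op_wedge_bas) (simp add: bas_Cons bas_Nil contr_op_wedge_op contr_op_one)

text \<open>The Leibniz rule with a one-letter left factor computes the value on a monomial from the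
  value on the shorter monomial, and monomials span.\<close>

lemma is_contraction_unique:
  assumes "is_contraction \<alpha> M" "is_contraction \<alpha> N" shows "M = N"
proof -
  have "M *v bas I = N *v bas I" for I
  proof (induction I)
    case Nil show ?case using assms by (simp add: is_contraction_def)
  next
    case (Cons \<beta> I)
    have *: "bas (\<beta> # I) = wedge (bas [\<beta>]) (bas I)" by (simp add: wedge_bas bas_Cons[of _ I])
    have "L *v bas (\<beta> # I) = wedge (eta \<alpha> \<beta> *\<^sub>R bas []) (bas I) - wedge (bas [\<beta>]) (L *v bas I)"
      if "is_contraction \<alpha> L" for L
      using that unfolding * is_contraction_def by (simp add: wedge_scaleR_right)
    then show ?case using assms Cons.IH by simp
  qed
  then show ?thesis
    by (metis op16_eqI axis_span_bas op_apply.scaleR_right)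
qed

lemma iota_eq: "iota \<alpha> = contr_op \<alpha>"
  unfolding iota_def by (rule the_equality) (auto intro: is_contraction_contr_op is_contraction_unique)

lemma gamma_eq: "gamma \<alpha> = wedge_op \<alpha> - contr_op \<alpha>"
  by (simp add: gamma_def wedge_bas iota_eq matrix_vector_mult_diff_rdistrib[symmetric])

section \<open>The second Clifford action\<close>

text \<open>These operators anticommute with all gamma matrices, so products of two of them lie in the
  commutant.\<close>

definition delta :: "4 \<Rightarrow> op16" where "delta \<alpha> = wedge_op \<alpha> + contr_op \<alpha>"

lemma op16_ext: "(\<And>\<psi>. (M::op16) *v \<psi> = N *v \<psi>) \<Longrightarrow> M = N"
  using op16_eqI by blast

lemma scaleR_mult_2_form: "(c * 2) *\<^sub>R (v::form) = c *\<^sub>R (v * 2)"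
  by (simp add: vec_eq_iff scaleR_conv_of_real[where 'a=complex])

lemma delta_delta: "delta \<alpha> ** delta \<beta> = (2 * eta \<alpha> \<beta>) *\<^sub>R mat 1 - delta \<beta> ** delta \<alpha>"
proof (rule op16_ext)
  fix \<psi>
  have s: "eta \<beta> \<alpha> = eta \<alpha> \<beta>" by (simp add: eta_def)
  show "(delta \<alpha> ** delta \<beta>) *v \<psi> = ((2 * eta \<alpha> \<beta>) *\<^sub>R mat 1 - delta \<beta> ** delta \<alpha>) *v \<psi>"
    unfolding delta_def
    by (simp add: op_apply.diff_left op_apply.add_left op_apply.add_right matrix_vector_mul_assoc[symmetric] op_apply.scaleR_left
        contr_op_wedge_op contr_op_contr_op[of \<alpha>] wedge_op_wedge_op[of \<alpha>] s scaleR_mult_2_form algebra_simps)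
qed

text \<open>In the anticommutator the mixed products of wedge and contraction contribute \<eta> once
  with each sign, because the contraction enters \<open>delta\<close> and \<open>gamma\<close> with
  opposite signs.\<close>

lemma delta_gamma: "delta \<alpha> ** gamma \<beta> = - (gamma \<beta> ** delta \<alpha>)"
proof (rule op16_ext)
  fix \<psi>
  have s: "eta \<beta> \<alpha> = eta \<alpha> \<beta>" by (simp add: eta_def)
  show "(delta \<alpha> ** gamma \<beta>) *v \<psi> = (- (gamma \<beta> ** delta \<alpha>)) *v \<psi>"
    unfolding delta_def gamma_eq
    by (simp add: op_apply.diff_left op_apply.add_left op_apply.add_right op_apply.diff_right op_apply.minus_left matrix_vector_mul_assoc[symmetric] op_apply.scaleR_left
        contr_op_wedge_op contr_op_contr_op[of \<alpha>] wedge_op_wedge_op[of \<alpha>] s algebra_simps)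
qed

text \<open>The gamma matrices generate the whole exterior algebra from \<open>e\<^sub>\<emptyset>\<close>, because the contraction part of
  \<open>\<gamma>\<^sub>a\<close> kills \<open>e\<^sub>A\<close> when \<open>a\<close> is not in \<open>A\<close>.\<close>

lemma commutant_unique:
  assumes "\<And>\<alpha>. T ** gamma \<alpha> = gamma \<alpha> ** T" "\<And>\<alpha>. S ** gamma \<alpha> = gamma \<alpha> ** S"
    and 0: "T *v axis {} 1 = S *v axis {} 1"
  shows "T = S"
proof (rule op16_eqI)
  fix C show "T *v axis C 1 = S *v axis C 1"
  proof (induction rule: finite_induct[OF finite[of C]])
    case 1 show ?case by (rule 0)
  next
    case (2 a A)
    have "gamma a *v axis A 1 = wedge_sign a A *\<^sub>R axis (insert a A) 1"
      using 2 by (auto simp: vec_eq_iff gamma_eq op_apply.diff_left wedge_op_nth contr_op_nth axis_def scaleR_conv_of_real[where 'a=complex])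
    then have *: "axis (insert a A) 1 = wedge_sign a A *\<^sub>R (gamma a *v axis A 1)"
      using wedge_sign_sq[OF 2(2)] by simp
    show ?case unfolding * using assms(1,2) 2(3)
      by (simp add: op_apply.scaleR_right matrix_vector_mul_assoc) (simp flip: matrix_vector_mul_assoc)
  qed
qed

text \<open>A product of two \<open>delta\<close> changes sign twice when a gamma matrix passes it.
  Applied to the unit it yields the wanted two-form plus \<eta>(\<rho>, \<sigma>) times the unit,
  and the scalar matrix removes this remainder.\<close>

lemma Theta_eq: "Theta [\<rho>, \<sigma>] = delta \<rho> ** delta \<sigma> - eta \<rho> \<sigma> *\<^sub>R mat 1"
proof -
  let ?T = "delta \<rho> ** delta \<sigma> - eta \<rho> \<sigma> *\<^sub>R mat 1"
  have c: "?T ** gamma \<alpha> = gamma \<alpha> ** ?T" for \<alpha>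
  proof -
    have "delta \<rho> ** delta \<sigma> ** gamma \<alpha> = delta \<rho> ** (delta \<sigma> ** gamma \<alpha>)"
      by (simp add: matrix_mul_assoc)
    also have "\<dots> = - ((delta \<rho> ** gamma \<alpha>) ** delta \<sigma>)"
      by (simp add: delta_gamma op_mult.minus_right matrix_mul_assoc)
    also have "\<dots> = gamma \<alpha> ** (delta \<rho> ** delta \<sigma>)"
      by (simp add: delta_gamma op_mult.minus_left matrix_mul_assoc)
    finally show ?thesis by (simp add: op_mult.diff_left op_mult.diff_right op_mult.scaleR_left op_mult.scaleR_right)
  qed
  have "?T *v bas [] = bas [\<rho>, \<sigma>]"
    unfolding delta_def
    by (simp add: bas_Cons bas_Nil op_apply.diff_left op_apply.add_left op_apply.add_right op_apply.scaleR_left matrix_vector_mul_assoc[symmetric] contr_op_one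
       contr_op_wedge_op)
  then have T: "is_Theta [\<rho>, \<sigma>] ?T" using c unfolding is_Theta_def by blast
  have "S = ?T" if "is_Theta [\<rho>, \<sigma>] S" for S
  proof (rule commutant_unique)
    show "S *v axis {} 1 = ?T *v axis {} 1"
      using T that unfolding is_Theta_def bas_Nil by metis
  qed (use T that in \<open>unfold is_Theta_def, blast+\<close>)
  with T show ?thesis unfolding Theta_def by (rule the_equality)
qed

section \<open>Traces and commutators in the second Clifford algebra\<close>

abbreviation e :: "4 \<Rightarrow> real" where "e \<alpha> \<equiv> eta \<alpha> \<alpha>"

lemma eta_diag_sq: "e \<alpha> * e \<alpha> = 1" "e \<alpha> * (e \<alpha> * x) = x"
  by (auto simp: eta_def)

lemma eta_sym: "eta \<alpha> \<beta> = eta \<beta> \<alpha>" by (simp add: eta_def)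

lemma sum_eta: "(\<Sum>\<beta>\<in>UNIV. eta \<alpha> \<beta> * f \<beta>) = e \<alpha> * f \<alpha>"
proof -
  have "(\<Sum>\<beta>\<in>UNIV. eta \<alpha> \<beta> * f \<beta>) = (\<Sum>\<beta>\<in>UNIV. if \<beta> = \<alpha> then e \<alpha> * f \<alpha> else 0)"
    by (rule sum.cong) (auto simp: eta_def)
  also have "\<dots> = e \<alpha> * f \<alpha>" by (subst sum.delta) auto
  finally show ?thesis .
qed

lemma sum_eta_scaleR:
  fixes f :: "4 \<Rightarrow> op16"
  shows "(\<Sum>\<beta>\<in>UNIV. (eta \<alpha> \<beta> * r \<beta>) *\<^sub>R f \<beta>) = (e \<alpha> * r \<alpha>) *\<^sub>R f \<alpha>"
proof -
  have "(\<Sum>\<beta>\<in>UNIV. (eta \<alpha> \<beta> * r \<beta>) *\<^sub>R f \<beta>) = (\<Sum>\<beta>\<in>UNIV. if \<beta> = \<alpha> then (e \<alpha> * r \<alpha>) *\<^sub>R f \<alpha> else 0)"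
    by (rule sum.cong) (auto simp: eta_def)
  then show ?thesis by simp
qed

lemmas complex_scaleR = scaleR_conv_of_real[where 'a=complex]

lemma trace_zero: "trace (0::op16) = 0" by (simp add: trace_def)

lemma trace_scaleR: "trace (r *\<^sub>R (A::op16)) = r *\<^sub>R trace A"
  by (simp add: trace_def scaleR_sum_right)

lemma trace_sum: "trace (\<Sum>i\<in>S. f i :: op16) = (\<Sum>i\<in>S. trace (f i))"
  by (induction S rule: infinite_finite_induct) (simp_all add: trace_add trace_zero)

text \<open>By cyclicity both orders have the same trace, so the trace of the Clifford relation
  determines it; 16 is the dimension of the exterior algebra.\<close>

lemma trace_delta2: "trace (delta \<rho> ** delta \<sigma>) = of_real (16 * eta \<rho> \<sigma>)"
proof -
  have "trace (delta \<rho> ** delta \<sigma>) = (2 * eta \<rho> \<sigma>) *\<^sub>R 16 - trace (delta \<rho> ** delta \<sigma>)"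
    by (subst delta_delta) (simp add: trace_sub trace_scaleR trace_I trace_mul_sym[of "delta \<sigma>"])
  then show ?thesis by (simp add: complex_scaleR)
qed

text \<open>The factor with index \<rho> is moved to the right past the three others, leaving a
  trace of two factors each time. Cyclicity then returns the original trace with a minus sign, so
  twice that trace is known.\<close>

lemma trace_delta4:
  "trace (delta \<rho> ** delta \<sigma> ** (delta \<mu> ** delta \<nu>)) =
     of_real (16 * (eta \<rho> \<sigma> * eta \<mu> \<nu> - eta \<rho> \<mu> * eta \<sigma> \<nu> + eta \<rho> \<nu> * eta \<sigma> \<mu>))"
proof -
  let ?t = "\<lambda>a b c d. trace (delta a ** delta b ** (delta c ** delta d))"
  have 1: "?t \<rho> \<sigma> \<mu> \<nu> = of_real (32 * eta \<rho> \<sigma> * eta \<mu> \<nu>) - ?t \<sigma> \<rho> \<mu> \<nu>"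
    by (subst delta_delta[of \<rho>]) (simp add: op_mult.diff_left op_mult.scaleR_left trace_sub trace_scaleR trace_delta2 complex_scaleR)
  have 3: "?t \<sigma> \<mu> \<rho> \<nu> = of_real (32 * eta \<rho> \<nu> * eta \<sigma> \<mu>) - ?t \<sigma> \<mu> \<nu> \<rho>"
    by (subst delta_delta[of \<rho>]) (simp add: op_mult.diff_right op_mult.scaleR_right trace_sub trace_scaleR trace_delta2 complex_scaleR)
  have 4: "?t \<sigma> \<mu> \<nu> \<rho> = ?t \<rho> \<sigma> \<mu> \<nu>"
    by (metis matrix_mul_assoc trace_mul_sym)
  have "delta \<sigma> ** delta \<rho> ** (delta \<mu> ** delta \<nu>) = delta \<sigma> ** ((delta \<rho> ** delta \<mu>) ** delta \<nu>)"
    by (simp add: matrix_mul_assoc)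
  also have "\<dots> = (2 * eta \<rho> \<mu>) *\<^sub>R (delta \<sigma> ** delta \<nu>) - delta \<sigma> ** delta \<mu> ** (delta \<rho> ** delta \<nu>)"
    by (subst delta_delta[of \<rho>]) (simp add: op_mult.diff_left op_mult.diff_right op_mult.scaleR_left op_mult.scaleR_right matrix_mul_assoc)
  finally have 2: "?t \<sigma> \<rho> \<mu> \<nu> = of_real (32 * eta \<rho> \<mu> * eta \<sigma> \<nu>) - ?t \<sigma> \<mu> \<rho> \<nu>"
    by (simp add: trace_sub trace_scaleR trace_delta2 complex_scaleR)
  have "2 * ?t \<rho> \<sigma> \<mu> \<nu> = 2 * of_real (16 * (eta \<rho> \<sigma> * eta \<mu> \<nu> - eta \<rho> \<mu> * eta \<sigma> \<nu> + eta \<rho> \<nu> * eta \<sigma> \<mu>))"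
    using 1 2 3 4 by (simp add: algebra_simps)
  then show ?thesis by (metis mult_left_cancel zero_neq_numeral)
qed

text \<open>The commutator of a pair with a single \<open>delta\<close> is again linear in
  \<open>delta\<close>, which is fact \<open>c\<close>. Applying it to both factors of the second
  pair gives the four terms.\<close>

lemma delta4_commutator:
  "delta \<rho> ** delta \<sigma> ** (delta \<mu> ** delta \<nu>) - delta \<mu> ** delta \<nu> ** (delta \<rho> ** delta \<sigma>) =
    (2 * eta \<sigma> \<mu>) *\<^sub>R (delta \<rho> ** delta \<nu>) - (2 * eta \<rho> \<mu>) *\<^sub>R (delta \<sigma> ** delta \<nu>)
    + (2 * eta \<sigma> \<nu>) *\<^sub>R (delta \<mu> ** delta \<rho>) - (2 * eta \<rho> \<nu>) *\<^sub>R (delta \<mu> ** delta \<sigma>)"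
proof -
  have c: "delta \<rho> ** delta \<sigma> ** delta \<mu> = (2 * eta \<sigma> \<mu>) *\<^sub>R delta \<rho> - (2 * eta \<rho> \<mu>) *\<^sub>R delta \<sigma> + delta \<mu> ** delta \<rho> ** delta \<sigma>" for \<mu>
  proof -
    have "delta \<rho> ** delta \<sigma> ** delta \<mu> = delta \<rho> ** (delta \<sigma> ** delta \<mu>)"
      by (simp add: matrix_mul_assoc)
    also have "\<dots> = (2 * eta \<sigma> \<mu>) *\<^sub>R delta \<rho> - delta \<rho> ** delta \<mu> ** delta \<sigma>"
      by (subst delta_delta[of \<sigma>]) (simp add: op_mult.diff_right op_mult.scaleR_right matrix_mul_assoc)
    also have "delta \<rho> ** delta \<mu> ** delta \<sigma> = (2 * eta \<rho> \<mu>) *\<^sub>R delta \<sigma> - delta \<mu> ** delta \<rho> ** delta \<sigma>"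
      by (subst delta_delta[of \<rho>]) (simp add: op_mult.diff_left op_mult.scaleR_left)
    finally show ?thesis by simp
  qed
  have "delta \<rho> ** delta \<sigma> ** (delta \<mu> ** delta \<nu>) = (delta \<rho> ** delta \<sigma> ** delta \<mu>) ** delta \<nu>"
    by (simp add: matrix_mul_assoc)
  also have "\<dots> = (2 * eta \<sigma> \<mu>) *\<^sub>R (delta \<rho> ** delta \<nu>) - (2 * eta \<rho> \<mu>) *\<^sub>R (delta \<sigma> ** delta \<nu>)
     + delta \<mu> ** (delta \<rho> ** delta \<sigma> ** delta \<nu>)"
    by (simp add: c[of \<mu>] op_mult.diff_left op_mult.add_left op_mult.scaleR_left matrix_mul_assoc)
  also have "delta \<mu> ** (delta \<rho> ** delta \<sigma> ** delta \<nu>) =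
     (2 * eta \<sigma> \<nu>) *\<^sub>R (delta \<mu> ** delta \<rho>) - (2 * eta \<rho> \<nu>) *\<^sub>R (delta \<mu> ** delta \<sigma>) + delta \<mu> ** delta \<nu> ** (delta \<rho> ** delta \<sigma>)"
    by (subst c) (simp add: op_mult.diff_right op_mult.add_right op_mult.scaleR_right matrix_mul_assoc)
  finally show ?thesis by simp
qed

text \<open>The spin representation of an antisymmetric tensor, seen as an element of so(1,3). For
  antisymmetric coefficients the scalar part of \<open>Theta\<close> contributes nothing, so bare
  products of \<open>delta\<close> suffice.\<close>

definition spin :: "(4 \<Rightarrow> 4 \<Rightarrow> real) \<Rightarrow> op16" where
  "spin a = (\<Sum>\<rho>\<in>UNIV. \<Sum>\<sigma>\<in>UNIV. a \<rho> \<sigma> *\<^sub>R (delta \<rho> ** delta \<sigma>))"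

lemma spin_add: "spin a + spin b = spin (\<lambda>\<rho> \<sigma>. a \<rho> \<sigma> + b \<rho> \<sigma>)"
  by (simp add: spin_def scaleR_add_left sum.distrib)

lemma spin_diff: "spin a - spin b = spin (\<lambda>\<rho> \<sigma>. a \<rho> \<sigma> - b \<rho> \<sigma>)"
  by (simp add: spin_def scaleR_diff_left sum_subtractf)

lemma spin_scaleR: "r *\<^sub>R spin a = spin (\<lambda>\<rho> \<sigma>. r * a \<rho> \<sigma>)"
  by (simp add: spin_def scaleR_sum_right)

lemma antisym_eta:
  fixes a :: "4 \<Rightarrow> 4 \<Rightarrow> real"
  assumes "\<And>\<rho> \<sigma>. a \<rho> \<sigma> = - a \<sigma> \<rho>" shows "a \<rho> \<sigma> * eta \<rho> \<sigma> = 0"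
proof (cases "\<rho> = \<sigma>")
  case True then have "a \<rho> \<sigma> = 0" using assms[of \<rho> \<sigma>] by simp
  then show ?thesis by simp
qed (simp add: eta_def)

lemma spin_Theta:
  assumes "\<And>\<rho> \<sigma>. a \<rho> \<sigma> = - a \<sigma> \<rho>"
  shows "(\<Sum>\<rho>\<in>UNIV. \<Sum>\<sigma>\<in>UNIV. a \<rho> \<sigma> *\<^sub>R Theta [\<rho>, \<sigma>]) = spin a"
  unfolding spin_def
  by (intro sum.cong refl) (simp only: Theta_eq scaleR_diff_right scaleR_scaleR antisym_eta[of a, OF assms] scaleR_zero_left diff_zero)

text \<open>The contraction inside the first pair vanishes by antisymmetry, and the two mixed
  contractions are negatives of each other under exchange of \<rho> and \<sigma>, hence twice
  16.\<close>

lemma trace_spin_spin: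
  assumes "\<And>\<rho> \<sigma>. a \<rho> \<sigma> = - a \<sigma> \<rho>"
  shows "trace (spin a ** spin b) = of_real (- 32 * (\<Sum>\<rho>\<in>UNIV. \<Sum>\<sigma>\<in>UNIV. a \<rho> \<sigma> * (e \<rho> * e \<sigma> * b \<rho> \<sigma>)))"
proof -
  have "trace (spin a ** spin b) = of_real (\<Sum>\<rho>\<in>UNIV. \<Sum>\<sigma>\<in>UNIV. \<Sum>\<mu>\<in>UNIV. \<Sum>\<nu>\<in>UNIV. a \<rho> \<sigma> * b \<mu> \<nu> *
      (16 * (eta \<rho> \<sigma> * eta \<mu> \<nu> - eta \<rho> \<mu> * eta \<sigma> \<nu> + eta \<rho> \<nu> * eta \<sigma> \<mu>)))"
  proof -
    have "spin a ** spin b = (\<Sum>\<rho>\<in>UNIV. \<Sum>\<sigma>\<in>UNIV. (a \<rho> \<sigma> *\<^sub>R (delta \<rho> ** delta \<sigma>)) ** spin b)"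
      by (simp add: spin_def[of a] op_mult.sum_left)
    also have "\<dots> = (\<Sum>\<rho>\<in>UNIV. \<Sum>\<sigma>\<in>UNIV. \<Sum>\<mu>\<in>UNIV. \<Sum>\<nu>\<in>UNIV. (a \<rho> \<sigma> * b \<mu> \<nu>) *\<^sub>R (delta \<rho> ** delta \<sigma> ** (delta \<mu> ** delta \<nu>)))"
      by (simp add: spin_def op_mult.sum_right op_mult.scaleR_left op_mult.scaleR_right scaleR_sum_right mult.commute)
    finally show ?thesis
      by (simp only: trace_sum trace_scaleR trace_delta4 complex_scaleR of_real_sum flip: of_real_mult)
  qed
  also have "(\<Sum>\<rho>\<in>UNIV. \<Sum>\<sigma>\<in>UNIV. \<Sum>\<mu>\<in>UNIV. \<Sum>\<nu>\<in>UNIV. a \<rho> \<sigma> * b \<mu> \<nu> *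
      (16 * (eta \<rho> \<sigma> * eta \<mu> \<nu> - eta \<rho> \<mu> * eta \<sigma> \<nu> + eta \<rho> \<nu> * eta \<sigma> \<mu>))) =
     (\<Sum>\<rho>\<in>UNIV. \<Sum>\<sigma>\<in>UNIV. 16 * (a \<rho> \<sigma> * (e \<rho> * e \<sigma> * b \<sigma> \<rho>)) - 16 * (a \<rho> \<sigma> * (e \<rho> * e \<sigma> * b \<rho> \<sigma>)))"
  proof (intro sum.cong refl)
    fix \<rho> \<sigma>
    have "(\<Sum>\<mu>\<in>UNIV. \<Sum>\<nu>\<in>UNIV. a \<rho> \<sigma> * b \<mu> \<nu> *
      (16 * (eta \<rho> \<sigma> * eta \<mu> \<nu> - eta \<rho> \<mu> * eta \<sigma> \<nu> + eta \<rho> \<nu> * eta \<sigma> \<mu>))) =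
      (\<Sum>\<mu>\<in>UNIV. \<Sum>\<nu>\<in>UNIV. 16 * (eta \<sigma> \<mu> * (eta \<rho> \<nu> * (a \<rho> \<sigma> * b \<mu> \<nu>))) - 16 * (eta \<rho> \<mu> * (eta \<sigma> \<nu> * (a \<rho> \<sigma> * b \<mu> \<nu>))))"
      using antisym_eta[of a, OF assms, of \<rho> \<sigma>] by (intro sum.cong refl) algebra
    also have "\<dots> = 16 * (a \<rho> \<sigma> * (e \<rho> * e \<sigma> * b \<sigma> \<rho>)) - 16 * (a \<rho> \<sigma> * (e \<rho> * e \<sigma> * b \<rho> \<sigma>))"
      by (simp only: sum_subtractf flip: sum_distrib_left) (simp only: sum_eta, algebra)
    finally show "(\<Sum>\<mu>\<in>UNIV. \<Sum>\<nu>\<in>UNIV. a \<rho> \<sigma> * b \<mu> \<nu> *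
      (16 * (eta \<rho> \<sigma> * eta \<mu> \<nu> - eta \<rho> \<mu> * eta \<sigma> \<nu> + eta \<rho> \<nu> * eta \<sigma> \<mu>))) = 16 * (a \<rho> \<sigma> * (e \<rho> * e \<sigma> * b \<sigma> \<rho>)) - 16 * (a \<rho> \<sigma> * (e \<rho> * e \<sigma> * b \<rho> \<sigma>))" .
  qed
  also have "\<dots> = (\<Sum>\<rho>\<in>UNIV. \<Sum>\<sigma>\<in>UNIV. 16 * (a \<rho> \<sigma> * (e \<rho> * e \<sigma> * b \<sigma> \<rho>))) -
       (\<Sum>\<rho>\<in>UNIV. \<Sum>\<sigma>\<in>UNIV. 16 * (a \<rho> \<sigma> * (e \<rho> * e \<sigma> * b \<rho> \<sigma>)))"
    by (simp add: sum_subtractf)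
  also have "(\<Sum>\<rho>\<in>UNIV. \<Sum>\<sigma>\<in>UNIV. 16 * (a \<rho> \<sigma> * (e \<rho> * e \<sigma> * b \<sigma> \<rho>))) = - (\<Sum>\<rho>\<in>UNIV. \<Sum>\<sigma>\<in>UNIV. 16 * (a \<rho> \<sigma> * (e \<rho> * e \<sigma> * b \<rho> \<sigma>)))"
    unfolding sum_negf[symmetric]
    by (subst sum.swap, intro sum.cong refl) (subst assms, simp)
  also have "- (\<Sum>\<rho>\<in>UNIV. \<Sum>\<sigma>\<in>UNIV. 16 * (a \<rho> \<sigma> * (e \<rho> * e \<sigma> * b \<rho> \<sigma>))) - (\<Sum>\<rho>\<in>UNIV. \<Sum>\<sigma>\<in>UNIV. 16 * (a \<rho> \<sigma> * (e \<rho> * e \<sigma> * b \<rho> \<sigma>)))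
    = - 32 * (\<Sum>\<rho>\<in>UNIV. \<Sum>\<sigma>\<in>UNIV. a \<rho> \<sigma> * (e \<rho> * e \<sigma> * b \<rho> \<sigma>))"
    by (simp flip: sum_distrib_left)
  finally show ?thesis .
qed

text \<open>\<open>spin\<close> carries the matrix commutator, taken with the metric, to the
  operator commutator up to the factor 4. Each of the four terms of \<open>delta4_commutator\<close>
  becomes one of the two matrix products after relabelling, with antisymmetry fixing the
  sign.\<close>

lemma spin_commutator:
  assumes a: "\<And>\<rho> \<sigma>. a \<rho> \<sigma> = - a \<sigma> \<rho>" and b: "\<And>\<rho> \<sigma>. b \<rho> \<sigma> = - b \<sigma> \<rho>"
  shows "spin a ** spin b - spin b ** spin a =
    spin (\<lambda>\<rho> \<sigma>. 4 * (\<Sum>\<nu>\<in>UNIV. e \<nu> * (a \<rho> \<nu> * b \<nu> \<sigma> - b \<rho> \<nu> * a \<nu> \<sigma>)))"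
proof -
  let ?S = "\<lambda>f. \<Sum>\<rho>\<in>UNIV. \<Sum>\<sigma>\<in>UNIV. \<Sum>\<mu>\<in>UNIV. \<Sum>\<nu>\<in>UNIV. (f \<rho> \<sigma> \<mu> \<nu> :: op16)"
  let ?ab = "spin (\<lambda>\<rho> \<nu>. \<Sum>\<sigma>\<in>UNIV. e \<sigma> * (a \<rho> \<sigma> * b \<sigma> \<nu>))"
  let ?ba = "spin (\<lambda>\<rho> \<nu>. \<Sum>\<sigma>\<in>UNIV. e \<sigma> * (b \<rho> \<sigma> * a \<sigma> \<nu>))"
  have 1: "?S (\<lambda>\<rho> \<sigma> \<mu> \<nu>. (eta \<sigma> \<mu> * (a \<rho> \<sigma> * b \<mu> \<nu>)) *\<^sub>R (delta \<rho> ** delta \<nu>)) = ?ab"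
  proof -
    have "?S (\<lambda>\<rho> \<sigma> \<mu> \<nu>. (eta \<sigma> \<mu> * (a \<rho> \<sigma> * b \<mu> \<nu>)) *\<^sub>R (delta \<rho> ** delta \<nu>)) =
      (\<Sum>\<rho>\<in>UNIV. \<Sum>\<sigma>\<in>UNIV. \<Sum>\<nu>\<in>UNIV. \<Sum>\<mu>\<in>UNIV. (eta \<sigma> \<mu> * (a \<rho> \<sigma> * b \<mu> \<nu>)) *\<^sub>R (delta \<rho> ** delta \<nu>))"
      by (rule sum.cong[OF refl], rule sum.cong[OF refl], rule sum.swap)
    also have "\<dots> = (\<Sum>\<rho>\<in>UNIV. \<Sum>\<sigma>\<in>UNIV. \<Sum>\<nu>\<in>UNIV. (e \<sigma> * (a \<rho> \<sigma> * b \<sigma> \<nu>)) *\<^sub>R (delta \<rho> ** delta \<nu>))"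
      by (simp only: sum_eta_scaleR)
    also have "\<dots> = (\<Sum>\<rho>\<in>UNIV. \<Sum>\<nu>\<in>UNIV. \<Sum>\<sigma>\<in>UNIV. (e \<sigma> * (a \<rho> \<sigma> * b \<sigma> \<nu>)) *\<^sub>R (delta \<rho> ** delta \<nu>))"
      by (rule sum.cong[OF refl], rule sum.swap)
    finally show ?thesis by (simp add: spin_def scaleR_sum_left)
  qed
  have 2: "?S (\<lambda>\<rho> \<sigma> \<mu> \<nu>. (eta \<rho> \<mu> * (a \<rho> \<sigma> * b \<mu> \<nu>)) *\<^sub>R (delta \<sigma> ** delta \<nu>)) = - ?ab"
  proof -
    have "?S (\<lambda>\<rho> \<sigma> \<mu> \<nu>. (eta \<rho> \<mu> * (a \<rho> \<sigma> * b \<mu> \<nu>)) *\<^sub>R (delta \<sigma> ** delta \<nu>)) =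
      ?S (\<lambda>\<rho> \<sigma> \<mu> \<nu>. - ((eta \<sigma> \<mu> * (a \<rho> \<sigma> * b \<mu> \<nu>)) *\<^sub>R (delta \<rho> ** delta \<nu>)))"
      by (subst sum.swap, intro sum.cong refl) (subst a, simp)
    then show ?thesis by (simp only: sum_negf 1)
  qed
  have 3: "?S (\<lambda>\<rho> \<sigma> \<mu> \<nu>. (eta \<sigma> \<nu> * (a \<rho> \<sigma> * b \<mu> \<nu>)) *\<^sub>R (delta \<mu> ** delta \<rho>)) = - ?ba"
  proof -
    have "?S (\<lambda>\<rho> \<sigma> \<mu> \<nu>. (eta \<sigma> \<nu> * (a \<rho> \<sigma> * b \<mu> \<nu>)) *\<^sub>R (delta \<mu> ** delta \<rho>)) =
      (\<Sum>\<rho>\<in>UNIV. \<Sum>\<sigma>\<in>UNIV. \<Sum>\<mu>\<in>UNIV. (e \<sigma> * (a \<rho> \<sigma> * b \<mu> \<sigma>)) *\<^sub>R (delta \<mu> ** delta \<rho>))"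
      by (simp only: sum_eta_scaleR)
    also have "\<dots> = (\<Sum>\<rho>\<in>UNIV. \<Sum>\<mu>\<in>UNIV. \<Sum>\<sigma>\<in>UNIV. (e \<sigma> * (a \<rho> \<sigma> * b \<mu> \<sigma>)) *\<^sub>R (delta \<mu> ** delta \<rho>))"
      by (rule sum.cong[OF refl], rule sum.swap)
    also have "\<dots> = (\<Sum>\<mu>\<in>UNIV. \<Sum>\<rho>\<in>UNIV. \<Sum>\<sigma>\<in>UNIV. (e \<sigma> * (a \<rho> \<sigma> * b \<mu> \<sigma>)) *\<^sub>R (delta \<mu> ** delta \<rho>))"
      by (rule sum.swap)
    also have "\<dots> = (\<Sum>\<mu>\<in>UNIV. \<Sum>\<rho>\<in>UNIV. \<Sum>\<sigma>\<in>UNIV. - ((e \<sigma> * (b \<mu> \<sigma> * a \<sigma> \<rho>)) *\<^sub>R (delta \<mu> ** delta \<rho>)))"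
      by (intro sum.cong refl) (subst a, simp add: mult.commute mult.left_commute)
    finally show ?thesis by (simp add: spin_def scaleR_sum_left sum_negf)
  qed
  have 4: "?S (\<lambda>\<rho> \<sigma> \<mu> \<nu>. (eta \<rho> \<nu> * (a \<rho> \<sigma> * b \<mu> \<nu>)) *\<^sub>R (delta \<mu> ** delta \<sigma>)) = ?ba"
  proof -
    have "?S (\<lambda>\<rho> \<sigma> \<mu> \<nu>. (eta \<rho> \<nu> * (a \<rho> \<sigma> * b \<mu> \<nu>)) *\<^sub>R (delta \<mu> ** delta \<sigma>)) =
      ?S (\<lambda>\<rho> \<sigma> \<mu> \<nu>. - ((eta \<sigma> \<nu> * (a \<rho> \<sigma> * b \<mu> \<nu>)) *\<^sub>R (delta \<mu> ** delta \<rho>)))"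
      by (subst sum.swap, intro sum.cong refl) (subst a, simp)
    then show ?thesis by (simp only: sum_negf 3 minus_minus)
  qed
  have "spin b ** spin a = ?S (\<lambda>\<rho> \<sigma> \<mu> \<nu>. (a \<rho> \<sigma> * b \<mu> \<nu>) *\<^sub>R (delta \<mu> ** delta \<nu> ** (delta \<rho> ** delta \<sigma>)))"
  proof -
    have "spin b ** spin a = (\<Sum>\<rho>\<in>UNIV. \<Sum>\<sigma>\<in>UNIV. spin b ** (a \<rho> \<sigma> *\<^sub>R (delta \<rho> ** delta \<sigma>)))"
      by (simp add: spin_def[of a] op_mult.sum_right)
    also have "\<dots> = ?S (\<lambda>\<rho> \<sigma> \<mu> \<nu>. (a \<rho> \<sigma> * b \<mu> \<nu>) *\<^sub>R (delta \<mu> ** delta \<nu> ** (delta \<rho> ** delta \<sigma>)))"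
      by (simp add: spin_def op_mult.sum_left op_mult.scaleR_left op_mult.scaleR_right scaleR_sum_right mult.commute)
    finally show ?thesis .
  qed
  moreover have "spin a ** spin b = ?S (\<lambda>\<rho> \<sigma> \<mu> \<nu>. (a \<rho> \<sigma> * b \<mu> \<nu>) *\<^sub>R (delta \<rho> ** delta \<sigma> ** (delta \<mu> ** delta \<nu>)))"
  proof -
    have "spin a ** spin b = (\<Sum>\<rho>\<in>UNIV. \<Sum>\<sigma>\<in>UNIV. (a \<rho> \<sigma> *\<^sub>R (delta \<rho> ** delta \<sigma>)) ** spin b)"
      by (simp add: spin_def[of a] op_mult.sum_left)
    also have "\<dots> = ?S (\<lambda>\<rho> \<sigma> \<mu> \<nu>. (a \<rho> \<sigma> * b \<mu> \<nu>) *\<^sub>R (delta \<rho> ** delta \<sigma> ** (delta \<mu> ** delta \<nu>)))"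
      by (simp add: spin_def op_mult.sum_right op_mult.scaleR_left op_mult.scaleR_right scaleR_sum_right mult.commute)
    finally show ?thesis .
  qed
  ultimately have "spin a ** spin b - spin b ** spin a =
      ?S (\<lambda>\<rho> \<sigma> \<mu> \<nu>. (a \<rho> \<sigma> * b \<mu> \<nu>) *\<^sub>R (delta \<rho> ** delta \<sigma> ** (delta \<mu> ** delta \<nu>) - delta \<mu> ** delta \<nu> ** (delta \<rho> ** delta \<sigma>)))"
    by (simp add: scaleR_diff_right sum_subtractf)
  also have "\<dots> = ?S (\<lambda>\<rho> \<sigma> \<mu> \<nu>. 2 *\<^sub>R ((eta \<sigma> \<mu> * (a \<rho> \<sigma> * b \<mu> \<nu>)) *\<^sub>R (delta \<rho> ** delta \<nu>))
       - 2 *\<^sub>R ((eta \<rho> \<mu> * (a \<rho> \<sigma> * b \<mu> \<nu>)) *\<^sub>R (delta \<sigma> ** delta \<nu>))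
       + 2 *\<^sub>R ((eta \<sigma> \<nu> * (a \<rho> \<sigma> * b \<mu> \<nu>)) *\<^sub>R (delta \<mu> ** delta \<rho>))
       - 2 *\<^sub>R ((eta \<rho> \<nu> * (a \<rho> \<sigma> * b \<mu> \<nu>)) *\<^sub>R (delta \<mu> ** delta \<sigma>)))"
    unfolding delta4_commutator
    by (intro sum.cong refl) (simp add: scaleR_add_right scaleR_diff_right mult.commute mult.left_commute)
  also have "\<dots> = 2 *\<^sub>R ?ab - 2 *\<^sub>R (- ?ab) + 2 *\<^sub>R (- ?ba) - 2 *\<^sub>R ?ba"
    by (simp only: sum.distrib sum_subtractf flip: scaleR_sum_right) (simp only: 1 2 3 4)
  also have "\<dots> = 4 *\<^sub>R ?ab - 4 *\<^sub>R ?ba"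
    by (simp add: algebra_simps flip: scaleR_add_left)
  also have "\<dots> = spin (\<lambda>\<rho> \<sigma>. 4 * (\<Sum>\<nu>\<in>UNIV. e \<nu> * (a \<rho> \<nu> * b \<nu> \<sigma> - b \<rho> \<nu> * a \<nu> \<sigma>)))"
    by (simp add: spin_scaleR spin_diff algebra_simps sum_subtractf)
  finally show ?thesis .
qed

section \<open>The hermitian form and the current\<close>

text \<open>A minor of a diagonal matrix. If two sets of equal size differ, the row of an element in
  only the first of them is zero. If they agree, every permutation other than the identity meets an
  off-diagonal entry.\<close>

lemma eta_list_sorted:
  "eta_list (sorted_list_of_set A) (sorted_list_of_set B) = (if A = B then \<Prod>a\<in>A. e a else 0)"
proof (cases "card A = card B")
  case False
  then show ?thesis by (auto simp: eta_list_def)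
next
  case card: True
  let ?I = "sorted_list_of_set A" and ?J = "sorted_list_of_set B"
  let ?n = "card A"
  let ?f = "\<lambda>p. of_int (sign p) * (\<Prod>i<?n. eta (?I ! i) (?J ! p i))"
  have eta: "eta_list ?I ?J = (\<Sum>p | p permutes {..<?n}. ?f p)"
    using card by (simp add: eta_list_def)
  show ?thesis
  proof (cases "A = B")
    case False
    then obtain a where a: "a \<in> A" "a \<notin> B"
      using card card_subset_eq[of B A] by (metis finite subsetI)
    then obtain i where i: "i < ?n" "?I ! i = a"
      by (metis in_set_conv_nth sorted_list_of_set.length_sorted_key_list_of_set
          sorted_list_of_set.set_sorted_key_list_of_set finite)
    have "?f p = 0" if p: "p permutes {..<?n}" for p
    proof -
      have "p i < ?n" using permutes_in_image[OF p, of i] i by simp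
      then have "?J ! p i \<in> B"
        using card nth_mem[of "p i" ?J] by simp
      then have "eta (?I ! i) (?J ! p i) = 0" using a i by (auto simp: eta_def)
      then show ?thesis using i by (auto intro!: prod_zero)
    qed
    then have "(\<Sum>p | p permutes {..<?n}. ?f p) = 0" by (intro sum.neutral) auto
    with False eta show ?thesis by simp
  next
    case True
    have "?f p = 0" if p: "p permutes {..<?n}" and "p \<noteq> id" for p
    proof -
      obtain i where i: "p i \<noteq> i" using \<open>p \<noteq> id\<close> by (metis eq_id_iff)
      then have n: "i < ?n" "p i < ?n"
        using p permutes_in_image[OF p, of i] by (auto simp: permutes_def)
      then have "?I ! i \<noteq> ?J ! p i"
        using i True nth_eq_iff_index_eq[of ?I i "p i"] by simp
      then have "eta (?I ! i) (?J ! p i) = 0" by (simp add: eta_def)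
      then show ?thesis using n by (auto intro!: prod_zero)
    qed
    then have "(\<Sum>p | p permutes {..<?n}. ?f p) = (\<Sum>p\<in>{id}. ?f p)"
      by (intro sum.mono_neutral_right) (auto simp: finite_permutations permutes_id)
    also have "\<dots> = (\<Prod>i<?n. e (?I ! i))" using True by simp
    also have "\<dots> = (\<Prod>a\<in>A. e a)"
      by (rule prod.reindex_bij_betw, rule bij_betw_nth) auto
    finally show ?thesis using True eta by simp
  qed
qed

definition herm :: "form \<Rightarrow> form \<Rightarrow> complex" where
  "herm \<psi> \<phi> = dagger_prod \<psi> (eta_hat *v \<phi>)"

lemma herm_eq: "herm \<psi> \<phi> = (\<Sum>A\<in>UNIV. of_real (\<Prod>a\<in>A. e a) * (cnj (\<psi> $ A) * \<phi> $ A))"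
proof -
  have "(eta_hat *v \<phi>) $ A = of_real (\<Prod>a\<in>A. e a) * \<phi> $ A" for A
  proof -
    have "(eta_hat *v \<phi>) $ A = (\<Sum>B\<in>UNIV. if B = A then of_real (\<Prod>a\<in>A. e a) * \<phi> $ A else 0)"
      unfolding matrix_vector_mult_def eta_hat_def vec_lambda_beta eta_list_sorted
      by (rule sum.cong) auto
    then show ?thesis by simp
  qed
  then show ?thesis by (simp add: herm_def dagger_prod_def mult.left_commute)
qed

lemma herm_cnj: "cnj (herm \<psi> \<phi>) = herm \<phi> \<psi>"
  unfolding herm_eq cnj_sum by (intro sum.cong refl) (simp add: mult.commute)

text \<open>Over the reals conjugation is linear, so the sesquilinear form counts as
  bilinear.\<close>

lemma herm_bilinear: "bounded_bilinear herm"
  unfolding bilinear_conv_bounded_bilinear[symmetric] bilinear_def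
  by (intro conjI allI linearI; simp add: herm_eq algebra_simps sum.distrib scaleR_sum_right)

interpretation herm: bounded_bilinear herm by (rule herm_bilinear)

text \<open>Inserting \<alpha> is a bijection from the sets without \<alpha> to those with it. It
  multiplies the weight of the extended metric by \<open>e \<alpha>\<close>, which is the metric
  factor built into the contraction.\<close>

lemma herm_wedge_op: "herm (wedge_op \<alpha> *v \<psi>) \<phi> = herm \<psi> (contr_op \<alpha> *v \<phi>)"
proof -
  let ?s = "\<lambda>A. complex_of_real (\<Prod>a\<in>A. e a)"
  have "herm (wedge_op \<alpha> *v \<psi>) \<phi> = (\<Sum>C\<in>{C. \<alpha> \<in> C}. ?s C * (of_real (wedge_sign \<alpha> (C - {\<alpha>})) * cnj (\<psi> $ (C - {\<alpha>})) * \<phi> $ C))"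
    unfolding herm_eq wedge_op_nth by (rule sum.mono_neutral_cong_right) auto
  also have "\<dots> = (\<Sum>A\<in>{A. \<alpha> \<notin> A}. ?s A * (cnj (\<psi> $ A) * (of_real (e \<alpha> * wedge_sign \<alpha> A) * \<phi> $ insert \<alpha> A)))"
    by (rule sum.reindex_bij_witness[where i="insert \<alpha>" and j="\<lambda>C. C - {\<alpha>}"])
       (auto simp: insert_absorb prod.insert prod.remove[of _ \<alpha>])
  also have "\<dots> = herm \<psi> (contr_op \<alpha> *v \<phi>)"
    unfolding herm_eq contr_op_nth by (rule sum.mono_neutral_cong_left) auto
  finally show ?thesis .
qed

lemma herm_contr_op: "herm (contr_op \<alpha> *v \<psi>) \<phi> = herm \<psi> (wedge_op \<alpha> *v \<phi>)"
  by (metis herm_wedge_op herm_cnj)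

lemma herm_delta: "herm (delta \<alpha> *v \<psi>) \<phi> = herm \<psi> (delta \<alpha> *v \<phi>)"
  by (simp add: delta_def op_apply.add_left herm.add_left herm.add_right herm_wedge_op herm_contr_op)

lemma herm_gamma: "herm (gamma \<alpha> *v \<psi>) \<phi> = - herm \<psi> (gamma \<alpha> *v \<phi>)"
  by (simp add: gamma_eq op_apply.diff_left herm.diff_left herm.diff_right herm_wedge_op herm_contr_op)

text \<open>\<open>gamma\<close> is skew and each \<open>delta\<close> is self-adjoint. Taking the
  adjoint reverses the two \<open>delta\<close>, and restoring their order costs 2 \<eta>; the skew
  term with coefficient \<eta> inside \<open>Theta\<close> absorbs exactly this defect.\<close>

lemma herm_gamma_Theta_real:
  "cnj (herm \<psi> (gamma \<alpha> *v (Theta [\<rho>, \<sigma>] *v \<psi>))) = herm \<psi> (gamma \<alpha> *v (Theta [\<rho>, \<sigma>] *v \<psi>))"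
proof -
  have dg: "delta \<beta> *v (gamma \<alpha> *v \<phi>) = - (gamma \<alpha> *v (delta \<beta> *v \<phi>))" for \<beta> \<phi>
    by (simp add: matrix_vector_mul_assoc delta_gamma op_apply.minus_left)
  have dd: "delta \<sigma> *v (delta \<rho> *v \<phi>) = (2 * eta \<rho> \<sigma>) *\<^sub>R \<phi> - delta \<rho> *v (delta \<sigma> *v \<phi>)" for \<phi>
    by (simp add: matrix_vector_mul_assoc delta_delta[of \<sigma>] op_apply.diff_left op_apply.scaleR_left eta_sym[of \<sigma> \<rho>])
  have T: "Theta [\<rho>, \<sigma>] *v \<psi> = delta \<rho> *v (delta \<sigma> *v \<psi>) - eta \<rho> \<sigma> *\<^sub>R \<psi>"
    by (simp add: Theta_eq op_apply.diff_left op_apply.scaleR_left matrix_vector_mul_assoc)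
  have 1: "cnj (herm \<psi> (gamma \<alpha> *v \<psi>)) = - herm \<psi> (gamma \<alpha> *v \<psi>)"
    by (simp add: herm_cnj herm_gamma)
  have "cnj (herm \<psi> (gamma \<alpha> *v (delta \<rho> *v (delta \<sigma> *v \<psi>)))) = - herm \<psi> (delta \<sigma> *v (delta \<rho> *v (gamma \<alpha> *v \<psi>)))"
    by (simp add: herm_cnj herm_gamma herm_delta)
  also have "\<dots> = - herm \<psi> (gamma \<alpha> *v (delta \<sigma> *v (delta \<rho> *v \<psi>)))"
    by (simp add: dg op_apply.minus_right)
  also have "\<dots> = herm \<psi> (gamma \<alpha> *v (delta \<rho> *v (delta \<sigma> *v \<psi>))) - of_real (2 * eta \<rho> \<sigma>) * herm \<psi> (gamma \<alpha> *v \<psi>)"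
    by (simp add: dd op_apply.diff_right op_apply.scaleR_right herm.diff_right herm.scaleR_right complex_scaleR)
  finally show ?thesis
    unfolding T by (simp add: op_apply.diff_right op_apply.scaleR_right herm.diff_right herm.scaleR_right complex_scaleR 1)
qed

lemma eta_diag_sandwich: "e \<alpha> * x * e \<alpha> = x"
  by (auto simp: eta_def)

text \<open>The real part discards nothing by \<open>herm_current\<close>; it makes the source a
  real field, so that the variation can be treated with real integrals.\<close>

definition current :: "(spacetime \<Rightarrow> form) \<Rightarrow> field3" where
  "current \<psi> \<alpha> \<rho> \<sigma> x = Re (herm (\<psi> x) (gamma \<alpha> *v (Theta [\<rho>, \<sigma>] *v \<psi> x)))"

lemma herm_current: "herm (\<psi> x) (gamma \<alpha> *v (Theta [\<rho>, \<sigma>] *v \<psi> x)) = of_real (current \<psi> \<alpha> \<rho> \<sigma> x)"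
  using herm_gamma_Theta_real unfolding current_def by (metis Reals_cnj_iff of_real_Re)

lemma chi_eq: "chi \<tau> \<psi> \<alpha> \<rho> \<sigma> x = of_real (current \<psi> \<alpha> \<rho> \<sigma> x / (128 * \<tau>))"
  unfolding chi_def herm_def[symmetric] herm_current by simp

lemma X_field_eq: "X_field F \<alpha> x = (\<Sum>\<rho>\<in>UNIV. \<Sum>\<sigma>\<in>UNIV. (e \<alpha> * F \<alpha> \<rho> \<sigma> x) *\<^sub>R Theta [\<rho>, \<sigma>])"
proof -
  have "X_field F \<alpha> x = (\<Sum>\<beta>\<in>UNIV. if \<beta> = \<alpha> then (\<Sum>\<rho>\<in>UNIV. \<Sum>\<sigma>\<in>UNIV. (e \<alpha> * F \<alpha> \<rho> \<sigma> x) *\<^sub>R Theta [\<rho>, \<sigma>]) else 0)"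
    unfolding X_field_def by (rule sum.cong) (auto simp: eta_def)
  then show ?thesis by simp
qed

text \<open>The metric that lowers the index in \<open>X_field\<close> cancels the one that raises
  the index of \<open>gamma\<close>. Because the coupling is real, half of it plus its conjugate
  returns it with coefficient one, and the kinetic Lagrangian is affine in \<open>F\<close>.\<close>

lemma L_K_split:
  "L_K m (X_field F) \<psi> x = L_K m (\<lambda>_ _. 0) \<psi> x
     + of_real (\<Sum>\<alpha>\<in>UNIV. \<Sum>\<rho>\<in>UNIV. \<Sum>\<sigma>\<in>UNIV. F \<alpha> \<rho> \<sigma> x * current \<psi> \<alpha> \<rho> \<sigma> x)"
proof -
  have *: "shift \<alpha> gamma *v (X_field F \<alpha> x *v \<psi> x) =
     (\<Sum>\<rho>\<in>UNIV. \<Sum>\<sigma>\<in>UNIV. F \<alpha> \<rho> \<sigma> x *\<^sub>R (gamma \<alpha> *v (Theta [\<rho>, \<sigma>] *v \<psi> x)))" for \<alpha>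
    by (simp add: X_field_eq shift_eq op_apply.sum_left op_apply.sum_right op_apply.scaleR_left op_apply.scaleR_right scaleR_sum_right eta_diag_sq eta_diag_sandwich)
  have "Dirac (X_field F) \<psi> x = Dirac (\<lambda>_ _. 0) \<psi> x +
     (\<Sum>\<alpha>\<in>UNIV. \<Sum>\<rho>\<in>UNIV. \<Sum>\<sigma>\<in>UNIV. F \<alpha> \<rho> \<sigma> x *\<^sub>R (gamma \<alpha> *v (Theta [\<rho>, \<sigma>] *v \<psi> x)))"
    by (simp add: Dirac_def op_apply.add_right * sum.distrib)
  then have 1: "herm (\<psi> x) (Dirac (X_field F) \<psi> x) = herm (\<psi> x) (Dirac (\<lambda>_ _. 0) \<psi> x) +
     of_real (\<Sum>\<alpha>\<in>UNIV. \<Sum>\<rho>\<in>UNIV. \<Sum>\<sigma>\<in>UNIV. F \<alpha> \<rho> \<sigma> x * current \<psi> \<alpha> \<rho> \<sigma> x)"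
    by (simp add: herm.add_right herm.sum_right herm.scaleR_right herm_current complex_scaleR)
  have 2: "plus_cc (1/2 * (z + of_real r)) = plus_cc (1/2 * z) + of_real r" for z r
    by (simp add: plus_cc_def complex_eq_iff)
  show ?thesis unfolding L_K_def herm_def[symmetric] 1 2 by (rule diff_add_eq[symmetric])
qed

section \<open>The curvature and the Lagrangian of the gauge field\<close>

lemma pd_eqI: "(f has_derivative f') (at x) \<Longrightarrow> pd \<alpha> f x = f' (axis \<alpha> 1)"
  unfolding pd_def by (metis frechet_derivative_at)

lemma smooth_differentiable: "smooth f \<Longrightarrow> f differentiable (at x)"
  unfolding smooth_def by (metis foldr.simps(1) id_apply)

lemma smooth_field_differentiable: "smooth_field F \<Longrightarrow> F \<alpha> \<rho> \<sigma> differentiable (at x)"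
  by (simp add: smooth_field_def smooth_differentiable)

lemma pd_X_field:
  assumes "smooth_field F"
  shows "pd \<alpha> (X_field F \<beta>) x = (\<Sum>\<rho>\<in>UNIV. \<Sum>\<sigma>\<in>UNIV. (e \<beta> * pd \<alpha> (F \<beta> \<rho> \<sigma>) x) *\<^sub>R Theta [\<rho>, \<sigma>])"
proof -
  have "(F \<beta> \<rho> \<sigma> has_derivative frechet_derivative (F \<beta> \<rho> \<sigma>) (at x)) (at x)" for \<rho> \<sigma>
    using assms smooth_differentiable frechet_derivative_works unfolding smooth_field_def by blast
  then have "(X_field F \<beta> has_derivative
     (\<lambda>h. \<Sum>\<rho>\<in>UNIV. \<Sum>\<sigma>\<in>UNIV. (e \<beta> * frechet_derivative (F \<beta> \<rho> \<sigma>) (at x) h) *\<^sub>R Theta [\<rho>, \<sigma>])) (at x)"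
    unfolding X_field_eq[abs_def]
    by (intro has_derivative_sum has_derivative_scaleR_left has_derivative_mult_right)
  from pd_eqI[OF this] show ?thesis by (simp add: pd_def)
qed

lemma pd_cmult:
  fixes f :: "spacetime \<Rightarrow> 'b::real_normed_vector"
  assumes "f differentiable (at x)" shows "pd \<alpha> (\<lambda>y. c *\<^sub>R f y) x = c *\<^sub>R pd \<alpha> f x"
  using assms unfolding frechet_derivative_works
  by (intro pd_eqI[THEN trans]) (auto intro!: derivative_eq_intros simp: pd_def)

lemma F_ddd_eq: "F_ddd F \<alpha> \<rho> \<sigma> = (\<lambda>x. (e \<alpha> * e \<rho> * e \<sigma>) *\<^sub>R F \<alpha> \<rho> \<sigma> x)"
  by (simp add: F_ddd_def[abs_def] shift_eq mult.assoc)

lemma pd_F_ddd: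
  assumes "smooth_field F"
  shows "pd \<beta> (F_ddd F \<alpha> \<rho> \<sigma>) x = e \<alpha> * e \<rho> * e \<sigma> * pd \<beta> (F \<alpha> \<rho> \<sigma>) x"
  unfolding F_ddd_eq by (subst pd_cmult[OF smooth_field_differentiable[OF assms]]) simp

lemma Fierz_antisym: "Fierz F \<Longrightarrow> F \<alpha> \<rho> \<sigma> x = - F \<alpha> \<sigma> \<rho> x"
  unfolding Fierz_def by blast

lemma pd_uminus: "pd \<alpha> (\<lambda>y. - f y) x = - pd \<alpha> f x" if "f differentiable (at x)"
  using pd_cmult[OF that, of \<alpha> "-1"] by simp

lemma pd_antisym:
  assumes "smooth_field F" "Fierz F"
  shows "pd \<beta> (F \<alpha> \<rho> \<sigma>) x = - pd \<beta> (F \<alpha> \<sigma> \<rho>) x"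
proof -
  have "F \<alpha> \<rho> \<sigma> = (\<lambda>x. - F \<alpha> \<sigma> \<rho> x)" using Fierz_antisym[OF assms(2)] by blast
  then show ?thesis
    using assms(1) smooth_differentiable pd_uminus unfolding smooth_field_def by metis
qed

text \<open>The coefficients in \<open>spin\<close> sit in the place of upper indices, whereas
  \<open>curv\<close> has all indices down; the two factors \<open>e\<close> raise the last
  pair.\<close>

lemma Omega_X_field:
  assumes F: "smooth_field F" "Fierz F"
  shows "Omega (X_field F) \<alpha> \<beta> x = spin (\<lambda>\<rho> \<sigma>. e \<rho> * e \<sigma> * curv F \<alpha> \<beta> \<rho> \<sigma> x)"
proof -
  have X: "X_field F \<alpha> x = spin (\<lambda>\<rho> \<sigma>. e \<alpha> * F \<alpha> \<rho> \<sigma> x)" for \<alpha>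
    unfolding X_field_eq using Fierz_antisym[OF F(2), of \<alpha>] by (intro spin_Theta) (metis mult_minus_right)
  have dX: "pd \<alpha> (X_field F \<beta>) x = spin (\<lambda>\<rho> \<sigma>. e \<beta> * pd \<alpha> (F \<beta> \<rho> \<sigma>) x)" for \<alpha> \<beta>
    unfolding pd_X_field[OF F(1)] using pd_antisym[OF F] by (intro spin_Theta) (metis mult_minus_right)
  have "X_field F \<alpha> x ** X_field F \<beta> x - X_field F \<beta> x ** X_field F \<alpha> x =
    spin (\<lambda>\<rho> \<sigma>. 4 * (\<Sum>\<nu>\<in>UNIV. e \<nu> * ((e \<alpha> * F \<alpha> \<rho> \<nu> x) * (e \<beta> * F \<beta> \<nu> \<sigma> x) - (e \<beta> * F \<beta> \<rho> \<nu> x) * (e \<alpha> * F \<alpha> \<nu> \<sigma> x))))"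
    unfolding X by (rule spin_commutator; metis Fierz_antisym[OF F(2)] mult_minus_right)
  then have "Omega (X_field F) \<alpha> \<beta> x = spin (\<lambda>\<rho> \<sigma>. e \<beta> * pd \<alpha> (F \<beta> \<rho> \<sigma>) x - e \<alpha> * pd \<beta> (F \<alpha> \<rho> \<sigma>) x +
    4 * (\<Sum>\<nu>\<in>UNIV. e \<nu> * ((e \<alpha> * F \<alpha> \<rho> \<nu> x) * (e \<beta> * F \<beta> \<nu> \<sigma> x) - (e \<beta> * F \<beta> \<rho> \<nu> x) * (e \<alpha> * F \<alpha> \<nu> \<sigma> x))))"
    by (simp add: Omega_def dX spin_diff spin_add flip: add_diff_eq)
  also have "\<dots> = spin (\<lambda>\<rho> \<sigma>. e \<rho> * e \<sigma> * curv F \<alpha> \<beta> \<rho> \<sigma> x)"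
  proof (rule arg_cong[where f=spin], rule ext, rule ext)
    fix \<rho> \<sigma>
    have "(\<Sum>\<nu>\<in>UNIV. e \<nu> * ((e \<alpha> * F \<alpha> \<rho> \<nu> x) * (e \<beta> * F \<beta> \<nu> \<sigma> x) - (e \<beta> * F \<beta> \<rho> \<nu> x) * (e \<alpha> * F \<alpha> \<nu> \<sigma> x))) =
      e \<rho> * e \<sigma> * (\<Sum>\<nu>\<in>UNIV. F_ddu F \<alpha> \<rho> \<nu> x * F_ddd F \<beta> \<nu> \<sigma> x - F_ddu F \<beta> \<rho> \<nu> x * F_ddd F \<alpha> \<nu> \<sigma> x)"
      unfolding sum_distrib_left
    proof (intro sum.cong refl)
      fix \<nu>
      show "e \<nu> * ((e \<alpha> * F \<alpha> \<rho> \<nu> x) * (e \<beta> * F \<beta> \<nu> \<sigma> x) - (e \<beta> * F \<beta> \<rho> \<nu> x) * (e \<alpha> * F \<alpha> \<nu> \<sigma> x)) =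
         e \<rho> * e \<sigma> * (F_ddu F \<alpha> \<rho> \<nu> x * F_ddd F \<beta> \<nu> \<sigma> x - F_ddu F \<beta> \<rho> \<nu> x * F_ddd F \<alpha> \<nu> \<sigma> x)"
        unfolding F_ddd_eq F_ddu_def shift_eq real_scaleR_def
        using eta_diag_sq(1)[of \<rho>] eta_diag_sq(1)[of \<sigma>] by algebra
    qed
    then show "e \<beta> * pd \<alpha> (F \<beta> \<rho> \<sigma>) x - e \<alpha> * pd \<beta> (F \<alpha> \<rho> \<sigma>) x +
    4 * (\<Sum>\<nu>\<in>UNIV. e \<nu> * ((e \<alpha> * F \<alpha> \<rho> \<nu> x) * (e \<beta> * F \<beta> \<nu> \<sigma> x) - (e \<beta> * F \<beta> \<rho> \<nu> x) * (e \<alpha> * F \<alpha> \<nu> \<sigma> x))) =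
      e \<rho> * e \<sigma> * curv F \<alpha> \<beta> \<rho> \<sigma> x"
      unfolding curv_def pd_F_ddd[OF F(1)]
      using eta_diag_sq(1)[of \<rho>] eta_diag_sq(1)[of \<sigma>] by algebra
  qed
  finally show ?thesis .
qed

lemma curv_up_eq: "curv_up F \<alpha> \<beta> \<rho> \<sigma> x = e \<alpha> * e \<beta> * e \<rho> * e \<sigma> * curv F \<alpha> \<beta> \<rho> \<sigma> x"
  by (simp add: curv_up_def shift_eq)

text \<open>The quadratic part is a matrix commutator. Transposing a product of two antisymmetric
  matrices reverses their order, and this changes the sign of the commutator.\<close>

lemma curv_antisym:
  assumes F: "smooth_field F" "Fierz F"
  shows "curv F \<alpha> \<beta> \<rho> \<sigma> x = - curv F \<alpha> \<beta> \<sigma> \<rho> x"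
proof -
  have "(\<Sum>\<nu>\<in>UNIV. F_ddu F \<alpha> \<rho> \<nu> x * F_ddd F \<beta> \<nu> \<sigma> x - F_ddu F \<beta> \<rho> \<nu> x * F_ddd F \<alpha> \<nu> \<sigma> x) =
     - (\<Sum>\<nu>\<in>UNIV. F_ddu F \<alpha> \<sigma> \<nu> x * F_ddd F \<beta> \<nu> \<rho> x - F_ddu F \<beta> \<sigma> \<nu> x * F_ddd F \<alpha> \<nu> \<rho> x)"
    unfolding sum_negf[symmetric]
  proof (intro sum.cong refl)
    fix \<nu>
    show "F_ddu F \<alpha> \<rho> \<nu> x * F_ddd F \<beta> \<nu> \<sigma> x - F_ddu F \<beta> \<rho> \<nu> x * F_ddd F \<alpha> \<nu> \<sigma> x =
     - (F_ddu F \<alpha> \<sigma> \<nu> x * F_ddd F \<beta> \<nu> \<rho> x - F_ddu F \<beta> \<sigma> \<nu> x * F_ddd F \<alpha> \<nu> \<rho> x)"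
      unfolding F_ddd_eq F_ddu_def shift_eq real_scaleR_def
      using Fierz_antisym[OF F(2), of \<alpha> \<nu> \<rho> x] Fierz_antisym[OF F(2), of \<alpha> \<nu> \<sigma> x]
        Fierz_antisym[OF F(2), of \<beta> \<nu> \<rho> x] Fierz_antisym[OF F(2), of \<beta> \<nu> \<sigma> x] by algebra
  qed
  moreover have "pd \<gamma> (F_ddd F \<delta> \<rho> \<sigma>) x = - pd \<gamma> (F_ddd F \<delta> \<sigma> \<rho>) x" for \<gamma> \<delta>
    unfolding pd_F_ddd[OF F(1)] using pd_antisym[OF F, of \<gamma> \<delta> \<rho> \<sigma>] by simp
  ultimately show ?thesis unfolding curv_def by simp
qed

lemma L_V_X_field:
  assumes F: "smooth_field F" "Fierz F"
  shows "L_V (X_field F) x = of_real (- 32 * (\<Sum>\<alpha>\<in>UNIV. \<Sum>\<beta>\<in>UNIV. \<Sum>\<rho>\<in>UNIV. \<Sum>\<sigma>\<in>UNIV.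
                               curv F \<alpha> \<beta> \<rho> \<sigma> x * curv_up F \<alpha> \<beta> \<rho> \<sigma> x))"
proof -
  let ?a = "\<lambda>\<alpha> \<beta> \<rho> \<sigma>. e \<rho> * e \<sigma> * curv F \<alpha> \<beta> \<rho> \<sigma> x"
  let ?O = "Omega (X_field F)"
  have anti: "?a \<alpha> \<beta> \<rho> \<sigma> = - ?a \<alpha> \<beta> \<sigma> \<rho>" for \<alpha> \<beta> \<rho> \<sigma>
    using curv_antisym[OF F, of \<alpha> \<beta> \<rho> \<sigma>] by simp
  have "trace (?O \<alpha> \<beta> x ** shift \<alpha> (\<lambda>\<alpha>. shift \<beta> (\<lambda>\<beta>. ?O \<alpha> \<beta> x))) = of_real (-32 * (\<Sum>\<rho>\<in>UNIV. \<Sum>\<sigma>\<in>UNIV.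
                               curv F \<alpha> \<beta> \<rho> \<sigma> x * curv_up F \<alpha> \<beta> \<rho> \<sigma> x))" for \<alpha> \<beta>
  proof -
    have "trace (?O \<alpha> \<beta> x ** shift \<alpha> (\<lambda>\<alpha>. shift \<beta> (\<lambda>\<beta>. ?O \<alpha> \<beta> x))) =
       of_real (e \<alpha> * e \<beta>) * of_real (-32 * (\<Sum>\<rho>\<in>UNIV. \<Sum>\<sigma>\<in>UNIV. ?a \<alpha> \<beta> \<rho> \<sigma> * (e \<rho> * e \<sigma> * ?a \<alpha> \<beta> \<rho> \<sigma>)))"
      by (simp only: shift_eq Omega_X_field[OF F] op_mult.scaleR_right scaleR_scaleR trace_scaleR
          trace_spin_spin[of "?a \<alpha> \<beta>", OF anti] complex_scaleR)
    also have "\<dots> = of_real (-32 * (e \<alpha> * e \<beta> * (\<Sum>\<rho>\<in>UNIV. \<Sum>\<sigma>\<in>UNIV. ?a \<alpha> \<beta> \<rho> \<sigma> * (e \<rho> * e \<sigma> * ?a \<alpha> \<beta> \<rho> \<sigma>))))"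
      by (simp only: of_real_mult[symmetric] mult.left_commute[of "- 32"])
    also have "e \<alpha> * e \<beta> * (\<Sum>\<rho>\<in>UNIV. \<Sum>\<sigma>\<in>UNIV. ?a \<alpha> \<beta> \<rho> \<sigma> * (e \<rho> * e \<sigma> * ?a \<alpha> \<beta> \<rho> \<sigma>)) = (\<Sum>\<rho>\<in>UNIV. \<Sum>\<sigma>\<in>UNIV. curv F \<alpha> \<beta> \<rho> \<sigma> x * curv_up F \<alpha> \<beta> \<rho> \<sigma> x)"
      unfolding curv_up_eq sum_distrib_left
    proof (intro sum.cong refl)
      fix \<rho> \<sigma>
      show "e \<alpha> * e \<beta> * (?a \<alpha> \<beta> \<rho> \<sigma> * (e \<rho> * e \<sigma> * ?a \<alpha> \<beta> \<rho> \<sigma>)) =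
        curv F \<alpha> \<beta> \<rho> \<sigma> x * (e \<alpha> * e \<beta> * e \<rho> * e \<sigma> * curv F \<alpha> \<beta> \<rho> \<sigma> x)"
        using eta_diag_sq(1)[of \<rho>] eta_diag_sq(1)[of \<sigma>] by algebra
    qed
    finally show ?thesis .
  qed
  then have "trace (\<Sum>\<alpha>\<in>UNIV. \<Sum>\<beta>\<in>UNIV. ?O \<alpha> \<beta> x ** shift \<alpha> (\<lambda>\<alpha>. shift \<beta> (\<lambda>\<beta>. ?O \<alpha> \<beta> x))) =
     of_real (- 32 * (\<Sum>\<alpha>\<in>UNIV. \<Sum>\<beta>\<in>UNIV. \<Sum>\<rho>\<in>UNIV. \<Sum>\<sigma>\<in>UNIV.
                               curv F \<alpha> \<beta> \<rho> \<sigma> x * curv_up F \<alpha> \<beta> \<rho> \<sigma> x))"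
    by (simp only: trace_sum sum_distrib_left of_real_sum)
  then show ?thesis by (simp add: L_V_def plus_cc_def)
qed

section \<open>Smooth functions and test functions\<close>

text \<open>Bounding the order of differentiation makes smoothness accessible to induction: the
  derivative of a sum, a product or a composite is built from functions that are differentiable to
  one order less.\<close>

definition smooth_upto :: "nat \<Rightarrow> (spacetime \<Rightarrow> 'b::real_normed_vector) \<Rightarrow> bool" where
  "smooth_upto n f \<longleftrightarrow> (\<forall>\<alpha>s x. length \<alpha>s \<le> n \<longrightarrow> foldr pd \<alpha>s f differentiable (at x))"

lemma smooth_iff_upto: "smooth f \<longleftrightarrow> (\<forall>n. smooth_upto n f)"
  unfolding smooth_def smooth_upto_def by blast

lemma smooth_upto_0: "smooth_upto 0 f \<longleftrightarrow> (\<forall>x. f differentiable (at x))"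
  by (simp add: smooth_upto_def)

lemma smooth_upto_Suc:
  "smooth_upto (Suc n) f \<longleftrightarrow> (\<forall>x. f differentiable (at x)) \<and> (\<forall>\<alpha>. smooth_upto n (pd \<alpha> f))"
proof safe
  fix x assume "smooth_upto (Suc n) f"
  then have "foldr pd [] f differentiable (at x)"
    unfolding smooth_upto_def by (metis le0 list.size(3))
  then show "f differentiable (at x)" by simp
next
  fix \<alpha> assume f: "smooth_upto (Suc n) f"
  have "foldr pd \<alpha>s (pd \<alpha> f) differentiable (at x)" if "length \<alpha>s \<le> n" for \<alpha>s x
  proof -
    have "foldr pd (\<alpha>s @ [\<alpha>]) f differentiable (at x)"
      using f that unfolding smooth_upto_def by (metis Suc_le_mono length_append_singleton)
    then show ?thesis by simp
  qed
  then show "smooth_upto n (pd \<alpha> f)" by (simp add: smooth_upto_def)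
next
  assume f: "\<forall>x. f differentiable (at x)" "\<forall>\<alpha>. smooth_upto n (pd \<alpha> f)"
  \<comment> \<open>\<open>foldr\<close> applies the last entry of the list first, so the innermost
    derivative is split off at the end of the list.\<close>
  have "foldr pd \<alpha>s f differentiable (at x)" if "length \<alpha>s \<le> Suc n" for \<alpha>s x
  proof (cases \<alpha>s rule: rev_cases)
    case (snoc bs a)
    then show ?thesis using f(2) that by (simp add: smooth_upto_def)
  qed (use f in simp)
  then show "smooth_upto (Suc n) f" by (simp add: smooth_upto_def)
qed

lemma smooth_pd: "smooth f \<Longrightarrow> smooth (pd \<alpha> f)"
  using smooth_upto_Suc unfolding smooth_iff_upto by blast

lemma smooth_upto_diff: "smooth_upto n f \<Longrightarrow> f differentiable (at x)"
  by (cases n) (auto simp: smooth_upto_0 smooth_upto_Suc)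

lemma smooth_upto_Suc_imp: "smooth_upto (Suc n) f \<Longrightarrow> smooth_upto n f"
  by (auto simp: smooth_upto_def)

lemma smooth_continuous: "smooth f \<Longrightarrow> continuous_on S f"
  by (meson continuous_at_imp_continuous_on differentiable_imp_continuous_within smooth_differentiable)

lemma pd_has_derivative:
  "f differentiable (at x) \<Longrightarrow> \<exists>f'. (f has_derivative f') (at x) \<and> (\<forall>\<alpha>. pd \<alpha> f x = f' (axis \<alpha> 1))"
  using frechet_derivative_works pd_eqI by blast

lemma pd_const: "pd \<alpha> (\<lambda>_. c) = (\<lambda>_. 0)"
  by (rule ext, rule pd_eqI[OF has_derivative_const])

lemma pd_add:
  assumes "f differentiable (at x)" "g differentiable (at x)"
  shows "pd \<alpha> (\<lambda>y. f y + g y) x = pd \<alpha> f x + pd \<alpha> g x"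
proof -
  obtain f' where f': "(f has_derivative f') (at x)" "\<And>\<alpha>. pd \<alpha> f x = f' (axis \<alpha> 1)"
    using pd_has_derivative[OF assms(1)] by blast
  obtain g' where g': "(g has_derivative g') (at x)" "\<And>\<alpha>. pd \<alpha> g x = g' (axis \<alpha> 1)"
    using pd_has_derivative[OF assms(2)] by blast
  show ?thesis using pd_eqI[OF has_derivative_add[OF f'(1) g'(1)]] f'(2) g'(2) by simp
qed

lemma pd_mult:
  fixes f g :: "spacetime \<Rightarrow> real"
  assumes "f differentiable (at x)" "g differentiable (at x)"
  shows "pd \<alpha> (\<lambda>y. f y * g y) x = f x * pd \<alpha> g x + pd \<alpha> f x * g x"
proof -
  obtain f' where f': "(f has_derivative f') (at x)" "\<And>\<alpha>. pd \<alpha> f x = f' (axis \<alpha> 1)"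
    using pd_has_derivative[OF assms(1)] by blast
  obtain g' where g': "(g has_derivative g') (at x)" "\<And>\<alpha>. pd \<alpha> g x = g' (axis \<alpha> 1)"
    using pd_has_derivative[OF assms(2)] by blast
  show ?thesis using pd_eqI[OF has_derivative_mult[OF f'(1) g'(1)]] f'(2) g'(2) by simp
qed

lemma pd_sum:
  assumes "\<And>i. i \<in> S \<Longrightarrow> f i differentiable (at x)"
  shows "pd \<alpha> (\<lambda>y. \<Sum>i\<in>S. f i y) x = (\<Sum>i\<in>S. pd \<alpha> (f i) x)"
proof -
  have "((\<lambda>y. \<Sum>i\<in>S. f i y) has_derivative (\<lambda>h. \<Sum>i\<in>S. frechet_derivative (f i) (at x) h)) (at x)"
    using assms frechet_derivative_works by (intro has_derivative_sum) blast
  from pd_eqI[OF this] show ?thesis by (simp add: pd_def)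
qed

lemma smooth_upto_const: "smooth_upto n (\<lambda>_. c)"
  by (induction n arbitrary: c) (auto simp: smooth_upto_0 smooth_upto_Suc pd_const)

lemma smooth_upto_add: "smooth_upto n f \<Longrightarrow> smooth_upto n g \<Longrightarrow> smooth_upto n (\<lambda>x. f x + g x)"
proof (induction n arbitrary: f g)
  case (Suc n)
  have "pd \<alpha> (\<lambda>x. f x + g x) = (\<lambda>x. pd \<alpha> f x + pd \<alpha> g x)" for \<alpha>
    using Suc.prems smooth_upto_diff by (intro ext pd_add) auto
  then show ?case using Suc by (auto simp: smooth_upto_Suc)
qed (auto simp: smooth_upto_0)

lemma smooth_upto_mult:
  fixes f g :: "spacetime \<Rightarrow> real"
  shows "smooth_upto n f \<Longrightarrow> smooth_upto n g \<Longrightarrow> smooth_upto n (\<lambda>x. f x * g x)"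
proof (induction n arbitrary: f g)
  case (Suc n)
  have "pd \<alpha> (\<lambda>x. f x * g x) = (\<lambda>x. f x * pd \<alpha> g x + pd \<alpha> f x * g x)" for \<alpha>
    using Suc.prems smooth_upto_diff by (intro ext pd_mult) auto
  then show ?case using Suc smooth_upto_Suc_imp[OF Suc.prems(1)] smooth_upto_Suc_imp[OF Suc.prems(2)]
    by (auto simp: smooth_upto_Suc intro!: smooth_upto_add)
qed (auto simp: smooth_upto_0)

lemma smooth_const: "smooth (\<lambda>_. c)"
  by (simp add: smooth_iff_upto smooth_upto_const)
lemma smooth_add: "smooth f \<Longrightarrow> smooth g \<Longrightarrow> smooth (\<lambda>x. f x + g x)"
  by (simp add: smooth_iff_upto smooth_upto_add)
lemma smooth_mult: "smooth f \<Longrightarrow> smooth g \<Longrightarrow> smooth (\<lambda>x. f x * g x :: real)"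
  by (simp add: smooth_iff_upto smooth_upto_mult)
lemma smooth_cmult: "smooth f \<Longrightarrow> smooth (\<lambda>x. c * f x :: real)"
  by (intro smooth_mult smooth_const)
lemma smooth_diff:
  fixes f g :: "spacetime \<Rightarrow> real"
  assumes "smooth f" "smooth g" shows "smooth (\<lambda>x. f x - g x)"
  using smooth_add[OF assms(1) smooth_cmult[OF assms(2), of "-1"]] by simp
lemma smooth_sum: "(\<And>i. i \<in> S \<Longrightarrow> smooth (f i)) \<Longrightarrow> smooth (\<lambda>x. \<Sum>i\<in>S. f i x)"
  by (induction S rule: infinite_finite_induct) (auto intro: smooth_const smooth_add)

lemma smooth_component: "smooth (\<lambda>x::spacetime. x $ i)"
  unfolding smooth_iff_upto
proof
  fix n
  have "pd \<alpha> (\<lambda>x::spacetime. x $ i) = (\<lambda>_. axis \<alpha> 1 $ i)" for \<alpha>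
    by (rule ext, rule pd_eqI) (intro bounded_linear_imp_has_derivative bounded_linear_vec_nth)
  moreover have "(\<lambda>x::spacetime. x $ i) differentiable (at x)" for x
    by (intro bounded_linear_imp_differentiable bounded_linear_vec_nth)
  ultimately show "smooth_upto n (\<lambda>x. x $ i)"
    by (cases n) (simp_all add: smooth_upto_0 smooth_upto_Suc smooth_upto_const)
qed

text \<open>The power is carried along to make the family closed under differentiation.\<close>

definition flat_exp :: "nat \<Rightarrow> real \<Rightarrow> real" where
  "flat_exp k t = (if t \<le> 0 then 0 else (1/t) ^ k * exp (- (1/t)))"

text \<open>A single term of the exponential series at 1/t already bounds the power of order k + 2.
  The two spare powers become a factor t squared, which is what forces a zero derivative at the
  origin.\<close>

lemma flat_exp_bound: "\<bar>flat_exp k t\<bar> \<le> fact (k + 2) * t\<^sup>2"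
proof (cases "t \<le> 0")
  case False
  then have t: "t > 0" by simp
  have "(1/t) ^ (k + 2) / fact (k + 2) \<le> exp (1/t)"
  proof -
    have s: "(\<lambda>n. (1/t) ^ n /\<^sub>R fact n) sums exp (1/t)" by (rule exp_converges)
    have "sum (\<lambda>n. (1/t) ^ n /\<^sub>R fact n) {k + 2} \<le> exp (1/t)"
      using t by (subst sums_unique[OF s], intro sum_le_suminf[OF sums_summable[OF s]]) auto
    then show ?thesis by (simp add: field_simps)
  qed
  then have "(1/t) ^ (k + 2) \<le> exp (1/t) * fact (k + 2)"
    by (simp only: pos_divide_le_eq[OF fact_gt_zero])
  then have "(1/t) ^ (k + 2) * exp (- (1/t)) \<le> exp (1/t) * fact (k + 2) * exp (- (1/t))"
    by (rule mult_right_mono) simp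
  also have "\<dots> = fact (k + 2) * (exp (1/t) * exp (- (1/t)))"
    by (simp only: mult_ac)
  also have "\<dots> = fact (k + 2)" by (simp only: exp_minus_inverse mult_1_right)
  finally have "(1/t) ^ (k + 2) * exp (- (1/t)) \<le> fact (k + 2)" .
  then have "(1/t) ^ (k + 2) * exp (- (1/t)) * t\<^sup>2 \<le> fact (k + 2) * t\<^sup>2"
    by (rule mult_right_mono) simp
  moreover have "(1/t) ^ (k + 2) * exp (- (1/t)) * t\<^sup>2 = (1/t) ^ k * exp (- (1/t))"
    using t by (simp add: field_simps power2_eq_square)
  ultimately show ?thesis using t by (simp add: flat_exp_def)
qed (simp add: flat_exp_def)

text \<open>Away from zero this is the chain rule on an open half-line. At zero the quadratic bound
  makes the difference quotient at most a constant times the absolute value of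
  \<open>h\<close>.\<close>

lemma flat_exp_deriv:
  "(flat_exp k has_real_derivative (flat_exp (k + 2) t - k * flat_exp (k + 1) t)) (at t)"
proof (cases t "0::real" rule: linorder_cases)
  case less
  have "((\<lambda>_. 0) has_real_derivative 0) (at t)" by simp
  then have "(flat_exp k has_real_derivative 0) (at t)"
    by (rule has_field_derivative_transform_within_open[of _ _ _ "{..<0}"]) (use less in \<open>auto simp: flat_exp_def\<close>)
  then show ?thesis using less by (simp add: flat_exp_def)
next
  case greater
  have "((\<lambda>t. (1/t) ^ k * exp (- (1/t))) has_real_derivative
     ((1/t) ^ (k + 2) * exp (- (1/t)) - k * ((1/t) ^ (k + 1) * exp (- (1/t))))) (at t)"
  proof -
    have d1: "((\<lambda>t. 1/t) has_real_derivative - ((1/t)\<^sup>2)) (at t)"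
      using greater by (auto intro!: derivative_eq_intros simp: power2_eq_square)
    have d2: "((\<lambda>u. u ^ k * exp (- u)) has_real_derivative (k * u ^ (k - 1) * exp (- u) - u ^ k * exp (- u))) (at u)" for u :: real
      by (auto intro!: derivative_eq_intros)
    \<comment> \<open>The truncated exponent at k = 0 is harmless, since the factor k removes that
      term.\<close>
    have "(k * u ^ (k - 1) * exp (- u) - u ^ k * exp (- u)) * - (u\<^sup>2) =
        u ^ (k + 2) * exp (- u) - k * (u ^ (k + 1) * exp (- u))" for u :: real
      by (cases k) (auto simp: algebra_simps power2_eq_square)
    with DERIV_chain2[OF d2 d1] show ?thesis by simp
  qed
  then have "(flat_exp k has_real_derivative
     ((1/t) ^ (k + 2) * exp (- (1/t)) - k * ((1/t) ^ (k + 1) * exp (- (1/t))))) (at t)"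
    by (rule has_field_derivative_transform_within_open[of _ _ _ "{0<..}"]) (use greater in \<open>auto simp: flat_exp_def\<close>)
  then show ?thesis using greater by (simp add: flat_exp_def)
next
  case equal
  have "((\<lambda>h. (flat_exp k (0 + h) - flat_exp k 0) / h) \<longlongrightarrow> 0) (at 0)"
  proof (rule Lim_null_comparison)
    show "\<forall>\<^sub>F h in at 0. norm ((flat_exp k (0 + h) - flat_exp k 0) / h) \<le> fact (k + 2) * \<bar>h\<bar>"
    proof (rule eventually_at_filter[THEN iffD2], rule always_eventually, intro allI impI)
      fix h :: real assume "h \<noteq> 0"
      then show "norm ((flat_exp k (0 + h) - flat_exp k 0) / h) \<le> fact (k + 2) * \<bar>h\<bar>"
        using flat_exp_bound[of k h]
        by (simp add: flat_exp_def[of k 0] abs_divide divide_le_eq power2_eq_square abs_mult_self_eq mult.assoc)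
    qed
    have "((\<lambda>h::real. fact (k + 2) * \<bar>h\<bar>) \<longlongrightarrow> fact (k + 2) * \<bar>0\<bar>) (at 0)"
      by (intro tendsto_intros)
    then show "((\<lambda>h::real. fact (k + 2) * \<bar>h\<bar>) \<longlongrightarrow> 0) (at 0)" by simp
  qed
  then show ?thesis using equal by (simp add: DERIV_def flat_exp_def[of _ 0])
qed

lemma flat_exp_comp_derivative:
  assumes "q differentiable (at x)"
  shows "((\<lambda>x. flat_exp k (q x)) has_derivative (\<lambda>h. (flat_exp (k + 2) (q x) - k * flat_exp (k + 1) (q x)) *
      frechet_derivative q (at x) h)) (at x)"
  using DERIV_compose_FDERIV[OF flat_exp_deriv assms[unfolded frechet_derivative_works], of k]
  by (simp add: mult.commute)

lemma smooth_upto_flat_exp: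
  assumes "smooth q" shows "smooth_upto n (\<lambda>x. flat_exp k (q x))"
proof (induction n arbitrary: k)
  case 0
  show ?case using flat_exp_comp_derivative[OF smooth_differentiable[OF assms]]
    unfolding smooth_upto_0 differentiable_def by blast
next
  case (Suc n)
  note * = flat_exp_comp_derivative[OF smooth_differentiable[OF assms]]
  have "pd \<alpha> (\<lambda>x. flat_exp k (q x)) =
      (\<lambda>x. (flat_exp (k + 2) (q x) + (- real k) * flat_exp (k + 1) (q x)) * pd \<alpha> q x)" for \<alpha>
    by (rule ext) (simp add: pd_eqI[OF *] pd_def[of _ q])
  moreover have "smooth_upto n (pd \<alpha> q)" for \<alpha>
    using smooth_pd[OF assms] smooth_iff_upto by blast
  then have "smooth_upto n (\<lambda>x. (flat_exp (k + 2) (q x) + (- real k) * flat_exp (k + 1) (q x)) * pd \<alpha> q x)" for \<alpha>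
    by (intro smooth_upto_mult smooth_upto_add smooth_upto_const Suc.IH)
  moreover have "(\<lambda>x. flat_exp k (q x)) differentiable (at x)" for x
    using * unfolding differentiable_def by blast
  ultimately show ?case unfolding smooth_upto_Suc by simp
qed

text \<open>\<open>flat_exp 0\<close> is composed with r squared minus the squared distance to the
  centre, a polynomial in the coordinates that is nonpositive off the ball.\<close>

lemma smooth_bump:
  fixes x0 :: spacetime
  assumes "r > 0"
  obtains \<phi> :: "spacetime \<Rightarrow> real"
  where "smooth \<phi>" "\<And>x. \<phi> x \<ge> 0" "\<phi> x0 > 0" "\<And>x. x \<notin> cball x0 r \<Longrightarrow> \<phi> x = 0"
proof -
  define q where "q x = r\<^sup>2 - (\<Sum>i\<in>UNIV. (x $ i - x0 $ i) * (x $ i - x0 $ i))" for x :: spacetime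
  have qn: "q x = r\<^sup>2 - (dist x0 x)\<^sup>2" for x
  proof -
    have "dist x0 x = norm (x - x0)" by (simp add: dist_norm norm_minus_commute)
    then show ?thesis by (simp add: q_def norm_vec_def L2_set_def sum_nonneg power2_eq_square)
  qed
  have "smooth q" unfolding q_def[abs_def]
    by (intro smooth_diff smooth_const smooth_sum smooth_mult smooth_component)
  then have "smooth (\<lambda>x. flat_exp 0 (q x))"
    unfolding smooth_iff_upto[of "\<lambda>x. flat_exp 0 (q x)"] using smooth_upto_flat_exp by blast
  moreover have "flat_exp 0 (q x) \<ge> 0" for x by (simp add: flat_exp_def)
  moreover have "flat_exp 0 (q x0) > 0" using assms by (simp add: flat_exp_def qn)
  moreover have "flat_exp 0 (q x) = 0" if "x \<notin> cball x0 r" for x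
    using that assms by (auto simp: flat_exp_def qn not_le intro!: power_mono)
  ultimately show ?thesis by (rule that)
qed

section \<open>Integration by parts and the fundamental lemma\<close>

lemma lborel_integral_translate:
  fixes g :: "'a::euclidean_space \<Rightarrow> real"
  assumes "g \<in> borel_measurable borel"
  shows "(LINT x|lborel. g (x + v)) = (LINT x|lborel. g x)"
proof -
  have "(LINT x|lborel. g x) = (LINT x|distr lborel borel ((+) v). g x)"
    by (simp add: lborel_distr_plus)
  also have "\<dots> = (LINT x|lborel. g (v + x))"
    by (rule integral_distr) (use assms in auto)
  finally show ?thesis by (simp add: add.commute)
qed

text \<open>The difference quotients of \<open>g\<close> have integral zero by translation invariance; pass to the limit.\<close>

lemma integral_pd_zero:
  fixes g :: "spacetime \<Rightarrow> real"
  assumes d: "\<And>x. g differentiable (at x)" and c: "continuous_on UNIV (pd \<alpha> g)"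
    and K: "compact K" and 0: "\<And>x. x \<notin> K \<Longrightarrow> g x = 0"
  shows "(LINT x|lborel. pd \<alpha> g x) = 0"
proof -
  let ?a = "axis \<alpha> 1 :: spacetime"
  have na: "norm ?a = 1" by simp
  have gc: "continuous_on UNIV g"
    using d by (simp add: continuous_at_imp_continuous_on differentiable_imp_continuous_within)
  have line: "((\<lambda>t. g (x + t *\<^sub>R ?a)) has_real_derivative pd \<alpha> g (x + t *\<^sub>R ?a)) (at t)" for x t
  proof -
    obtain g' where g': "(g has_derivative g') (at (x + t *\<^sub>R ?a))" "pd \<alpha> g (x + t *\<^sub>R ?a) = g' ?a"
      using pd_has_derivative[OF d] by blast
    have "((\<lambda>t. x + t *\<^sub>R ?a) has_derivative (\<lambda>h. h *\<^sub>R ?a)) (at t)"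
      by (auto intro!: derivative_eq_intros)
    from has_derivative_compose[OF this g'(1)]
    have "((\<lambda>t. g (x + t *\<^sub>R ?a)) has_derivative (\<lambda>h. g' (h *\<^sub>R ?a))) (at t)" .
    moreover have "g' (h *\<^sub>R ?a) = g' ?a * h" for h
      using linear_scale[OF has_derivative_linear[OF g'(1)]] by simp
    ultimately show ?thesis by (simp add: has_field_derivative_def g'(2))
  qed
  \<comment> \<open>The steps \<open>h n\<close> are at most 1. The difference quotients therefore
    vanish outside radius R + 1, and the intermediate points of the mean value theorem stay within
    radius R + 2, where the derivative is bounded.\<close>
  obtain R where R: "\<And>x. x \<in> K \<Longrightarrow> norm x \<le> R"
    using compact_imp_bounded[OF K] bounded_iff by blast
  have "compact (pd \<alpha> g ` cball 0 (R + 2))"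
    by (rule compact_continuous_image) (use c continuous_on_subset in auto)
  then obtain M where M: "\<And>x. norm x \<le> R + 2 \<Longrightarrow> \<bar>pd \<alpha> g x\<bar> \<le> M"
    using compact_imp_bounded bounded_iff by (metis imageI mem_cball_0 real_norm_def)
  define h where "h n = inverse (real (Suc n))" for n
  have h: "0 < h n" "h n \<le> 1" for n by (auto simp: h_def field_simps)
  define D where "D n x = (g (x + h n *\<^sub>R ?a) - g x) / h n" for n x
  have bound: "\<bar>D n x\<bar> \<le> M * indicator (cball 0 (R + 1)) x" for n x
  proof (cases "norm x \<le> R + 1")
    case True
    obtain z where z: "0 < z" "z < h n"
      "g (x + h n *\<^sub>R ?a) - g (x + 0 *\<^sub>R ?a) = (h n - 0) * pd \<alpha> g (x + z *\<^sub>R ?a)"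
      using MVT2[of 0 "h n" "\<lambda>t. g (x + t *\<^sub>R ?a)" "\<lambda>t. pd \<alpha> g (x + t *\<^sub>R ?a)"] h line by blast
    have "norm (x + z *\<^sub>R ?a) \<le> norm x + \<bar>z\<bar>"
      using norm_triangle_ineq[of x "z *\<^sub>R ?a"] by (simp add: na)
    then have "\<bar>pd \<alpha> g (x + z *\<^sub>R ?a)\<bar> \<le> M"
      using z(1,2) h[of n] True by (intro M) linarith
    moreover have "D n x = pd \<alpha> g (x + z *\<^sub>R ?a)"
      using z h[of n] by (simp add: D_def)
    ultimately show ?thesis using True by simp
  next
    case False
    have "norm x \<le> norm (x + h n *\<^sub>R ?a) + h n"
      using norm_triangle_ineq4[of "x + h n *\<^sub>R ?a" "h n *\<^sub>R ?a"] h[of n] by (simp add: na)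
    then have "x \<notin> K" "x + h n *\<^sub>R ?a \<notin> K"
      using False R[of x] R[of "x + h n *\<^sub>R ?a"] h[of n] by linarith+
    then show ?thesis using 0 False by (simp add: D_def)
  qed
  have Dlim: "(\<lambda>n. D n x) \<longlonglongrightarrow> pd \<alpha> g x" for x
  proof -
    have "((\<lambda>t. (g (x + t *\<^sub>R ?a) - g x) / t) \<longlongrightarrow> pd \<alpha> g x) (at 0)"
      using line[of x 0] by (simp add: DERIV_def)
    moreover have "filterlim h (at 0) sequentially"
      unfolding filterlim_at h_def using LIMSEQ_inverse_real_of_nat by (simp add: h_def)
    ultimately show ?thesis unfolding D_def using filterlim_compose by blast
  qed
  have gm: "g \<in> borel_measurable borel" using gc by (rule borel_measurable_continuous_onI)
  have Dm: "D n \<in> borel_measurable borel" for n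
    unfolding D_def[abs_def] using gc h[of n]
    by (intro borel_measurable_continuous_onI continuous_intros continuous_on_compose2[OF gc]) auto
  have int_g: "integrable lborel g"
  proof -
    have "set_integrable lborel K g"
      using K gc continuous_on_subset unfolding set_integrable_def by (intro borel_integrable_compact) auto
    moreover have "indicator K x *\<^sub>R g x = g x" for x using 0[of x] by (auto simp: indicator_def)
    ultimately show ?thesis unfolding set_integrable_def by (simp only:)
  qed
  have int_g': "integrable lborel (\<lambda>x. g (x + v))" for v
  proof -
    have "integrable (distr lborel borel ((+) v)) g" using int_g by (simp add: lborel_distr_plus)
    then show ?thesis by (subst (asm) integrable_distr_eq) (use gm in \<open>auto simp: add.commute\<close>)
  qed
  have D0: "(LINT x|lborel. D n x) = 0" for n
    unfolding D_def using int_g int_g' lborel_integral_translate[OF gm] by simp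
  have "(\<lambda>n. LINT x|lborel. D n x) \<longlonglongrightarrow> (LINT x|lborel. pd \<alpha> g x)"
  proof (rule integral_dominated_convergence)
    show "integrable lborel (\<lambda>x::spacetime. M * indicator (cball 0 (R + 1)) x)"
      using emeasure_compact_finite[of "cball (0::spacetime) (R+1)"] by (intro integrable_mult_right) auto
    show "pd \<alpha> g \<in> borel_measurable lborel" using c by (simp add: borel_measurable_continuous_onI)
  qed (use Dm Dlim bound in auto)
  then show ?thesis by (simp add: D0 LIMSEQ_const_iff)
qed

text \<open>If \<open>u\<close> does not vanish at a point, it keeps its sign on a small ball, and a
  bump supported there gives a nonnegative continuous integrand with zero integral. The set where
  that integrand is nonzero is open and null, hence empty, although it contains the centre.\<close>

lemma continuous_fundamental_lemma:
  fixes u :: "spacetime \<Rightarrow> real"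
  assumes u: "continuous_on UNIV u"
    and z: "\<And>\<phi> K. smooth \<phi> \<Longrightarrow> compact K \<Longrightarrow> (\<And>x. x \<notin> K \<Longrightarrow> \<phi> x = 0) \<Longrightarrow> (LINT x|lborel. \<phi> x * u x) = 0"
  shows "u x0 = 0"
proof (rule ccontr)
  assume ne: "u x0 \<noteq> 0"
  define s where "s = sgn (u x0)"
  have c: "continuous_on UNIV (\<lambda>x. s * u x)" by (intro continuous_intros u)
  have pos: "s * u x0 > 0" using ne by (simp add: s_def sgn_mult_self_eq mult.commute flip: abs_sgn)
  have "open {x. 0 < s * u x}" using open_Collect_less[OF continuous_on_const c] by simp
  then obtain r where r: "r > 0" "cball x0 r \<subseteq> {x. 0 < s * u x}"
    using pos open_contains_cball by blast
  obtain \<phi> :: "spacetime \<Rightarrow> real" where \<phi>: "smooth \<phi>" "\<And>x. \<phi> x \<ge> 0" "\<phi> x0 > 0" "\<And>x. x \<notin> cball x0 r \<Longrightarrow> \<phi> x = 0"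
    using smooth_bump[OF r(1)] by blast
  let ?w = "\<lambda>x. \<phi> x * (s * u x)"
  have w: "continuous_on S ?w" for S
    by (intro continuous_on_mult smooth_continuous[OF \<phi>(1)] continuous_on_subset[OF c]) simp
  have nn: "0 \<le> ?w x" for x
  proof (cases "x \<in> cball x0 r")
    case True
    then have "0 < s * u x" using r(2) by blast
    then show ?thesis using \<phi>(2)[of x] by simp
  qed (simp add: \<phi>(4))
  have int: "integrable lborel ?w"
  proof -
    have "integrable lborel (\<lambda>x. indicator (cball x0 r) x *\<^sub>R ?w x)"
      by (rule borel_integrable_compact) (use w in auto)
    moreover have "indicator (cball x0 r) x *\<^sub>R ?w x = ?w x" for x using \<phi>(4)[of x] by (auto simp: indicator_def)
    ultimately show ?thesis by (simp only:)
  qed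
  have "(LINT x|lborel. ?w x) = s * (LINT x|lborel. \<phi> x * u x)"
    by (simp add: mult.left_commute)
  also have "\<dots> = 0" using z[OF \<phi>(1) compact_cball \<phi>(4)] by simp
  finally have "AE x in lborel. ?w x = 0"
    using integral_nonneg_eq_0_iff_AE[OF int] nn by auto
  then have "?w x0 = 0"
  proof -
    have "open {x. ?w x \<noteq> 0}"
      by (rule open_Collect_neq[OF w continuous_on_const])
    moreover have "{x. ?w x \<noteq> 0} \<in> null_sets lborel"
      using \<open>AE x in lborel. ?w x = 0\<close> calculation by (subst (asm) AE_iff_null) auto
    ultimately have "{x. ?w x \<noteq> 0} = {}"
      using negligible_iff_null_sets open_not_negligible null_sets_completionI by blast
    then show ?thesis by blast
  qed
  then show False using \<phi>(3) pos by (metis mult_pos_pos less_irrefl)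
qed

section \<open>The covariant divergence of the curvature\<close>

text \<open>The rules from here on are equations between functions, so that they also rewrite
  beneath a further derivative.\<close>

lemma pd_add_smooth: "smooth f \<Longrightarrow> smooth g \<Longrightarrow> pd \<alpha> (\<lambda>y. f y + g y) = (\<lambda>x. pd \<alpha> f x + pd \<alpha> g x)"
  by (intro ext pd_add smooth_differentiable)

lemma pd_mult_smooth:
  fixes f g :: "spacetime \<Rightarrow> real"
  shows "smooth f \<Longrightarrow> smooth g \<Longrightarrow> pd \<alpha> (\<lambda>y. f y * g y) = (\<lambda>x. f x * pd \<alpha> g x + pd \<alpha> f x * g x)"
  by (intro ext pd_mult smooth_differentiable)

lemma pd_cmult_smooth: "smooth f \<Longrightarrow> pd \<alpha> (\<lambda>y. c * f y :: real) = (\<lambda>x. c * pd \<alpha> f x)"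
  using pd_cmult[OF smooth_differentiable] by (metis (no_types, lifting) ext real_scaleR_def)

lemma pd_diff_smooth:
  fixes f g :: "spacetime \<Rightarrow> real"
  assumes f: "smooth f" and g: "smooth g"
  shows "pd \<alpha> (\<lambda>y. f y - g y) = (\<lambda>x. pd \<alpha> f x - pd \<alpha> g x)"
  using pd_add_smooth[OF f smooth_cmult[OF g, of "-1"], of \<alpha>] pd_cmult_smooth[OF g, of \<alpha> "-1"] by simp

lemma pd_uminus_smooth: "smooth f \<Longrightarrow> pd \<alpha> (\<lambda>y. - f y :: real) = (\<lambda>x. - pd \<alpha> f x)"
  by (intro ext pd_uminus smooth_differentiable)

lemma pd_sum_smooth: "(\<And>i. smooth (f i)) \<Longrightarrow> pd \<alpha> (\<lambda>y. \<Sum>i\<in>S. f i y) = (\<lambda>x. \<Sum>i\<in>S. pd \<alpha> (f i) x)"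
  by (intro ext pd_sum smooth_differentiable)

lemmas pd_smooth_rules = pd_add_smooth pd_mult_smooth pd_cmult_smooth pd_diff_smooth pd_sum_smooth
lemmas smooth_rules = smooth_add smooth_mult smooth_cmult smooth_diff smooth_sum smooth_pd

lemma smooth_F_ddd: "smooth_field F \<Longrightarrow> smooth (F_ddd F \<alpha> \<rho> \<sigma>)"
  unfolding F_ddd_eq real_scaleR_def by (intro smooth_cmult) (simp add: smooth_field_def)

lemma F_ddd_antisym: "Fierz F \<Longrightarrow> F_ddd F \<alpha> \<rho> \<sigma> x = - F_ddd F \<alpha> \<sigma> \<rho> x"
  using Fierz_antisym[of F \<alpha> \<rho> \<sigma> x] by (simp add: F_ddd_eq)

lemma F_ddd_antisym_fun: "Fierz F \<Longrightarrow> F_ddd F \<alpha> \<rho> \<sigma> = (\<lambda>x. - F_ddd F \<alpha> \<sigma> \<rho> x)"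
  using F_ddd_antisym by blast

text \<open>All index positions are reduced to fully lowered components. As the metric is diagonal
  with entries of square one, every raised index is just a factor \<open>e\<close>, and tensor
  identities become polynomial identities between summands.\<close>

lemma lower_raise:
  "F \<alpha> \<rho> \<sigma> x = e \<alpha> * e \<rho> * e \<sigma> * F_ddd F \<alpha> \<rho> \<sigma> x"
  "F_uud F \<alpha> \<rho> \<sigma> x = e \<alpha> * e \<rho> * F_ddd F \<alpha> \<rho> \<sigma> x"
  "F_udd F \<alpha> \<rho> \<sigma> x = e \<alpha> * F_ddd F \<alpha> \<rho> \<sigma> x"
  "F_duu F \<alpha> \<rho> \<sigma> x = e \<rho> * e \<sigma> * F_ddd F \<alpha> \<rho> \<sigma> x"
  "F_ddu F \<alpha> \<rho> \<sigma> x = e \<sigma> * F_ddd F \<alpha> \<rho> \<sigma> x"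
  unfolding F_ddd_eq F_uud_def F_udd_def F_duu_def F_ddu_def shift_eq real_scaleR_def
  using eta_diag_sq(1)[of \<alpha>] eta_diag_sq(1)[of \<rho>] eta_diag_sq(1)[of \<sigma>] by algebra+

lemma curv_eq:
  "curv F \<alpha> \<beta> \<rho> \<sigma> x = pd \<alpha> (F_ddd F \<beta> \<rho> \<sigma>) x - pd \<beta> (F_ddd F \<alpha> \<rho> \<sigma>) x
     + 4 * (\<Sum>\<nu>\<in>UNIV. e \<nu> * (F_ddd F \<alpha> \<rho> \<nu> x * F_ddd F \<beta> \<nu> \<sigma> x - F_ddd F \<beta> \<rho> \<nu> x * F_ddd F \<alpha> \<nu> \<sigma> x))"
  unfolding curv_def lower_raise(5) by (simp add: algebra_simps)

lemma smooth_curv: "smooth_field F \<Longrightarrow> smooth (curv F \<alpha> \<beta> \<rho> \<sigma>)"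
  unfolding curv_eq[abs_def] by (intro smooth_rules smooth_F_ddd)

text \<open>The gauge-covariant divergence of the curvature, in the form in which integration by
  parts of the first variation produces it.\<close>

definition div_curv :: "field3 \<Rightarrow> field3" where
  "div_curv F \<alpha> \<rho> \<sigma> x = (\<Sum>\<beta>\<in>UNIV. e \<beta> * pd \<beta> (curv F \<beta> \<alpha> \<rho> \<sigma>) x)
     - 4 * (\<Sum>\<beta>\<in>UNIV. \<Sum>\<nu>\<in>UNIV. e \<beta> * e \<nu> *
         (curv F \<beta> \<alpha> \<sigma> \<nu> x * F_ddd F \<beta> \<rho> \<nu> x - curv F \<beta> \<alpha> \<rho> \<nu> x * F_ddd F \<beta> \<sigma> \<nu> x))"

text \<open>Expanding the curvature gives the same monomials as \<open>xi\<close>. The term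
  \<open>A\<close> arises twice, from the derivative of the quadratic part and from the derivative
  part multiplied by the connection, and this explains its extra factor 2.\<close>

lemma div_curv_eq_xi:
  assumes F: "smooth_field F" "Fierz F"
  shows "div_curv F \<alpha> \<rho> \<sigma> x = xi F \<alpha> \<rho> \<sigma> x"
proof -
  define G where "G \<alpha> \<rho> \<sigma> = F_ddd F \<alpha> \<rho> \<sigma> x" for \<alpha> \<rho> \<sigma>
  define d where "d \<beta> \<alpha> \<rho> \<sigma> = pd \<beta> (F_ddd F \<alpha> \<rho> \<sigma>) x" for \<beta> \<alpha> \<rho> \<sigma>
  \<comment> \<open>\<open>A\<close>, \<open>B\<close>, \<open>R\<close> are the terms of
    \<open>xi_tilde\<close> with one first derivative, \<open>U\<close> and \<open>V\<close> the
    cubic ones and \<open>L\<close> the second derivatives. \<open>L\<close> is antisymmetric by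
    itself, so it passes unchanged through the antisymmetrization in \<open>xi\<close>.\<close>
  define A where "A \<rho> \<sigma> = (\<Sum>\<beta>\<in>UNIV. \<Sum>\<nu>\<in>UNIV. e \<beta> * e \<nu> * G \<beta> \<nu> \<rho> * d \<beta> \<alpha> \<sigma> \<nu>)" for \<rho> \<sigma>
  define B where "B \<rho> \<sigma> = (\<Sum>\<beta>\<in>UNIV. \<Sum>\<nu>\<in>UNIV. e \<beta> * e \<nu> * G \<beta> \<nu> \<rho> * d \<alpha> \<beta> \<nu> \<sigma>)" for \<rho> \<sigma>
  define R where "R \<rho> \<sigma> = (\<Sum>\<beta>\<in>UNIV. \<Sum>\<nu>\<in>UNIV. e \<beta> * e \<nu> * G \<alpha> \<rho> \<nu> * d \<beta> \<beta> \<sigma> \<nu>)" for \<rho> \<sigma>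
  define U where "U \<rho> \<sigma> = (\<Sum>\<beta>\<in>UNIV. \<Sum>\<mu>\<in>UNIV. \<Sum>\<nu>\<in>UNIV. e \<beta> * e \<mu> * e \<nu> * (G \<beta> \<rho> \<mu> * G \<alpha> \<mu> \<nu> * G \<beta> \<nu> \<sigma>))" for \<rho> \<sigma>
  define V where "V \<rho> \<sigma> = (\<Sum>\<beta>\<in>UNIV. \<Sum>\<mu>\<in>UNIV. \<Sum>\<nu>\<in>UNIV. e \<beta> * e \<mu> * e \<nu> * (G \<beta> \<rho> \<mu> * G \<beta> \<mu> \<nu> * G \<alpha> \<nu> \<sigma>))" for \<rho> \<sigma>
  define L where "L \<rho> \<sigma> = (\<Sum>\<beta>\<in>UNIV. e \<beta> * (pd \<beta> (pd \<beta> (F_ddd F \<alpha> \<rho> \<sigma>)) x - pd \<beta> (pd \<alpha> (F_ddd F \<beta> \<rho> \<sigma>)) x))" for \<rho> \<sigma>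
  note sm = smooth_F_ddd[OF F(1)]
  have Ga: "G \<alpha> \<rho> \<sigma> = - G \<alpha> \<sigma> \<rho>" for \<alpha> \<rho> \<sigma>
    unfolding G_def by (rule F_ddd_antisym[OF F(2)])
  have pa: "pd \<beta> (F_ddd F \<alpha> \<rho> \<sigma>) = (\<lambda>x. - pd \<beta> (F_ddd F \<alpha> \<sigma> \<rho>) x)" for \<beta> \<alpha> \<rho> \<sigma>
    using pd_uminus_smooth[OF sm, of \<beta> \<alpha> \<sigma> \<rho>] F_ddd_antisym_fun[OF F(2), of \<alpha> \<rho> \<sigma>] by simp
  have da: "d \<beta> \<alpha> \<rho> \<sigma> = - d \<beta> \<alpha> \<sigma> \<rho>" for \<beta> \<alpha> \<rho> \<sigma>
    unfolding d_def by (subst pa) simp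
  have ppa: "pd \<gamma> (pd \<beta> (F_ddd F \<alpha> \<rho> \<sigma>)) x = - pd \<gamma> (pd \<beta> (F_ddd F \<alpha> \<sigma> \<rho>)) x" for \<gamma> \<beta> \<alpha> \<rho> \<sigma>
    by (subst pa) (simp add: pd_uminus_smooth smooth_pd sm)
  have La: "L \<sigma> \<rho> = - L \<rho> \<sigma>"
    unfolding L_def sum_negf[symmetric] by (intro sum.cong refl, subst (1 2) ppa) (simp add: algebra_simps)
  have xt: "xi_tilde F \<alpha> \<rho> \<sigma> x = 8 * (2 * A \<rho> \<sigma> + B \<rho> \<sigma> + R \<rho> \<sigma>) - 32 * (U \<rho> \<sigma> - V \<rho> \<sigma>) + L \<rho> \<sigma>" for \<rho> \<sigma>
  proof -
    have l1: "pd \<beta> (\<lambda>y. shift \<beta> (\<lambda>\<mu>. pd \<mu> (F_ddd F \<alpha> \<rho> \<sigma>) y)) x = e \<beta> * pd \<beta> (pd \<beta> (F_ddd F \<alpha> \<rho> \<sigma>)) x" for \<beta>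
      by (simp add: shift_eq pd_cmult_smooth smooth_pd sm)
    have u: "F_udd F \<beta> \<rho> \<sigma> = (\<lambda>x. e \<beta> * F_ddd F \<beta> \<rho> \<sigma> x)" for \<beta> \<rho> \<sigma>
      by (rule ext, rule lower_raise)
    have l2: "pd \<gamma> (F_udd F \<beta> \<rho> \<sigma>) = (\<lambda>x. e \<beta> * pd \<gamma> (F_ddd F \<beta> \<rho> \<sigma>) x)" for \<beta> \<gamma> \<rho> \<sigma>
      unfolding u by (rule pd_cmult_smooth[OF sm])
    have l3: "pd \<beta> (pd \<alpha> (F_udd F \<beta> \<rho> \<sigma>)) x = e \<beta> * pd \<beta> (pd \<alpha> (F_ddd F \<beta> \<rho> \<sigma>)) x" for \<beta>
      unfolding l2 by (simp add: pd_cmult_smooth smooth_pd sm)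
    have 1: "(\<Sum>\<beta>\<in>UNIV. \<Sum>\<nu>\<in>UNIV. F_uud F \<beta> \<nu> \<rho> x * pd \<beta> (F_ddd F \<alpha> \<sigma> \<nu>) x) = A \<rho> \<sigma>"
      "(\<Sum>\<beta>\<in>UNIV. \<Sum>\<nu>\<in>UNIV. F_uud F \<beta> \<nu> \<rho> x * pd \<alpha> (F_ddd F \<beta> \<nu> \<sigma>) x) = B \<rho> \<sigma>"
      by (simp_all add: A_def B_def lower_raise(2) G_def d_def)
    have 2: "(\<Sum>\<beta>\<in>UNIV. \<Sum>\<nu>\<in>UNIV. F_ddu F \<alpha> \<rho> \<nu> x * pd \<beta> (F_udd F \<beta> \<sigma> \<nu>) x) = R \<rho> \<sigma>"
      unfolding R_def l2 lower_raise(5) G_def d_def by (intro sum.cong refl) (simp add: mult_ac)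
    have 3: "(\<Sum>\<beta>\<in>UNIV. \<Sum>\<mu>\<in>UNIV. \<Sum>\<nu>\<in>UNIV. F_ddd F \<beta> \<rho> \<mu> x * F_duu F \<alpha> \<mu> \<nu> x * F_udd F \<beta> \<nu> \<sigma> x) = U \<rho> \<sigma>"
      unfolding U_def lower_raise(3,4) G_def by (intro sum.cong refl) (simp add: mult_ac)
    have 4: "(\<Sum>\<beta>\<in>UNIV. \<Sum>\<mu>\<in>UNIV. \<Sum>\<nu>\<in>UNIV. F_ddd F \<beta> \<rho> \<mu> x * F \<beta> \<mu> \<nu> x * F_ddd F \<alpha> \<nu> \<sigma> x) = V \<rho> \<sigma>"
      unfolding V_def
    proof (intro sum.cong refl)
      fix \<beta> \<mu> \<nu>
      have "F \<beta> \<mu> \<nu> x = e \<beta> * e \<mu> * e \<nu> * G \<beta> \<mu> \<nu>" unfolding G_def by (rule lower_raise)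
      then show "F_ddd F \<beta> \<rho> \<mu> x * F \<beta> \<mu> \<nu> x * F_ddd F \<alpha> \<nu> \<sigma> x =
          e \<beta> * e \<mu> * e \<nu> * (G \<beta> \<rho> \<mu> * G \<beta> \<mu> \<nu> * G \<alpha> \<nu> \<sigma>)"
        unfolding G_def by algebra
    qed
    have 5: "L \<rho> \<sigma> = (\<Sum>\<beta>\<in>UNIV. pd \<beta> (\<lambda>y. shift \<beta> (\<lambda>\<mu>. pd \<mu> (F_ddd F \<alpha> \<rho> \<sigma>) y)) x)
       - (\<Sum>\<beta>\<in>UNIV. pd \<beta> (pd \<alpha> (F_udd F \<beta> \<rho> \<sigma>)) x)"
      unfolding l1 l3 L_def by (simp only: right_diff_distrib sum_subtractf)
    show ?thesis unfolding xi_tilde_def 1 2 3 4 5 by simp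
  qed
  have C: "curv F \<beta> \<alpha> \<rho> \<sigma> x = d \<beta> \<alpha> \<rho> \<sigma> - d \<alpha> \<beta> \<rho> \<sigma> + 4 * (\<Sum>\<mu>\<in>UNIV. e \<mu> * (G \<beta> \<rho> \<mu> * G \<alpha> \<mu> \<sigma> - G \<alpha> \<rho> \<mu> * G \<beta> \<mu> \<sigma>))" for \<beta> \<rho> \<sigma>
    unfolding curv_eq G_def d_def ..
  have dC: "pd \<beta> (curv F \<beta> \<alpha> \<rho> \<sigma>) x = pd \<beta> (pd \<beta> (F_ddd F \<alpha> \<rho> \<sigma>)) x - pd \<beta> (pd \<alpha> (F_ddd F \<beta> \<rho> \<sigma>)) x
     + 4 * (\<Sum>\<nu>\<in>UNIV. e \<nu> * (G \<beta> \<rho> \<nu> * d \<beta> \<alpha> \<nu> \<sigma> + d \<beta> \<beta> \<rho> \<nu> * G \<alpha> \<nu> \<sigma> - (G \<alpha> \<rho> \<nu> * d \<beta> \<beta> \<nu> \<sigma> + d \<beta> \<alpha> \<rho> \<nu> * G \<beta> \<nu> \<sigma>)))" for \<beta>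
    unfolding curv_eq[abs_def] by (simp add: pd_smooth_rules smooth_rules sm G_def d_def)
  have 1: "(\<Sum>\<beta>\<in>UNIV. e \<beta> * pd \<beta> (curv F \<beta> \<alpha> \<rho> \<sigma>) x) = L \<rho> \<sigma> + 4 * (A \<rho> \<sigma> - R \<sigma> \<rho> + R \<rho> \<sigma> - A \<sigma> \<rho>)"
  proof -
    have "A \<rho> \<sigma> - R \<sigma> \<rho> + R \<rho> \<sigma> - A \<sigma> \<rho> = (\<Sum>\<beta>\<in>UNIV. \<Sum>\<nu>\<in>UNIV. e \<beta> * e \<nu> * (G \<beta> \<nu> \<rho> * d \<beta> \<alpha> \<sigma> \<nu> - G \<alpha> \<sigma> \<nu> * d \<beta> \<beta> \<rho> \<nu>
        + G \<alpha> \<rho> \<nu> * d \<beta> \<beta> \<sigma> \<nu> - G \<beta> \<nu> \<sigma> * d \<beta> \<alpha> \<rho> \<nu>))"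
      unfolding A_def R_def by (simp add: algebra_simps sum.distrib sum_subtractf)
    also have "\<dots> = (\<Sum>\<beta>\<in>UNIV. e \<beta> * (\<Sum>\<nu>\<in>UNIV. e \<nu> * (G \<beta> \<rho> \<nu> * d \<beta> \<alpha> \<nu> \<sigma> + d \<beta> \<beta> \<rho> \<nu> * G \<alpha> \<nu> \<sigma> - (G \<alpha> \<rho> \<nu> * d \<beta> \<beta> \<nu> \<sigma> + d \<beta> \<alpha> \<rho> \<nu> * G \<beta> \<nu> \<sigma>))))"
      unfolding sum_distrib_left
    proof (intro sum.cong refl)
      fix \<beta> \<nu>
      show "e \<beta> * e \<nu> * (G \<beta> \<nu> \<rho> * d \<beta> \<alpha> \<sigma> \<nu> - G \<alpha> \<sigma> \<nu> * d \<beta> \<beta> \<rho> \<nu>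
        + G \<alpha> \<rho> \<nu> * d \<beta> \<beta> \<sigma> \<nu> - G \<beta> \<nu> \<sigma> * d \<beta> \<alpha> \<rho> \<nu>) =
        e \<beta> * (e \<nu> * (G \<beta> \<rho> \<nu> * d \<beta> \<alpha> \<nu> \<sigma> + d \<beta> \<beta> \<rho> \<nu> * G \<alpha> \<nu> \<sigma> - (G \<alpha> \<rho> \<nu> * d \<beta> \<beta> \<nu> \<sigma> + d \<beta> \<alpha> \<rho> \<nu> * G \<beta> \<nu> \<sigma>)))"
        using Ga[of \<beta> \<rho> \<nu>] da[of \<beta> \<alpha> \<nu> \<sigma>] Ga[of \<alpha> \<nu> \<sigma>] da[of \<beta> \<beta> \<nu> \<sigma>] Ga[of \<beta> \<nu> \<sigma>] by algebra
    qed
    finally have *: "A \<rho> \<sigma> - R \<sigma> \<rho> + R \<rho> \<sigma> - A \<sigma> \<rho> = \<dots>" .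
    show ?thesis unfolding dC * L_def
      by (simp only: distrib_left sum.distrib sum_distrib_left[of 4] mult.left_commute[of 4])
  qed
  \<comment> \<open>Curvature times connection: its derivative part gives \<open>A\<close> and
    \<open>B\<close>, its quadratic part the cubic terms. In \<open>U\<close> the free indices come
    out reversed, which costs only a relabelling of two summed indices.\<close>
  have 2: "(\<Sum>\<beta>\<in>UNIV. \<Sum>\<nu>\<in>UNIV. e \<beta> * e \<nu> * (curv F \<beta> \<alpha> \<sigma> \<nu> x * G \<beta> \<rho> \<nu>)) = - A \<rho> \<sigma> - B \<rho> \<sigma> + 4 * (- U \<sigma> \<rho> - V \<rho> \<sigma>)" for \<rho> \<sigma>
  proof -
    have V': "V \<rho> \<sigma> = (\<Sum>\<beta>\<in>UNIV. \<Sum>\<nu>\<in>UNIV. \<Sum>\<mu>\<in>UNIV. e \<beta> * e \<nu> * e \<mu> * (G \<beta> \<rho> \<nu> * G \<beta> \<nu> \<mu> * G \<alpha> \<mu> \<sigma>))"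
      unfolding V_def ..
    have U': "U \<sigma> \<rho> = (\<Sum>\<beta>\<in>UNIV. \<Sum>\<nu>\<in>UNIV. \<Sum>\<mu>\<in>UNIV. e \<beta> * e \<mu> * e \<nu> * (G \<beta> \<sigma> \<mu> * G \<alpha> \<mu> \<nu> * G \<beta> \<nu> \<rho>))"
      unfolding U_def by (rule sum.cong[OF refl], rule sum.swap)
    have "- A \<rho> \<sigma> - B \<rho> \<sigma> + 4 * (- U \<sigma> \<rho> - V \<rho> \<sigma>) = (\<Sum>\<beta>\<in>UNIV. \<Sum>\<nu>\<in>UNIV.
        - (e \<beta> * e \<nu> * G \<beta> \<nu> \<rho> * d \<beta> \<alpha> \<sigma> \<nu>) - (e \<beta> * e \<nu> * G \<beta> \<nu> \<rho> * d \<alpha> \<beta> \<nu> \<sigma>) +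
        4 * (- (\<Sum>\<mu>\<in>UNIV. e \<beta> * e \<mu> * e \<nu> * (G \<beta> \<sigma> \<mu> * G \<alpha> \<mu> \<nu> * G \<beta> \<nu> \<rho>)) - (\<Sum>\<mu>\<in>UNIV. e \<beta> * e \<nu> * e \<mu> * (G \<beta> \<rho> \<nu> * G \<beta> \<nu> \<mu> * G \<alpha> \<mu> \<sigma>))))"
      unfolding A_def B_def U' V' by (simp only: sum.distrib sum_subtractf sum_negf sum_distrib_left[of 4, symmetric])
    also have "\<dots> = (\<Sum>\<beta>\<in>UNIV. \<Sum>\<nu>\<in>UNIV. e \<beta> * e \<nu> * (curv F \<beta> \<alpha> \<sigma> \<nu> x * G \<beta> \<rho> \<nu>))"
    proof (intro sum.cong refl)
      fix \<beta> \<nu>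
      have "- (\<Sum>\<mu>\<in>UNIV. e \<beta> * e \<mu> * e \<nu> * (G \<beta> \<sigma> \<mu> * G \<alpha> \<mu> \<nu> * G \<beta> \<nu> \<rho>)) - (\<Sum>\<mu>\<in>UNIV. e \<beta> * e \<nu> * e \<mu> * (G \<beta> \<rho> \<nu> * G \<beta> \<nu> \<mu> * G \<alpha> \<mu> \<sigma>)) =
        e \<beta> * e \<nu> * (G \<beta> \<rho> \<nu> * (\<Sum>\<mu>\<in>UNIV. e \<mu> * (G \<beta> \<sigma> \<mu> * G \<alpha> \<mu> \<nu> - G \<alpha> \<sigma> \<mu> * G \<beta> \<mu> \<nu>)))"
        unfolding sum_distrib_left sum_negf[symmetric] sum_subtractf[symmetric]
      proof (intro sum.cong refl)
        fix \<mu>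
        show "- (e \<beta> * e \<mu> * e \<nu> * (G \<beta> \<sigma> \<mu> * G \<alpha> \<mu> \<nu> * G \<beta> \<nu> \<rho>)) - e \<beta> * e \<nu> * e \<mu> * (G \<beta> \<rho> \<nu> * G \<beta> \<nu> \<mu> * G \<alpha> \<mu> \<sigma>) =
          e \<beta> * e \<nu> * (G \<beta> \<rho> \<nu> * (e \<mu> * (G \<beta> \<sigma> \<mu> * G \<alpha> \<mu> \<nu> - G \<alpha> \<sigma> \<mu> * G \<beta> \<mu> \<nu>)))"
          using Ga[of \<beta> \<nu> \<rho>] Ga[of \<beta> \<nu> \<mu>] Ga[of \<alpha> \<mu> \<sigma>] by algebra
      qed
      then show "- (e \<beta> * e \<nu> * G \<beta> \<nu> \<rho> * d \<beta> \<alpha> \<sigma> \<nu>) - (e \<beta> * e \<nu> * G \<beta> \<nu> \<rho> * d \<alpha> \<beta> \<nu> \<sigma>) +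
        4 * (- (\<Sum>\<mu>\<in>UNIV. e \<beta> * e \<mu> * e \<nu> * (G \<beta> \<sigma> \<mu> * G \<alpha> \<mu> \<nu> * G \<beta> \<nu> \<rho>)) - (\<Sum>\<mu>\<in>UNIV. e \<beta> * e \<nu> * e \<mu> * (G \<beta> \<rho> \<nu> * G \<beta> \<nu> \<mu> * G \<alpha> \<mu> \<sigma>)))
         = e \<beta> * e \<nu> * (curv F \<beta> \<alpha> \<sigma> \<nu> x * G \<beta> \<rho> \<nu>)"
        unfolding C using Ga[of \<beta> \<nu> \<rho>] da[of \<alpha> \<beta> \<nu> \<sigma>] by algebra
    qed
    finally show ?thesis by simp
  qed
  have "div_curv F \<alpha> \<rho> \<sigma> x = L \<rho> \<sigma> + 4 * (A \<rho> \<sigma> - R \<sigma> \<rho> + R \<rho> \<sigma> - A \<sigma> \<rho>)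
     - 4 * ((- A \<rho> \<sigma> - B \<rho> \<sigma> + 4 * (- U \<sigma> \<rho> - V \<rho> \<sigma>)) - (- A \<sigma> \<rho> - B \<sigma> \<rho> + 4 * (- U \<rho> \<sigma> - V \<sigma> \<rho>)))"
    unfolding div_curv_def 1 2[symmetric] by (simp only: G_def right_diff_distrib sum_subtractf)
  also have "\<dots> = xi F \<alpha> \<rho> \<sigma> x" unfolding xi_def xt La by simp
  finally show ?thesis .
qed

section \<open>The first variation\<close>

text \<open>The covariant derivative of \<open>f\<close>, viewed as a one-form with values in
  so(1,3); the connection acts by the matrix commutator with the factor 4 of the curvature.\<close>

definition cov_deriv :: "field3 \<Rightarrow> field3 \<Rightarrow> 4 \<Rightarrow> 4 \<Rightarrow> 4 \<Rightarrow> 4 \<Rightarrow> spacetime \<Rightarrow> real" where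
  "cov_deriv F f \<alpha> \<beta> \<rho> \<sigma> x = pd \<alpha> (F_ddd f \<beta> \<rho> \<sigma>) x
     + 4 * (\<Sum>\<nu>\<in>UNIV. e \<nu> * (F_ddd F \<alpha> \<rho> \<nu> x * F_ddd f \<beta> \<nu> \<sigma> x - F_ddd f \<beta> \<rho> \<nu> x * F_ddd F \<alpha> \<nu> \<sigma> x))"

definition curv_lin :: "field3 \<Rightarrow> field3 \<Rightarrow> 4 \<Rightarrow> 4 \<Rightarrow> 4 \<Rightarrow> 4 \<Rightarrow> spacetime \<Rightarrow> real" where
  "curv_lin F f \<alpha> \<beta> \<rho> \<sigma> x = cov_deriv F f \<alpha> \<beta> \<rho> \<sigma> x - cov_deriv F f \<beta> \<alpha> \<rho> \<sigma> x"

definition curv_quad :: "field3 \<Rightarrow> 4 \<Rightarrow> 4 \<Rightarrow> 4 \<Rightarrow> 4 \<Rightarrow> spacetime \<Rightarrow> real" where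
  "curv_quad f \<alpha> \<beta> \<rho> \<sigma> x =
     4 * (\<Sum>\<nu>\<in>UNIV. e \<nu> * (F_ddd f \<alpha> \<rho> \<nu> x * F_ddd f \<beta> \<nu> \<sigma> x - F_ddd f \<beta> \<rho> \<nu> x * F_ddd f \<alpha> \<nu> \<sigma> x))"

abbreviation perturb :: "field3 \<Rightarrow> real \<Rightarrow> field3 \<Rightarrow> field3" where
  "perturb F s f \<equiv> \<lambda>\<alpha> \<rho> \<sigma> x. F \<alpha> \<rho> \<sigma> x + s * f \<alpha> \<rho> \<sigma> x"

lemma curv_perturb:
  assumes F: "smooth_field F" and f: "smooth_field f"
  shows "curv (perturb F s f) \<alpha> \<beta> \<rho> \<sigma> x =
     curv F \<alpha> \<beta> \<rho> \<sigma> x + s * curv_lin F f \<alpha> \<beta> \<rho> \<sigma> x + s\<^sup>2 * curv_quad f \<alpha> \<beta> \<rho> \<sigma> x"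
proof -
  have G: "F_ddd (perturb F s f) \<alpha> \<rho> \<sigma> = (\<lambda>x. F_ddd F \<alpha> \<rho> \<sigma> x + s * F_ddd f \<alpha> \<rho> \<sigma> x)" for \<alpha> \<rho> \<sigma>
    by (simp add: F_ddd_eq algebra_simps)
  have pG: "pd \<gamma> (\<lambda>x. F_ddd F \<alpha> \<rho> \<sigma> x + s * F_ddd f \<alpha> \<rho> \<sigma> x) x =
      pd \<gamma> (F_ddd F \<alpha> \<rho> \<sigma>) x + s * pd \<gamma> (F_ddd f \<alpha> \<rho> \<sigma>) x" for \<gamma> \<alpha> \<rho> \<sigma>
    by (simp add: pd_add_smooth pd_cmult_smooth smooth_cmult smooth_F_ddd F f)
  let ?G = "\<lambda>\<alpha> \<rho> \<sigma>. F_ddd F \<alpha> \<rho> \<sigma> x" and ?g = "\<lambda>\<alpha> \<rho> \<sigma>. F_ddd f \<alpha> \<rho> \<sigma> x"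
  \<comment> \<open>The terms linear in \<open>s\<close> are grouped into two commutators that
    differ by exchanging \<alpha> and \<beta>, matching the two covariant derivatives in
    \<open>curv_lin\<close>.\<close>
  have "(\<Sum>\<nu>\<in>UNIV. e \<nu> * ((?G \<alpha> \<rho> \<nu> + s * ?g \<alpha> \<rho> \<nu>) * (?G \<beta> \<nu> \<sigma> + s * ?g \<beta> \<nu> \<sigma>) - (?G \<beta> \<rho> \<nu> + s * ?g \<beta> \<rho> \<nu>) * (?G \<alpha> \<nu> \<sigma> + s * ?g \<alpha> \<nu> \<sigma>)))
   = (\<Sum>\<nu>\<in>UNIV. e \<nu> * (?G \<alpha> \<rho> \<nu> * ?G \<beta> \<nu> \<sigma> - ?G \<beta> \<rho> \<nu> * ?G \<alpha> \<nu> \<sigma>))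
    + s * (\<Sum>\<nu>\<in>UNIV. e \<nu> * (?G \<alpha> \<rho> \<nu> * ?g \<beta> \<nu> \<sigma> - ?g \<beta> \<rho> \<nu> * ?G \<alpha> \<nu> \<sigma>))
    + (- s) * (\<Sum>\<nu>\<in>UNIV. e \<nu> * (?G \<beta> \<rho> \<nu> * ?g \<alpha> \<nu> \<sigma> - ?g \<alpha> \<rho> \<nu> * ?G \<beta> \<nu> \<sigma>))
    + s\<^sup>2 * (\<Sum>\<nu>\<in>UNIV. e \<nu> * (?g \<alpha> \<rho> \<nu> * ?g \<beta> \<nu> \<sigma> - ?g \<beta> \<rho> \<nu> * ?g \<alpha> \<nu> \<sigma>))"
    unfolding sum_distrib_left sum.distrib[symmetric]
    by (intro sum.cong refl) (simp add: algebra_simps power2_eq_square)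
  then show ?thesis
    unfolding curv_lin_def cov_deriv_def curv_quad_def curv_eq G pG by (simp add: algebra_simps)
qed

lemma smooth_perturb: "smooth_field F \<Longrightarrow> smooth_field f \<Longrightarrow> smooth_field (perturb F s f)"
  by (simp add: smooth_field_def smooth_rules)

lemma Fierz_trace: "Fierz F \<Longrightarrow> (\<Sum>\<alpha>\<in>UNIV. \<Sum>\<rho>\<in>UNIV. eta \<alpha> \<rho> * F \<alpha> \<rho> \<sigma> x) = 0"
  unfolding Fierz_def by blast

lemma Fierz_eps: "Fierz F \<Longrightarrow> (\<Sum>\<alpha>\<in>UNIV. \<Sum>\<rho>\<in>UNIV. \<Sum>\<sigma>\<in>UNIV. eps \<alpha> \<rho> \<sigma> \<omega> * F \<alpha> \<rho> \<sigma> x) = 0"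
  unfolding Fierz_def by blast

lemma Fierz_perturb:
  assumes F: "Fierz F" and f: "Fierz f" shows "Fierz (perturb F s f)"
  unfolding Fierz_def
proof (intro allI conjI)
  fix x \<alpha> \<rho> \<sigma> \<omega>
  show "F \<alpha> \<rho> \<sigma> x + s * f \<alpha> \<rho> \<sigma> x = - (F \<alpha> \<sigma> \<rho> x + s * f \<alpha> \<sigma> \<rho> x)"
    using Fierz_antisym[OF F, of \<alpha> \<rho> \<sigma> x] Fierz_antisym[OF f, of \<alpha> \<rho> \<sigma> x] by algebra
  have "(\<Sum>\<alpha>\<in>UNIV. \<Sum>\<rho>\<in>UNIV. eta \<alpha> \<rho> * (F \<alpha> \<rho> \<sigma> x + s * f \<alpha> \<rho> \<sigma> x)) =
    (\<Sum>\<alpha>\<in>UNIV. \<Sum>\<rho>\<in>UNIV. eta \<alpha> \<rho> * F \<alpha> \<rho> \<sigma> x) + s * (\<Sum>\<alpha>\<in>UNIV. \<Sum>\<rho>\<in>UNIV. eta \<alpha> \<rho> * f \<alpha> \<rho> \<sigma> x)"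
    by (simp only: distrib_left sum.distrib mult.left_commute[of _ s] sum_distrib_left[symmetric])
  then show "(\<Sum>\<alpha>\<in>UNIV. \<Sum>\<rho>\<in>UNIV. eta \<alpha> \<rho> * (F \<alpha> \<rho> \<sigma> x + s * f \<alpha> \<rho> \<sigma> x)) = 0"
    by (simp add: Fierz_trace[OF F] Fierz_trace[OF f])
  have "(\<Sum>\<alpha>\<in>UNIV. \<Sum>\<rho>\<in>UNIV. \<Sum>\<sigma>\<in>UNIV. eps \<alpha> \<rho> \<sigma> \<omega> * (F \<alpha> \<rho> \<sigma> x + s * f \<alpha> \<rho> \<sigma> x)) =
    (\<Sum>\<alpha>\<in>UNIV. \<Sum>\<rho>\<in>UNIV. \<Sum>\<sigma>\<in>UNIV. eps \<alpha> \<rho> \<sigma> \<omega> * F \<alpha> \<rho> \<sigma> x)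
    + s * (\<Sum>\<alpha>\<in>UNIV. \<Sum>\<rho>\<in>UNIV. \<Sum>\<sigma>\<in>UNIV. eps \<alpha> \<rho> \<sigma> \<omega> * f \<alpha> \<rho> \<sigma> x)"
    by (simp only: distrib_left sum.distrib mult.left_commute[of _ s] sum_distrib_left[symmetric])
  then show "(\<Sum>\<alpha>\<in>UNIV. \<Sum>\<rho>\<in>UNIV. \<Sum>\<sigma>\<in>UNIV. eps \<alpha> \<rho> \<sigma> \<omega> * (F \<alpha> \<rho> \<sigma> x + s * f \<alpha> \<rho> \<sigma> x)) = 0"
    by (simp add: Fierz_eps[OF F] Fierz_eps[OF f])
qed

definition ip4 :: "(4 \<Rightarrow> 4 \<Rightarrow> 4 \<Rightarrow> 4 \<Rightarrow> real) \<Rightarrow> (4 \<Rightarrow> 4 \<Rightarrow> 4 \<Rightarrow> 4 \<Rightarrow> real) \<Rightarrow> real" where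
  "ip4 a b = (\<Sum>\<alpha>\<in>UNIV. \<Sum>\<beta>\<in>UNIV. \<Sum>\<rho>\<in>UNIV. \<Sum>\<sigma>\<in>UNIV. e \<alpha> * e \<beta> * e \<rho> * e \<sigma> * (a \<alpha> \<beta> \<rho> \<sigma> * b \<alpha> \<beta> \<rho> \<sigma>))"

lemma ip4_quadratic:
  fixes s :: real
  defines "p \<equiv> \<lambda>c d n \<alpha> \<beta> \<rho> \<sigma>. c \<alpha> \<beta> \<rho> \<sigma> + s * d \<alpha> \<beta> \<rho> \<sigma> + s\<^sup>2 * n \<alpha> \<beta> \<rho> \<sigma>"
  shows "ip4 (p c d n) (p c d n) =
    ip4 c c + (2 * s) * ip4 c d + s\<^sup>2 * ip4 d d + (2 * s\<^sup>2) * ip4 c n + (2 * s ^ 3) * ip4 d n + s ^ 4 * ip4 n n"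
  unfolding ip4_def p_def sum_distrib_left sum.distrib[symmetric]
  by (intro sum.cong refl) (simp add: algebra_simps power2_eq_square power3_eq_cube power4_eq_xxxx)

text \<open>No metric factors occur: the first argument is meant with upper and the second with
  lower indices. As a form on arrays of numbers it is therefore positive definite.\<close>

definition ip3 :: "(4 \<Rightarrow> 4 \<Rightarrow> 4 \<Rightarrow> real) \<Rightarrow> (4 \<Rightarrow> 4 \<Rightarrow> 4 \<Rightarrow> real) \<Rightarrow> real" where
  "ip3 a b = (\<Sum>\<alpha>\<in>UNIV. \<Sum>\<rho>\<in>UNIV. \<Sum>\<sigma>\<in>UNIV. a \<alpha> \<rho> \<sigma> * b \<alpha> \<rho> \<sigma>)"

lemma Lagrangian_eq:
  assumes F: "smooth_field F" "Fierz F"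
  shows "Lagrangian m \<tau> \<psi> F x = L_K m (\<lambda>_ _. 0) \<psi> x +
    of_real (ip3 (\<lambda>\<alpha> \<rho> \<sigma>. F \<alpha> \<rho> \<sigma> x) (\<lambda>\<alpha> \<rho> \<sigma>. current \<psi> \<alpha> \<rho> \<sigma> x)
      + 32 * \<tau> * ip4 (\<lambda>\<alpha> \<beta> \<rho> \<sigma>. curv F \<alpha> \<beta> \<rho> \<sigma> x) (\<lambda>\<alpha> \<beta> \<rho> \<sigma>. curv F \<alpha> \<beta> \<rho> \<sigma> x))"
proof -
  have "ip4 (\<lambda>\<alpha> \<beta> \<rho> \<sigma>. curv F \<alpha> \<beta> \<rho> \<sigma> x) (\<lambda>\<alpha> \<beta> \<rho> \<sigma>. curv F \<alpha> \<beta> \<rho> \<sigma> x) =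
     (\<Sum>\<alpha>\<in>UNIV. \<Sum>\<beta>\<in>UNIV. \<Sum>\<rho>\<in>UNIV. \<Sum>\<sigma>\<in>UNIV. curv F \<alpha> \<beta> \<rho> \<sigma> x * curv_up F \<alpha> \<beta> \<rho> \<sigma> x)"
    unfolding ip4_def curv_up_eq by (intro sum.cong refl) (simp only: mult_ac)
  then show ?thesis
    unfolding Lagrangian_def L_V_X_field[OF F] L_K_split[of m F] ip3_def by simp
qed

text \<open>The coefficient of \<open>s\<close> in the Lagrangian along the perturbation; 64 is
  twice the 32 in front of the squared curvature.\<close>

definition first_var :: "real \<Rightarrow> (spacetime \<Rightarrow> form) \<Rightarrow> field3 \<Rightarrow> field3 \<Rightarrow> spacetime \<Rightarrow> real" where
  "first_var \<tau> \<psi> F f x = ip3 (\<lambda>\<alpha> \<rho> \<sigma>. f \<alpha> \<rho> \<sigma> x) (\<lambda>\<alpha> \<rho> \<sigma>. current \<psi> \<alpha> \<rho> \<sigma> x)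
      + 64 * \<tau> * ip4 (\<lambda>\<alpha> \<beta> \<rho> \<sigma>. curv F \<alpha> \<beta> \<rho> \<sigma> x) (\<lambda>\<alpha> \<beta> \<rho> \<sigma>. curv_lin F f \<alpha> \<beta> \<rho> \<sigma> x)"

lemma Lagrangian_perturb:
  assumes F: "smooth_field F" "Fierz F" and f: "smooth_field f" "Fierz f"
  defines "C \<equiv> \<lambda>x \<alpha> \<beta> \<rho> \<sigma>. curv F \<alpha> \<beta> \<rho> \<sigma> x" and "D \<equiv> \<lambda>x \<alpha> \<beta> \<rho> \<sigma>. curv_lin F f \<alpha> \<beta> \<rho> \<sigma> x"
    and "N \<equiv> \<lambda>x \<alpha> \<beta> \<rho> \<sigma>. curv_quad f \<alpha> \<beta> \<rho> \<sigma> x"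
  shows "Lagrangian m \<tau> \<psi> (perturb F s f) x = Lagrangian m \<tau> \<psi> F x + s *\<^sub>R of_real (first_var \<tau> \<psi> F f x)
     + s\<^sup>2 *\<^sub>R of_real (32 * \<tau> * (ip4 (D x) (D x) + 2 * ip4 (C x) (N x)))
     + s ^ 3 *\<^sub>R of_real (64 * \<tau> * ip4 (D x) (N x)) + s ^ 4 *\<^sub>R of_real (32 * \<tau> * ip4 (N x) (N x))"
proof -
  have 1: "ip3 (\<lambda>\<alpha> \<rho> \<sigma>. perturb F s f \<alpha> \<rho> \<sigma> x) j = ip3 (\<lambda>\<alpha> \<rho> \<sigma>. F \<alpha> \<rho> \<sigma> x) j + s * ip3 (\<lambda>\<alpha> \<rho> \<sigma>. f \<alpha> \<rho> \<sigma> x) j" for j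
    by (simp add: ip3_def distrib_right sum.distrib sum_distrib_left mult.assoc)
  have 2: "ip4 (\<lambda>\<alpha> \<beta> \<rho> \<sigma>. curv (perturb F s f) \<alpha> \<beta> \<rho> \<sigma> x) (\<lambda>\<alpha> \<beta> \<rho> \<sigma>. curv (perturb F s f) \<alpha> \<beta> \<rho> \<sigma> x) =
     ip4 (C x) (C x) + (2 * s) * ip4 (C x) (D x) + s\<^sup>2 * ip4 (D x) (D x) + (2 * s\<^sup>2) * ip4 (C x) (N x)
      + (2 * s ^ 3) * ip4 (D x) (N x) + s ^ 4 * ip4 (N x) (N x)"
    unfolding curv_perturb[OF F(1) f(1)] C_def D_def N_def by (rule ip4_quadratic)
  show ?thesis
    unfolding Lagrangian_eq[OF F] Lagrangian_eq[OF smooth_perturb[OF F(1) f(1)] Fierz_perturb[OF F(2) f(2)]] 1 2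
      first_var_def C_def[symmetric] D_def[symmetric] complex_scaleR
    by (simp add: C_def D_def algebra_simps)
qed

lemma sum_swap_13:
  fixes h :: "4 \<Rightarrow> 4 \<Rightarrow> 4 \<Rightarrow> real"
  shows "(\<Sum>\<rho>\<in>UNIV. \<Sum>\<sigma>\<in>UNIV. \<Sum>\<nu>\<in>UNIV. h \<rho> \<sigma> \<nu>) = (\<Sum>\<rho>\<in>UNIV. \<Sum>\<sigma>\<in>UNIV. \<Sum>\<nu>\<in>UNIV. h \<nu> \<sigma> \<rho>)"
proof -
  have "(\<Sum>\<rho>\<in>UNIV. \<Sum>\<sigma>\<in>UNIV. \<Sum>\<nu>\<in>UNIV. h \<rho> \<sigma> \<nu>) = (\<Sum>\<sigma>\<in>UNIV. \<Sum>\<rho>\<in>UNIV. \<Sum>\<nu>\<in>UNIV. h \<rho> \<sigma> \<nu>)"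
    by (rule sum.swap)
  also have "\<dots> = (\<Sum>\<sigma>\<in>UNIV. \<Sum>\<nu>\<in>UNIV. \<Sum>\<rho>\<in>UNIV. h \<rho> \<sigma> \<nu>)"
    by (rule sum.cong[OF refl], rule sum.swap)
  also have "\<dots> = (\<Sum>\<nu>\<in>UNIV. \<Sum>\<sigma>\<in>UNIV. \<Sum>\<rho>\<in>UNIV. h \<rho> \<sigma> \<nu>)"
    by (rule sum.swap)
  finally show ?thesis .
qed

lemma curv_swap: "curv F \<alpha> \<beta> \<rho> \<sigma> x = - curv F \<beta> \<alpha> \<rho> \<sigma> x"
  unfolding curv_eq by (simp add: sum_negf[symmetric] algebra_simps sum_subtractf)

text \<open>The curvature with raised indices contracted with the variation. The factor
  \<open>e \<alpha>\<close> is included, so that its divergence is the plain sum of partial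
  derivatives.\<close>

definition boundary_flux :: "field3 \<Rightarrow> field3 \<Rightarrow> 4 \<Rightarrow> spacetime \<Rightarrow> real" where
  "boundary_flux F f \<alpha> x =
     (\<Sum>\<beta>\<in>UNIV. \<Sum>\<rho>\<in>UNIV. \<Sum>\<sigma>\<in>UNIV. e \<alpha> * e \<beta> * e \<rho> * e \<sigma> * (curv F \<alpha> \<beta> \<rho> \<sigma> x * F_ddd f \<beta> \<rho> \<sigma> x))"

lemma smooth_boundary_flux: "smooth_field F \<Longrightarrow> smooth_field f \<Longrightarrow> smooth (boundary_flux F f \<alpha>)"
  unfolding boundary_flux_def[abs_def] by (intro smooth_rules smooth_F_ddd smooth_curv)

text \<open>Antisymmetry of the curvature in its first two indices makes both halves of
  \<open>curv_lin\<close> contribute alike, which turns 64 into 128. The product rule then moves the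
  derivative from \<open>f\<close> to the curvature, leaving a divergence.\<close>

lemma first_var_eq:
  assumes F: "smooth_field F" "Fierz F" and f: "smooth_field f"
  shows "first_var \<tau> \<psi> F f x =
     ip3 (\<lambda>\<alpha> \<rho> \<sigma>. f \<alpha> \<rho> \<sigma> x) (\<lambda>\<alpha> \<rho> \<sigma>. current \<psi> \<alpha> \<rho> \<sigma> x - 128 * \<tau> * xi F \<alpha> \<rho> \<sigma> x)
     + 128 * \<tau> * (\<Sum>\<alpha>\<in>UNIV. pd \<alpha> (boundary_flux F f \<alpha>) x)"
proof -
  let ?C = "\<lambda>\<alpha> \<beta> \<rho> \<sigma>. curv F \<alpha> \<beta> \<rho> \<sigma> x" and ?B = "\<lambda>\<alpha> \<beta> \<rho> \<sigma>. cov_deriv F f \<alpha> \<beta> \<rho> \<sigma> x"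
  let ?G = "\<lambda>\<alpha> \<rho> \<sigma>. F_ddd F \<alpha> \<rho> \<sigma> x" and ?g = "\<lambda>\<alpha> \<rho> \<sigma>. F_ddd f \<alpha> \<rho> \<sigma> x"
  note Ca = curv_antisym[OF F] and Ga = F_ddd_antisym[OF F(2)]
  have swap: "ip4 ?C (\<lambda>\<alpha> \<beta>. ?B \<beta> \<alpha>) = - ip4 ?C ?B"
  proof -
    have "ip4 ?C (\<lambda>\<alpha> \<beta>. ?B \<beta> \<alpha>) = (\<Sum>\<alpha>\<in>UNIV. \<Sum>\<beta>\<in>UNIV. \<Sum>\<rho>\<in>UNIV. \<Sum>\<sigma>\<in>UNIV. e \<beta> * e \<alpha> * e \<rho> * e \<sigma> * (?C \<beta> \<alpha> \<rho> \<sigma> * ?B \<alpha> \<beta> \<rho> \<sigma>))"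
      unfolding ip4_def by (rule sum.swap)
    also have "\<dots> = - ip4 ?C ?B"
      unfolding ip4_def sum_negf[symmetric]
    proof (intro sum.cong refl)
      fix \<alpha> \<beta> \<rho> \<sigma>
      show "e \<beta> * e \<alpha> * e \<rho> * e \<sigma> * (?C \<beta> \<alpha> \<rho> \<sigma> * ?B \<alpha> \<beta> \<rho> \<sigma>) = - (e \<alpha> * e \<beta> * e \<rho> * e \<sigma> * (?C \<alpha> \<beta> \<rho> \<sigma> * ?B \<alpha> \<beta> \<rho> \<sigma>))"
        using curv_swap[of F \<alpha> \<beta> \<rho> \<sigma> x] by algebra
    qed
    finally show ?thesis .
  qed
  have "ip4 ?C (\<lambda>\<alpha> \<beta> \<rho> \<sigma>. curv_lin F f \<alpha> \<beta> \<rho> \<sigma> x) = ip4 ?C ?B - ip4 ?C (\<lambda>\<alpha> \<beta>. ?B \<beta> \<alpha>)"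
    unfolding ip4_def curv_lin_def by (simp only: right_diff_distrib sum_subtractf)
  then have lin: "ip4 ?C (\<lambda>\<alpha> \<beta> \<rho> \<sigma>. curv_lin F f \<alpha> \<beta> \<rho> \<sigma> x) = 2 * ip4 ?C ?B"
    by (simp add: swap)
  \<comment> \<open>In \<open>P\<close> the derivative falls on the variation, in \<open>P'\<close>
    on the curvature, and \<open>Z\<close> collects the connection terms. The result is the
    splitting of P + 4 Z into the divergence P + P' minus P' - 4 Z, the pairing with
    \<open>xi\<close>.\<close>
  define P where "P = (\<Sum>\<alpha>\<in>UNIV. \<Sum>\<beta>\<in>UNIV. \<Sum>\<rho>\<in>UNIV. \<Sum>\<sigma>\<in>UNIV. e \<alpha> * e \<beta> * e \<rho> * e \<sigma> * (?C \<alpha> \<beta> \<rho> \<sigma> * pd \<alpha> (F_ddd f \<beta> \<rho> \<sigma>) x))"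
  define P' where "P' = (\<Sum>\<alpha>\<in>UNIV. \<Sum>\<beta>\<in>UNIV. \<Sum>\<rho>\<in>UNIV. \<Sum>\<sigma>\<in>UNIV. e \<alpha> * e \<beta> * e \<rho> * e \<sigma> * (pd \<alpha> (curv F \<alpha> \<beta> \<rho> \<sigma>) x * ?g \<beta> \<rho> \<sigma>))"
  define Z where "Z = (\<Sum>\<alpha>\<in>UNIV. \<Sum>\<beta>\<in>UNIV. \<Sum>\<rho>\<in>UNIV. \<Sum>\<sigma>\<in>UNIV. \<Sum>\<nu>\<in>UNIV.
      e \<alpha> * e \<beta> * e \<rho> * e \<sigma> * e \<nu> * (?g \<beta> \<rho> \<sigma> * (?C \<alpha> \<beta> \<sigma> \<nu> * ?G \<alpha> \<rho> \<nu> - ?C \<alpha> \<beta> \<rho> \<nu> * ?G \<alpha> \<sigma> \<nu>)))"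
  have flux: "(\<Sum>\<alpha>\<in>UNIV. pd \<alpha> (boundary_flux F f \<alpha>) x) = P + P'"
    unfolding P_def P'_def boundary_flux_def[abs_def]
    by (simp add: pd_smooth_rules smooth_rules smooth_F_ddd[OF f] smooth_curv[OF F(1)] distrib_left sum.distrib)
  have Q: "ip4 ?C ?B = P + 4 * Z"
  proof -
    have "ip4 ?C ?B = P + 4 * (\<Sum>\<alpha>\<in>UNIV. \<Sum>\<beta>\<in>UNIV.
       (\<Sum>\<rho>\<in>UNIV. \<Sum>\<sigma>\<in>UNIV. \<Sum>\<nu>\<in>UNIV. e \<alpha> * e \<beta> * e \<rho> * e \<sigma> * e \<nu> * (?C \<alpha> \<beta> \<rho> \<sigma> * (?G \<alpha> \<rho> \<nu> * ?g \<beta> \<nu> \<sigma>)))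
      - (\<Sum>\<rho>\<in>UNIV. \<Sum>\<sigma>\<in>UNIV. \<Sum>\<nu>\<in>UNIV. e \<alpha> * e \<beta> * e \<rho> * e \<sigma> * e \<nu> * (?C \<alpha> \<beta> \<rho> \<sigma> * (?g \<beta> \<rho> \<nu> * ?G \<alpha> \<nu> \<sigma>))))"
      unfolding ip4_def cov_deriv_def P_def sum_distrib_left sum.distrib[symmetric] sum_subtractf[symmetric]
      by (intro sum.cong refl, simp only: distrib_left sum_distrib_left, intro arg_cong2[where f="(+)"] sum.cong refl)
         (simp add: algebra_simps)
    also have "(\<Sum>\<alpha>\<in>UNIV. \<Sum>\<beta>\<in>UNIV.
       (\<Sum>\<rho>\<in>UNIV. \<Sum>\<sigma>\<in>UNIV. \<Sum>\<nu>\<in>UNIV. e \<alpha> * e \<beta> * e \<rho> * e \<sigma> * e \<nu> * (?C \<alpha> \<beta> \<rho> \<sigma> * (?G \<alpha> \<rho> \<nu> * ?g \<beta> \<nu> \<sigma>)))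
      - (\<Sum>\<rho>\<in>UNIV. \<Sum>\<sigma>\<in>UNIV. \<Sum>\<nu>\<in>UNIV. e \<alpha> * e \<beta> * e \<rho> * e \<sigma> * e \<nu> * (?C \<alpha> \<beta> \<rho> \<sigma> * (?g \<beta> \<rho> \<nu> * ?G \<alpha> \<nu> \<sigma>)))) = Z"
      unfolding Z_def
    proof (rule sum.cong[OF refl], rule sum.cong[OF refl])
      fix \<alpha> \<beta>
      have 1: "(\<Sum>\<rho>\<in>UNIV. \<Sum>\<sigma>\<in>UNIV. \<Sum>\<nu>\<in>UNIV. e \<alpha> * e \<beta> * e \<rho> * e \<sigma> * e \<nu> * (?C \<alpha> \<beta> \<rho> \<sigma> * (?G \<alpha> \<rho> \<nu> * ?g \<beta> \<nu> \<sigma>))) =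
         (\<Sum>\<rho>\<in>UNIV. \<Sum>\<sigma>\<in>UNIV. \<Sum>\<nu>\<in>UNIV. e \<alpha> * e \<beta> * e \<nu> * e \<sigma> * e \<rho> * (?C \<alpha> \<beta> \<nu> \<sigma> * (?G \<alpha> \<nu> \<rho> * ?g \<beta> \<rho> \<sigma>)))"
        by (rule sum_swap_13)
      have 2: "(\<Sum>\<rho>\<in>UNIV. \<Sum>\<sigma>\<in>UNIV. \<Sum>\<nu>\<in>UNIV. e \<alpha> * e \<beta> * e \<rho> * e \<sigma> * e \<nu> * (?C \<alpha> \<beta> \<rho> \<sigma> * (?g \<beta> \<rho> \<nu> * ?G \<alpha> \<nu> \<sigma>))) =
         (\<Sum>\<rho>\<in>UNIV. \<Sum>\<sigma>\<in>UNIV. \<Sum>\<nu>\<in>UNIV. e \<alpha> * e \<beta> * e \<rho> * e \<nu> * e \<sigma> * (?C \<alpha> \<beta> \<rho> \<nu> * (?g \<beta> \<rho> \<sigma> * ?G \<alpha> \<sigma> \<nu>)))"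
        by (rule sum.cong[OF refl], rule sum.swap)
      show "(\<Sum>\<rho>\<in>UNIV. \<Sum>\<sigma>\<in>UNIV. \<Sum>\<nu>\<in>UNIV. e \<alpha> * e \<beta> * e \<rho> * e \<sigma> * e \<nu> * (?C \<alpha> \<beta> \<rho> \<sigma> * (?G \<alpha> \<rho> \<nu> * ?g \<beta> \<nu> \<sigma>)))
      - (\<Sum>\<rho>\<in>UNIV. \<Sum>\<sigma>\<in>UNIV. \<Sum>\<nu>\<in>UNIV. e \<alpha> * e \<beta> * e \<rho> * e \<sigma> * e \<nu> * (?C \<alpha> \<beta> \<rho> \<sigma> * (?g \<beta> \<rho> \<nu> * ?G \<alpha> \<nu> \<sigma>))) =
       (\<Sum>\<rho>\<in>UNIV. \<Sum>\<sigma>\<in>UNIV. \<Sum>\<nu>\<in>UNIV.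
      e \<alpha> * e \<beta> * e \<rho> * e \<sigma> * e \<nu> * (?g \<beta> \<rho> \<sigma> * (?C \<alpha> \<beta> \<sigma> \<nu> * ?G \<alpha> \<rho> \<nu> - ?C \<alpha> \<beta> \<rho> \<nu> * ?G \<alpha> \<sigma> \<nu>)))"
        unfolding 1 2 sum_subtractf[symmetric]
      proof (intro sum.cong refl)
        fix \<rho> \<sigma> \<nu>
        show "e \<alpha> * e \<beta> * e \<nu> * e \<sigma> * e \<rho> * (?C \<alpha> \<beta> \<nu> \<sigma> * (?G \<alpha> \<nu> \<rho> * ?g \<beta> \<rho> \<sigma>)) -
           e \<alpha> * e \<beta> * e \<rho> * e \<nu> * e \<sigma> * (?C \<alpha> \<beta> \<rho> \<nu> * (?g \<beta> \<rho> \<sigma> * ?G \<alpha> \<sigma> \<nu>)) =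
           e \<alpha> * e \<beta> * e \<rho> * e \<sigma> * e \<nu> * (?g \<beta> \<rho> \<sigma> * (?C \<alpha> \<beta> \<sigma> \<nu> * ?G \<alpha> \<rho> \<nu> - ?C \<alpha> \<beta> \<rho> \<nu> * ?G \<alpha> \<sigma> \<nu>))"
          using Ca[of \<alpha> \<beta> \<nu> \<sigma> x] Ga[of \<alpha> \<nu> \<rho> x] by algebra
      qed
    qed
    finally show ?thesis .
  qed
  have X: "ip3 (\<lambda>\<alpha> \<rho> \<sigma>. f \<alpha> \<rho> \<sigma> x) (\<lambda>\<alpha> \<rho> \<sigma>. xi F \<alpha> \<rho> \<sigma> x) = P' - 4 * Z"
  proof -
    have f3: "f \<beta> \<rho> \<sigma> x = e \<beta> * e \<rho> * e \<sigma> * ?g \<beta> \<rho> \<sigma>" for \<beta> \<rho> \<sigma> by (rule lower_raise)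
    have "P' - 4 * Z = (\<Sum>\<alpha>\<in>UNIV. \<Sum>\<beta>\<in>UNIV. \<Sum>\<rho>\<in>UNIV. \<Sum>\<sigma>\<in>UNIV. e \<beta> * e \<rho> * e \<sigma> * ?g \<beta> \<rho> \<sigma> * (e \<alpha> * pd \<alpha> (curv F \<alpha> \<beta> \<rho> \<sigma>) x
        - 4 * (\<Sum>\<nu>\<in>UNIV. e \<alpha> * e \<nu> * (?C \<alpha> \<beta> \<sigma> \<nu> * ?G \<alpha> \<rho> \<nu> - ?C \<alpha> \<beta> \<rho> \<nu> * ?G \<alpha> \<sigma> \<nu>))))"
      unfolding P'_def Z_def sum_distrib_left sum_subtractf[symmetric] right_diff_distrib
      by (intro sum.cong refl arg_cong2[where f="(-)"]) (simp_all add: mult_ac)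
    also have "\<dots> = (\<Sum>\<beta>\<in>UNIV. \<Sum>\<alpha>\<in>UNIV. \<Sum>\<rho>\<in>UNIV. \<Sum>\<sigma>\<in>UNIV. e \<beta> * e \<rho> * e \<sigma> * ?g \<beta> \<rho> \<sigma> * (e \<alpha> * pd \<alpha> (curv F \<alpha> \<beta> \<rho> \<sigma>) x
        - 4 * (\<Sum>\<nu>\<in>UNIV. e \<alpha> * e \<nu> * (?C \<alpha> \<beta> \<sigma> \<nu> * ?G \<alpha> \<rho> \<nu> - ?C \<alpha> \<beta> \<rho> \<nu> * ?G \<alpha> \<sigma> \<nu>))))"
      by (rule sum.swap)
    also have "\<dots> = (\<Sum>\<beta>\<in>UNIV. \<Sum>\<rho>\<in>UNIV. \<Sum>\<alpha>\<in>UNIV. \<Sum>\<sigma>\<in>UNIV. e \<beta> * e \<rho> * e \<sigma> * ?g \<beta> \<rho> \<sigma> * (e \<alpha> * pd \<alpha> (curv F \<alpha> \<beta> \<rho> \<sigma>) x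
        - 4 * (\<Sum>\<nu>\<in>UNIV. e \<alpha> * e \<nu> * (?C \<alpha> \<beta> \<sigma> \<nu> * ?G \<alpha> \<rho> \<nu> - ?C \<alpha> \<beta> \<rho> \<nu> * ?G \<alpha> \<sigma> \<nu>))))"
      by (rule sum.cong[OF refl], rule sum.swap)
    also have "\<dots> = (\<Sum>\<beta>\<in>UNIV. \<Sum>\<rho>\<in>UNIV. \<Sum>\<sigma>\<in>UNIV. \<Sum>\<alpha>\<in>UNIV. e \<beta> * e \<rho> * e \<sigma> * ?g \<beta> \<rho> \<sigma> * (e \<alpha> * pd \<alpha> (curv F \<alpha> \<beta> \<rho> \<sigma>) x
        - 4 * (\<Sum>\<nu>\<in>UNIV. e \<alpha> * e \<nu> * (?C \<alpha> \<beta> \<sigma> \<nu> * ?G \<alpha> \<rho> \<nu> - ?C \<alpha> \<beta> \<rho> \<nu> * ?G \<alpha> \<sigma> \<nu>))))"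
      by (rule sum.cong[OF refl], rule sum.cong[OF refl], rule sum.swap)
    also have "\<dots> = ip3 (\<lambda>\<alpha> \<rho> \<sigma>. f \<alpha> \<rho> \<sigma> x) (\<lambda>\<alpha> \<rho> \<sigma>. xi F \<alpha> \<rho> \<sigma> x)"
      unfolding ip3_def f3 div_curv_eq_xi[OF F, symmetric] div_curv_def
      by (simp only: sum_subtractf sum_distrib_left[symmetric])
    finally show ?thesis by simp
  qed
  have split: "ip3 a (\<lambda>\<alpha> \<rho> \<sigma>. j \<alpha> \<rho> \<sigma> - c * y \<alpha> \<rho> \<sigma>) = ip3 a j - c * ip3 a y" for a j y c
    by (simp add: ip3_def right_diff_distrib sum_subtractf sum_distrib_left mult_ac)
  show ?thesis
    unfolding first_var_def lin Q flux split X by (simp add: algebra_simps)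
qed

section \<open>The Fierz projection\<close>

lemma UNIV_index4: "(UNIV :: 4 set) = {0, 1, 2, 3}"
  using all_index4[of "\<lambda>x. x \<in> {0, 1, 2, 3}"] by auto

lemma sum_index4: "(\<Sum>x\<in>(UNIV :: 4 set). f x) = f 0 + (f 1 + (f 2 + f 3))"
  unfolding UNIV_index4 using distinct_index4 by simp

text \<open>The nonzero terms come from the 3! orderings of the three indices other than the free
  one; no three distinct indices avoid two different values.\<close>

lemma eps_contract:
  "(\<Sum>\<alpha>\<in>UNIV. \<Sum>\<rho>\<in>UNIV. \<Sum>\<sigma>\<in>UNIV. eps \<alpha> \<rho> \<sigma> \<omega> * eps \<alpha> \<rho> \<sigma> \<omega>') = (if \<omega> = \<omega>' then 6 else 0)"
proof -
  have "\<forall>\<omega> \<omega>'. (\<Sum>\<alpha>\<in>UNIV. \<Sum>\<rho>\<in>UNIV. \<Sum>\<sigma>\<in>UNIV. eps \<alpha> \<rho> \<sigma> \<omega> * eps \<alpha> \<rho> \<sigma> \<omega>') = (if \<omega> = \<omega>' then 6 else 0)"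
    by (simp add: all_index4 sum_index4 eps_def order_sign_simps)
  then show ?thesis by blast
qed

definition trace_part :: "(4 \<Rightarrow> 4 \<Rightarrow> 4 \<Rightarrow> real) \<Rightarrow> 4 \<Rightarrow> real" where
  "trace_part T \<sigma> = (\<Sum>\<beta>\<in>UNIV. e \<beta> * T \<beta> \<beta> \<sigma>)"

definition axial_part :: "(4 \<Rightarrow> 4 \<Rightarrow> 4 \<Rightarrow> real) \<Rightarrow> 4 \<Rightarrow> real" where
  "axial_part T \<omega> = (\<Sum>\<alpha>\<in>UNIV. \<Sum>\<rho>\<in>UNIV. \<Sum>\<sigma>\<in>UNIV. eps \<alpha> \<rho> \<sigma> \<omega> * T \<alpha> \<rho> \<sigma>)"

text \<open>The real counterpart of \<open>fierz_part\<close>. The sign of the last term differs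
  because both symbols are taken with lower indices here, and \<open>eps_up\<close> is the negative
  of \<open>eps\<close>.\<close>

definition fierz_proj :: "(4 \<Rightarrow> 4 \<Rightarrow> 4 \<Rightarrow> real) \<Rightarrow> 4 \<Rightarrow> 4 \<Rightarrow> 4 \<Rightarrow> real" where
  "fierz_proj T \<alpha> \<rho> \<sigma> = T \<alpha> \<rho> \<sigma> - 1/3 * (eta \<alpha> \<rho> * trace_part T \<sigma>) + 1/3 * (eta \<alpha> \<sigma> * trace_part T \<rho>)
     - 1/6 * (\<Sum>\<omega>\<in>UNIV. eps \<alpha> \<rho> \<sigma> \<omega> * axial_part T \<omega>)"

lemma fierz_part_of_real:
  "fierz_part (\<lambda>\<alpha> \<rho> \<sigma>. of_real (T \<alpha> \<rho> \<sigma>)) \<alpha> \<rho> \<sigma> = of_real (fierz_proj T \<alpha> \<rho> \<sigma>)"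
proof -
  have t: "(\<Sum>\<beta>\<in>UNIV. shift \<beta> (\<lambda>\<mu>. complex_of_real (T \<mu> \<beta> \<sigma>))) = of_real (trace_part T \<sigma>)" for \<sigma>
    by (simp add: shift_eq trace_part_def complex_scaleR)
  have v: "(\<Sum>\<omega>\<in>UNIV. \<Sum>\<kappa>\<in>UNIV. \<Sum>\<mu>\<in>UNIV. \<Sum>\<nu>\<in>UNIV.
      of_real (eps \<alpha> \<rho> \<sigma> \<omega> * eps_up \<kappa> \<mu> \<nu> \<omega>) * complex_of_real (T \<kappa> \<mu> \<nu>)) =
      of_real (- (\<Sum>\<omega>\<in>UNIV. eps \<alpha> \<rho> \<sigma> \<omega> * axial_part T \<omega>))"
    unfolding axial_part_def eps_up_eq of_real_mult[symmetric] of_real_sum[symmetric]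
    by (simp add: sum_distrib_left sum_negf mult.assoc)
  show ?thesis unfolding fierz_part_def t v fierz_proj_def by simp
qed

lemma fierz_proj_diff: "fierz_proj (\<lambda>\<alpha> \<rho> \<sigma>. S \<alpha> \<rho> \<sigma> - c * T \<alpha> \<rho> \<sigma>) \<alpha> \<rho> \<sigma> = fierz_proj S \<alpha> \<rho> \<sigma> - c * fierz_proj T \<alpha> \<rho> \<sigma>"
proof -
  have t: "trace_part (\<lambda>\<alpha> \<rho> \<sigma>. S \<alpha> \<rho> \<sigma> - c * T \<alpha> \<rho> \<sigma>) \<sigma> = trace_part S \<sigma> - c * trace_part T \<sigma>" for \<sigma>
    by (simp add: trace_part_def algebra_simps sum_subtractf sum_distrib_left)
  have v: "axial_part (\<lambda>\<alpha> \<rho> \<sigma>. S \<alpha> \<rho> \<sigma> - c * T \<alpha> \<rho> \<sigma>) \<omega> = axial_part S \<omega> - c * axial_part T \<omega>" for \<omega>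
    by (simp add: axial_part_def algebra_simps sum_subtractf sum_distrib_left)
  have "(\<Sum>\<omega>\<in>UNIV. eps \<alpha> \<rho> \<sigma> \<omega> * (axial_part S \<omega> - c * axial_part T \<omega>)) =
    (\<Sum>\<omega>\<in>UNIV. eps \<alpha> \<rho> \<sigma> \<omega> * axial_part S \<omega>) - c * (\<Sum>\<omega>\<in>UNIV. eps \<alpha> \<rho> \<sigma> \<omega> * axial_part T \<omega>)"
    by (simp add: algebra_simps sum_subtractf sum_distrib_left)
  then show ?thesis unfolding fierz_proj_def t v by (simp add: algebra_simps)
qed

lemma eps_diag: "eps \<alpha> \<alpha> \<sigma> \<omega> = 0" by (simp add: eps_def order_sign_def)

lemma fierz_proj_antisym:
  assumes "\<And>\<alpha> \<rho> \<sigma>. T \<alpha> \<rho> \<sigma> = - T \<alpha> \<sigma> \<rho>"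
  shows "fierz_proj T \<alpha> \<rho> \<sigma> = - fierz_proj T \<alpha> \<sigma> \<rho>"
  unfolding fierz_proj_def
  by (subst eps_swap(2), subst assms) (simp add: sum_negf)

lemma sum_eta2: "(\<Sum>\<alpha>\<in>UNIV. \<Sum>\<rho>\<in>UNIV. eta \<alpha> \<rho> * h \<alpha> \<rho>) = (\<Sum>\<alpha>\<in>UNIV. e \<alpha> * h \<alpha> \<alpha>)"
  by (simp only: sum_eta)

text \<open>The two metric terms have traces 4 and 1 times the trace of \<open>T\<close>, so their
  coefficients -1/3 and 1/3 add up to -1; the axial term drops out as \<open>eps\<close> has a
  repeated index.\<close>

lemma trace_part_fierz_proj: "trace_part (fierz_proj T) \<sigma> = 0"
proof -
  have 1: "(\<Sum>\<beta>\<in>UNIV. e \<beta> * (eta \<beta> \<beta> * trace_part T \<sigma>)) = 4 * trace_part T \<sigma>"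
    by (simp add: eta_diag_sq)
  have 2: "(\<Sum>\<beta>\<in>UNIV. e \<beta> * (eta \<beta> \<sigma> * trace_part T \<beta>)) = trace_part T \<sigma>"
  proof -
    have "(\<Sum>\<beta>\<in>UNIV. e \<beta> * (eta \<beta> \<sigma> * trace_part T \<beta>)) = (\<Sum>\<beta>\<in>UNIV. eta \<sigma> \<beta> * (e \<beta> * trace_part T \<beta>))"
      by (intro sum.cong refl) (simp add: eta_def)
    then show ?thesis by (simp add: sum_eta eta_diag_sq)
  qed
  have "trace_part (fierz_proj T) \<sigma> = trace_part T \<sigma> - 1/3 * (\<Sum>\<beta>\<in>UNIV. e \<beta> * (eta \<beta> \<beta> * trace_part T \<sigma>))
    + 1/3 * (\<Sum>\<beta>\<in>UNIV. e \<beta> * (eta \<beta> \<sigma> * trace_part T \<beta>))"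
    unfolding trace_part_def[of "fierz_proj T"] fierz_proj_def eps_diag
    by (simp add: trace_part_def[of T] distrib_left right_diff_distrib sum.distrib sum_subtractf mult.left_commute[of _ "1/3"] sum_distrib_left del: sum_divide_distrib times_divide_eq_left times_divide_eq_right)
  then show ?thesis unfolding 1 2 by simp
qed

text \<open>The metric is symmetric and dies against \<open>eps\<close>, while contracting two
  symbols over three indices yields 6 and cancels the coefficient 1/6.\<close>

lemma axial_part_fierz_proj: "axial_part (fierz_proj T) \<omega> = 0"
proof -
  let ?S = "\<lambda>h. (\<Sum>\<alpha>\<in>UNIV. \<Sum>\<rho>\<in>UNIV. \<Sum>\<sigma>\<in>UNIV. h \<alpha> \<rho> \<sigma> :: real)"
  have z: "eps \<alpha> \<rho> \<sigma> \<omega> * (eta \<alpha> \<rho> * c) = 0" "eps \<alpha> \<rho> \<sigma> \<omega> * (eta \<alpha> \<sigma> * c) = 0" for \<alpha> \<rho> \<sigma> c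
    by (auto simp: eps_def order_sign_def eta_def)
  have "?S (\<lambda>\<alpha> \<rho> \<sigma>. eps \<alpha> \<rho> \<sigma> \<omega> * (\<Sum>\<omega>'\<in>UNIV. eps \<alpha> \<rho> \<sigma> \<omega>' * axial_part T \<omega>')) =
    ?S (\<lambda>\<alpha> \<rho> \<sigma>. \<Sum>\<omega>'\<in>UNIV. eps \<alpha> \<rho> \<sigma> \<omega> * eps \<alpha> \<rho> \<sigma> \<omega>' * axial_part T \<omega>')"
    by (simp only: sum_distrib_left mult.assoc)
  also have "\<dots> = (\<Sum>\<alpha>\<in>UNIV. \<Sum>\<rho>\<in>UNIV. \<Sum>\<omega>'\<in>UNIV. \<Sum>\<sigma>\<in>UNIV. eps \<alpha> \<rho> \<sigma> \<omega> * eps \<alpha> \<rho> \<sigma> \<omega>' * axial_part T \<omega>')"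
    by (rule sum.cong[OF refl], rule sum.cong[OF refl], rule sum.swap)
  also have "\<dots> = (\<Sum>\<alpha>\<in>UNIV. \<Sum>\<omega>'\<in>UNIV. \<Sum>\<rho>\<in>UNIV. \<Sum>\<sigma>\<in>UNIV. eps \<alpha> \<rho> \<sigma> \<omega> * eps \<alpha> \<rho> \<sigma> \<omega>' * axial_part T \<omega>')"
    by (rule sum.cong[OF refl], rule sum.swap)
  also have "\<dots> = (\<Sum>\<omega>'\<in>UNIV. \<Sum>\<alpha>\<in>UNIV. \<Sum>\<rho>\<in>UNIV. \<Sum>\<sigma>\<in>UNIV. eps \<alpha> \<rho> \<sigma> \<omega> * eps \<alpha> \<rho> \<sigma> \<omega>' * axial_part T \<omega>')"
    by (rule sum.swap)
  also have "\<dots> = (\<Sum>\<omega>'\<in>UNIV. (if \<omega>' = \<omega> then 6 * axial_part T \<omega> else 0))"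
    unfolding sum_distrib_right[symmetric] eps_contract by (rule sum.cong) auto
  also have "\<dots> = 6 * axial_part T \<omega>" by simp
  finally have 1: "?S (\<lambda>\<alpha> \<rho> \<sigma>. eps \<alpha> \<rho> \<sigma> \<omega> * (\<Sum>\<omega>'\<in>UNIV. eps \<alpha> \<rho> \<sigma> \<omega>' * axial_part T \<omega>')) = 6 * axial_part T \<omega>" .
  have "axial_part (fierz_proj T) \<omega> = ?S (\<lambda>\<alpha> \<rho> \<sigma>. eps \<alpha> \<rho> \<sigma> \<omega> * T \<alpha> \<rho> \<sigma> - 1/6 * (eps \<alpha> \<rho> \<sigma> \<omega> * (\<Sum>\<omega>'\<in>UNIV. eps \<alpha> \<rho> \<sigma> \<omega>' * axial_part T \<omega>')))"
    unfolding axial_part_def[of "fierz_proj T"] fierz_proj_def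
    by (simp only: distrib_left right_diff_distrib mult.left_commute[of _ "1/3"] mult.left_commute[of _ "1/6"] z mult_zero_right diff_zero add_0_right)
  also have "\<dots> = axial_part T \<omega> - 1/6 * ?S (\<lambda>\<alpha> \<rho> \<sigma>. eps \<alpha> \<rho> \<sigma> \<omega> * (\<Sum>\<omega>'\<in>UNIV. eps \<alpha> \<rho> \<sigma> \<omega>' * axial_part T \<omega>'))"
    by (simp only: sum_subtractf sum_distrib_left[symmetric] axial_part_def[of T])
  finally show ?thesis by (simp add: 1)
qed

text \<open>The constraints are linear and pointwise, so a projected constant tensor may be
  multiplied by any function. These are the test fields for the field equation.\<close>

lemma Fierz_scaled_fierz_proj:
  assumes "\<And>\<alpha> \<rho> \<sigma>. T \<alpha> \<rho> \<sigma> = - T \<alpha> \<sigma> \<rho>"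
  shows "Fierz (\<lambda>\<alpha> \<rho> \<sigma> x. \<phi> x * fierz_proj T \<alpha> \<rho> \<sigma>)"
  unfolding Fierz_def
proof (intro allI conjI)
  fix x \<alpha> \<rho> \<sigma> \<omega>
  show "\<phi> x * fierz_proj T \<alpha> \<rho> \<sigma> = - (\<phi> x * fierz_proj T \<alpha> \<sigma> \<rho>)"
    using fierz_proj_antisym[of T \<alpha> \<rho> \<sigma>, OF assms] by simp
  have "(\<Sum>\<alpha>\<in>UNIV. \<Sum>\<rho>\<in>UNIV. eta \<alpha> \<rho> * (\<phi> x * fierz_proj T \<alpha> \<rho> \<sigma>)) = \<phi> x * trace_part (fierz_proj T) \<sigma>"
    unfolding sum_eta2 trace_part_def by (simp only: mult.left_commute[of _ "\<phi> x"] sum_distrib_left)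
  then show "(\<Sum>\<alpha>\<in>UNIV. \<Sum>\<rho>\<in>UNIV. eta \<alpha> \<rho> * (\<phi> x * fierz_proj T \<alpha> \<rho> \<sigma>)) = 0"
    by (simp add: trace_part_fierz_proj)
  have "(\<Sum>\<alpha>\<in>UNIV. \<Sum>\<rho>\<in>UNIV. \<Sum>\<sigma>\<in>UNIV. eps \<alpha> \<rho> \<sigma> \<omega> * (\<phi> x * fierz_proj T \<alpha> \<rho> \<sigma>)) = \<phi> x * axial_part (fierz_proj T) \<omega>"
    unfolding axial_part_def by (simp only: mult.left_commute[of _ "\<phi> x"] sum_distrib_left)
  then show "(\<Sum>\<alpha>\<in>UNIV. \<Sum>\<rho>\<in>UNIV. \<Sum>\<sigma>\<in>UNIV. eps \<alpha> \<rho> \<sigma> \<omega> * (\<phi> x * fierz_proj T \<alpha> \<rho> \<sigma>)) = 0"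
    by (simp add: axial_part_fierz_proj)
qed

text \<open>Every term that the projection subtracts contains \<eta> or \<open>eps\<close>
  contracted with \<open>f\<close>, and the constraints annihilate these contractions. The second
  trace term reduces to the first by antisymmetry.\<close>

lemma Fierz_ip3_proj:
  assumes f: "Fierz f"
  shows "ip3 (\<lambda>\<alpha> \<rho> \<sigma>. f \<alpha> \<rho> \<sigma> x) T = ip3 (\<lambda>\<alpha> \<rho> \<sigma>. f \<alpha> \<rho> \<sigma> x) (fierz_proj T)"
proof -
  let ?S = "\<lambda>h. (\<Sum>\<alpha>\<in>UNIV. \<Sum>\<rho>\<in>UNIV. \<Sum>\<sigma>\<in>UNIV. h \<alpha> \<rho> \<sigma> :: real)"
  have tr: "(\<Sum>\<alpha>\<in>UNIV. \<Sum>\<rho>\<in>UNIV. eta \<alpha> \<rho> * (f \<alpha> \<rho> \<sigma> x * c)) = 0" for \<sigma> c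
  proof -
    have "(\<Sum>\<alpha>\<in>UNIV. \<Sum>\<rho>\<in>UNIV. eta \<alpha> \<rho> * (f \<alpha> \<rho> \<sigma> x * c)) = (\<Sum>\<alpha>\<in>UNIV. \<Sum>\<rho>\<in>UNIV. eta \<alpha> \<rho> * f \<alpha> \<rho> \<sigma> x) * c"
      by (simp only: sum_distrib_right mult.assoc)
    then show ?thesis by (simp add: Fierz_trace[OF f])
  qed
  have 1: "?S (\<lambda>\<alpha> \<rho> \<sigma>. eta \<alpha> \<rho> * (f \<alpha> \<rho> \<sigma> x * trace_part T \<sigma>)) = 0"
  proof -
    have "?S (\<lambda>\<alpha> \<rho> \<sigma>. eta \<alpha> \<rho> * (f \<alpha> \<rho> \<sigma> x * trace_part T \<sigma>)) = (\<Sum>\<alpha>\<in>UNIV. \<Sum>\<sigma>\<in>UNIV. \<Sum>\<rho>\<in>UNIV. eta \<alpha> \<rho> * (f \<alpha> \<rho> \<sigma> x * trace_part T \<sigma>))"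
      by (rule sum.cong[OF refl], rule sum.swap)
    also have "\<dots> = (\<Sum>\<sigma>\<in>UNIV. \<Sum>\<alpha>\<in>UNIV. \<Sum>\<rho>\<in>UNIV. eta \<alpha> \<rho> * (f \<alpha> \<rho> \<sigma> x * trace_part T \<sigma>))"
      by (rule sum.swap)
    finally show ?thesis by (simp only: tr sum.neutral_const)
  qed
  have 2: "?S (\<lambda>\<alpha> \<rho> \<sigma>. eta \<alpha> \<sigma> * (f \<alpha> \<rho> \<sigma> x * trace_part T \<rho>)) = 0"
  proof -
    have "?S (\<lambda>\<alpha> \<rho> \<sigma>. eta \<alpha> \<sigma> * (f \<alpha> \<rho> \<sigma> x * trace_part T \<rho>)) = ?S (\<lambda>\<alpha> \<sigma> \<rho>. eta \<alpha> \<sigma> * (f \<alpha> \<rho> \<sigma> x * trace_part T \<rho>))"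
      by (rule sum.cong[OF refl], rule sum.swap)
    also have "\<dots> = - ?S (\<lambda>\<alpha> \<rho> \<sigma>. eta \<alpha> \<rho> * (f \<alpha> \<rho> \<sigma> x * trace_part T \<sigma>))"
      unfolding sum_negf[symmetric]
    proof (intro sum.cong refl)
      fix \<alpha> \<rho> \<sigma>
      show "eta \<alpha> \<rho> * (f \<alpha> \<sigma> \<rho> x * trace_part T \<sigma>) = - (eta \<alpha> \<rho> * (f \<alpha> \<rho> \<sigma> x * trace_part T \<sigma>))"
        using Fierz_antisym[OF f, of \<alpha> \<rho> \<sigma> x] by simp
    qed
    finally show ?thesis by (simp only: 1 minus_zero)
  qed
  have 3: "?S (\<lambda>\<alpha> \<rho> \<sigma>. f \<alpha> \<rho> \<sigma> x * (\<Sum>\<omega>\<in>UNIV. eps \<alpha> \<rho> \<sigma> \<omega> * axial_part T \<omega>)) = 0"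
  proof -
    have "?S (\<lambda>\<alpha> \<rho> \<sigma>. f \<alpha> \<rho> \<sigma> x * (\<Sum>\<omega>\<in>UNIV. eps \<alpha> \<rho> \<sigma> \<omega> * axial_part T \<omega>)) =
       ?S (\<lambda>\<alpha> \<rho> \<sigma>. \<Sum>\<omega>\<in>UNIV. eps \<alpha> \<rho> \<sigma> \<omega> * f \<alpha> \<rho> \<sigma> x * axial_part T \<omega>)"
      unfolding sum_distrib_left by (intro sum.cong refl) simp
    also have "\<dots> = (\<Sum>\<alpha>\<in>UNIV. \<Sum>\<rho>\<in>UNIV. \<Sum>\<omega>\<in>UNIV. \<Sum>\<sigma>\<in>UNIV. eps \<alpha> \<rho> \<sigma> \<omega> * f \<alpha> \<rho> \<sigma> x * axial_part T \<omega>)"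
      by (rule sum.cong[OF refl], rule sum.cong[OF refl], rule sum.swap)
    also have "\<dots> = (\<Sum>\<alpha>\<in>UNIV. \<Sum>\<omega>\<in>UNIV. \<Sum>\<rho>\<in>UNIV. \<Sum>\<sigma>\<in>UNIV. eps \<alpha> \<rho> \<sigma> \<omega> * f \<alpha> \<rho> \<sigma> x * axial_part T \<omega>)"
      by (rule sum.cong[OF refl], rule sum.swap)
    also have "\<dots> = (\<Sum>\<omega>\<in>UNIV. \<Sum>\<alpha>\<in>UNIV. \<Sum>\<rho>\<in>UNIV. \<Sum>\<sigma>\<in>UNIV. eps \<alpha> \<rho> \<sigma> \<omega> * f \<alpha> \<rho> \<sigma> x * axial_part T \<omega>)"
      by (rule sum.swap)
    finally show ?thesis
      by (simp only: sum_distrib_right[symmetric] Fierz_eps[OF f] mult_zero_left sum.neutral_const)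
  qed
  have "ip3 (\<lambda>\<alpha> \<rho> \<sigma>. f \<alpha> \<rho> \<sigma> x) (fierz_proj T) = ip3 (\<lambda>\<alpha> \<rho> \<sigma>. f \<alpha> \<rho> \<sigma> x) T
     - 1/3 * ?S (\<lambda>\<alpha> \<rho> \<sigma>. eta \<alpha> \<rho> * (f \<alpha> \<rho> \<sigma> x * trace_part T \<sigma>))
     + 1/3 * ?S (\<lambda>\<alpha> \<rho> \<sigma>. eta \<alpha> \<sigma> * (f \<alpha> \<rho> \<sigma> x * trace_part T \<rho>))
     - 1/6 * ?S (\<lambda>\<alpha> \<rho> \<sigma>. f \<alpha> \<rho> \<sigma> x * (\<Sum>\<omega>\<in>UNIV. eps \<alpha> \<rho> \<sigma> \<omega> * axial_part T \<omega>))"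
    unfolding ip3_def sum_distrib_left[of "1/3"] sum_distrib_left[of "1/6"] sum_subtractf[symmetric] sum.distrib[symmetric]
    by (intro sum.cong refl) (simp add: fierz_proj_def algebra_simps)
  then show ?thesis by (simp only: 1 2 3)
qed

lemma ip3_self_eq_0: "ip3 a a = 0 \<longleftrightarrow> (\<forall>\<alpha> \<rho> \<sigma>. a \<alpha> \<rho> \<sigma> = 0)"
  unfolding ip3_def by (simp add: sum_nonneg_eq_0_iff sum_nonneg)

section \<open>The field equation\<close>

lemma pd_zero_outside:
  fixes f :: "spacetime \<Rightarrow> 'b::real_normed_vector"
  assumes K: "compact K" and 0: "\<And>x. x \<notin> K \<Longrightarrow> f x = 0" and x: "x \<notin> K"
  shows "pd \<alpha> f x = 0"
proof -
  have "((\<lambda>_. 0) has_derivative (\<lambda>_. 0)) (at x)" by simp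
  then have "(f has_derivative (\<lambda>_. 0)) (at x)"
    by (rule has_derivative_transform_within_open[of _ _ _ _ "- K"])
       (use x 0 in \<open>auto simp: compact_imp_closed[OF K] open_Compl\<close>)
  from pd_eqI[OF this] show ?thesis .
qed

lemma set_integral_eq_whole:
  fixes h :: "spacetime \<Rightarrow> 'b::{banach, second_countable_topology}"
  assumes "\<And>x. x \<notin> K \<Longrightarrow> h x = 0"
  shows "(LINT x:K|lborel. h x) = (LINT x|lborel. h x)"
  unfolding set_lebesgue_integral_def
  by (rule Bochner_Integration.integral_cong) (auto simp: indicator_def assms)

lemma integrable_compact_support:
  fixes h :: "spacetime \<Rightarrow> 'b::{banach, second_countable_topology}"
  assumes "continuous_on UNIV h" "compact K" "\<And>x. x \<notin> K \<Longrightarrow> h x = 0"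
  shows "integrable lborel h"
proof -
  have "integrable lborel (\<lambda>x. indicator K x *\<^sub>R h x)"
    using assms(1,2) continuous_on_subset by (intro borel_integrable_compact) auto
  moreover have "indicator K x *\<^sub>R h x = h x" for x using assms(3)[of x] by (auto simp: indicator_def)
  ultimately show ?thesis by (simp only:)
qed

lemma continuous_current:
  assumes "smooth \<psi>" shows "continuous_on UNIV (current \<psi> \<alpha> \<rho> \<sigma>)"
  unfolding current_def[abs_def]
  by (intro continuous_on_Re herm.continuous_on op_apply.continuous_on continuous_on_const smooth_continuous[OF assms])

lemma continuous_L_K_free:
  assumes "smooth \<psi>" shows "continuous_on UNIV (L_K m (\<lambda>_ _. 0) \<psi>)"
proof -
  have D: "Dirac (\<lambda>_ _. 0) \<psi> = (\<lambda>x. \<Sum>\<alpha>\<in>UNIV. shift \<alpha> gamma *v pd \<alpha> \<psi> x)"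
    by (rule ext) (simp add: Dirac_def op_apply.zero_left)
  show ?thesis
    unfolding L_K_def[abs_def] herm_def[symmetric] D plus_cc_def
    by (intro continuous_intros herm.continuous_on op_apply.continuous_on continuous_on_cnj
        smooth_continuous[OF assms] smooth_continuous[OF smooth_pd[OF assms]])
qed

lemma continuous_ip4:
  assumes "\<And>\<alpha> \<beta> \<rho> \<sigma>. continuous_on S (a \<alpha> \<beta> \<rho> \<sigma>)" "\<And>\<alpha> \<beta> \<rho> \<sigma>. continuous_on S (b \<alpha> \<beta> \<rho> \<sigma>)"
  shows "continuous_on S (\<lambda>x. ip4 (\<lambda>\<alpha> \<beta> \<rho> \<sigma>. a \<alpha> \<beta> \<rho> \<sigma> x) (\<lambda>\<alpha> \<beta> \<rho> \<sigma>. b \<alpha> \<beta> \<rho> \<sigma> x))"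
  unfolding ip4_def by (intro continuous_on_sum continuous_on_mult continuous_on_const assms)

lemma continuous_ip3:
  assumes "\<And>\<alpha> \<rho> \<sigma>. continuous_on S (a \<alpha> \<rho> \<sigma>)" "\<And>\<alpha> \<rho> \<sigma>. continuous_on S (b \<alpha> \<rho> \<sigma>)"
  shows "continuous_on S (\<lambda>x. ip3 (\<lambda>\<alpha> \<rho> \<sigma>. a \<alpha> \<rho> \<sigma> x) (\<lambda>\<alpha> \<rho> \<sigma>. b \<alpha> \<rho> \<sigma> x))"
  unfolding ip3_def by (intro continuous_on_sum continuous_on_mult assms)

lemma smooth_curv_lin: "smooth_field F \<Longrightarrow> smooth_field f \<Longrightarrow> smooth (curv_lin F f \<alpha> \<beta> \<rho> \<sigma>)"
  unfolding curv_lin_def[abs_def] cov_deriv_def by (intro smooth_rules smooth_F_ddd)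

lemma smooth_curv_quad: "smooth_field f \<Longrightarrow> smooth (curv_quad f \<alpha> \<beta> \<rho> \<sigma>)"
  unfolding curv_quad_def[abs_def] by (intro smooth_rules smooth_F_ddd)

text \<open>Smoothness is read off from \<open>div_curv\<close>, where all indices are down and only
  sums, products and one outer derivative of smooth functions occur.\<close>

lemma smooth_xi:
  assumes F: "smooth_field F" "Fierz F" shows "smooth (xi F \<alpha> \<rho> \<sigma>)"
proof -
  have "xi F \<alpha> \<rho> \<sigma> = div_curv F \<alpha> \<rho> \<sigma>" using div_curv_eq_xi[OF F] by (intro ext) simp
  moreover have "smooth (div_curv F \<alpha> \<rho> \<sigma>)"
    unfolding div_curv_def[abs_def] by (intro smooth_rules smooth_F_ddd smooth_curv F(1))
  ultimately show ?thesis by simp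
qed

lemma has_vector_derivative_quartic:
  fixes a b c d :: "'b::real_normed_vector"
  shows "((\<lambda>s. z + s *\<^sub>R a + s\<^sup>2 *\<^sub>R b + s ^ 3 *\<^sub>R c + s ^ 4 *\<^sub>R d) has_vector_derivative a) (at 0)"
  by (auto intro!: derivative_eq_intros)

text \<open>The coefficients of the quartic in \<open>s\<close> are continuous, hence integrable on
  compact \<open>K\<close>. The integral is then itself a quartic in \<open>s\<close>, and its
  derivative at zero is the linear coefficient; nothing is differentiated under the integral
  sign.\<close>

lemma Lagrangian_integral_derivative:
  assumes F: "smooth_field F" "Fierz F" and \<psi>: "smooth \<psi>" and f: "smooth_field f" "Fierz f" and K: "compact K"
  shows "((\<lambda>s. LINT x:K|lborel. Lagrangian m \<tau> \<psi> (perturb F s f) x)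
    has_vector_derivative (LINT x:K|lborel. complex_of_real (first_var \<tau> \<psi> F f x))) (at 0)"
proof -
  let ?C = "\<lambda>x \<alpha> \<beta> \<rho> \<sigma>. curv F \<alpha> \<beta> \<rho> \<sigma> x" and ?D = "\<lambda>x \<alpha> \<beta> \<rho> \<sigma>. curv_lin F f \<alpha> \<beta> \<rho> \<sigma> x"
  let ?N = "\<lambda>x \<alpha> \<beta> \<rho> \<sigma>. curv_quad f \<alpha> \<beta> \<rho> \<sigma> x"
  define a0 where "a0 = Lagrangian m \<tau> \<psi> F"
  define a1 where "a1 x = complex_of_real (first_var \<tau> \<psi> F f x)" for x
  define a2 where "a2 x = complex_of_real (32 * \<tau> * (ip4 (?D x) (?D x) + 2 * ip4 (?C x) (?N x)))" for x
  define a3 where "a3 x = complex_of_real (64 * \<tau> * ip4 (?D x) (?N x))" for x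
  define a4 where "a4 x = complex_of_real (32 * \<tau> * ip4 (?N x) (?N x))" for x
  note cc = smooth_continuous[OF smooth_curv[OF F(1)]] smooth_continuous[OF smooth_curv_lin[OF F(1) f(1)]]
    smooth_continuous[OF smooth_curv_quad[OF f(1)]]
  have sf: "continuous_on UNIV (h \<alpha> \<rho> \<sigma>)" if "smooth_field h" for h \<alpha> \<rho> \<sigma>
    using that by (simp add: smooth_field_def smooth_continuous)
  have c0: "continuous_on UNIV a0"
    unfolding a0_def Lagrangian_eq[OF F, abs_def]
    by (intro continuous_on_add continuous_on_of_real continuous_on_mult continuous_on_const
        continuous_L_K_free[OF \<psi>] continuous_ip3 continuous_ip4 continuous_current[OF \<psi>] cc sf[OF F(1)])
  have c1: "continuous_on UNIV a1"
    unfolding a1_def first_var_def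
    by (intro continuous_on_add continuous_on_of_real continuous_on_mult continuous_on_const
        continuous_ip3 continuous_ip4 continuous_current[OF \<psi>] cc sf[OF f(1)])
  have c2: "continuous_on UNIV a2" "continuous_on UNIV a3" "continuous_on UNIV a4"
    unfolding a2_def a3_def a4_def
    by (intro continuous_on_add continuous_on_of_real continuous_on_mult continuous_on_const continuous_ip4 cc)+
  have int: "set_integrable lborel K h" if "continuous_on UNIV h" for h :: "spacetime \<Rightarrow> complex"
    unfolding set_integrable_def using that K continuous_on_subset by (intro borel_integrable_compact) auto
  note ints = int[OF c0] int[OF c1] int[OF c2(1)] int[OF c2(2)] int[OF c2(3)]
  have "(LINT x:K|lborel. Lagrangian m \<tau> \<psi> (perturb F s f) x) =
     (LINT x:K|lborel. a0 x) + s *\<^sub>R (LINT x:K|lborel. a1 x) + s\<^sup>2 *\<^sub>R (LINT x:K|lborel. a2 x)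
      + s ^ 3 *\<^sub>R (LINT x:K|lborel. a3 x) + s ^ 4 *\<^sub>R (LINT x:K|lborel. a4 x)" for s
  proof -
    have "(LINT x:K|lborel. Lagrangian m \<tau> \<psi> (perturb F s f) x) =
      (LINT x:K|lborel. a0 x + s *\<^sub>R a1 x + s\<^sup>2 *\<^sub>R a2 x + s ^ 3 *\<^sub>R a3 x + s ^ 4 *\<^sub>R a4 x)"
      unfolding a0_def a1_def a2_def a3_def a4_def Lagrangian_perturb[OF F f] ..
    also have "\<dots> = (LINT x:K|lborel. a0 x) + s *\<^sub>R (LINT x:K|lborel. a1 x) + s\<^sup>2 *\<^sub>R (LINT x:K|lborel. a2 x)
      + s ^ 3 *\<^sub>R (LINT x:K|lborel. a3 x) + s ^ 4 *\<^sub>R (LINT x:K|lborel. a4 x)"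
    proof -
      have "indicator K x *\<^sub>R (a0 x + s *\<^sub>R a1 x + s\<^sup>2 *\<^sub>R a2 x + s ^ 3 *\<^sub>R a3 x + s ^ 4 *\<^sub>R a4 x) =
        indicator K x *\<^sub>R a0 x + s *\<^sub>R (indicator K x *\<^sub>R a1 x) + s\<^sup>2 *\<^sub>R (indicator K x *\<^sub>R a2 x)
        + s ^ 3 *\<^sub>R (indicator K x *\<^sub>R a3 x) + s ^ 4 *\<^sub>R (indicator K x *\<^sub>R a4 x)" for x
        by (simp only: scaleR_add_right scaleR_left_commute[of _ "indicator K x"])
      then show ?thesis
        using ints unfolding set_integrable_def set_lebesgue_integral_def
        by (simp only: Bochner_Integration.integral_add Bochner_Integration.integrable_add
            integrable_scaleR_right integral_scaleR_right simp_thms)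
    qed
    finally show ?thesis .
  qed
  then show ?thesis unfolding a1_def[symmetric] by (simp only: has_vector_derivative_quartic)
qed

text \<open>The quantity 128 \<tau> (\<chi> - \<xi>) before projection, written without division by
  \<tau>.\<close>

definition euler_lagrange :: "real \<Rightarrow> (spacetime \<Rightarrow> form) \<Rightarrow> field3 \<Rightarrow> field3" where
  "euler_lagrange \<tau> \<psi> F \<alpha> \<rho> \<sigma> x = current \<psi> \<alpha> \<rho> \<sigma> x - 128 * \<tau> * xi F \<alpha> \<rho> \<sigma> x"

text \<open>The flux is linear in \<open>f\<close> and thus vanishes off \<open>K\<close>, so its
  divergence integrates to zero. Since the whole first variation vanishes off \<open>K\<close>, the
  integral may be taken over all of space.\<close>

lemma first_var_integral:
  assumes F: "smooth_field F" "Fierz F" and \<psi>: "smooth \<psi>" and f: "smooth_field f"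
    and K: "compact K" and 0: "\<And>\<alpha> \<rho> \<sigma> x. x \<notin> K \<Longrightarrow> f \<alpha> \<rho> \<sigma> x = 0"
  shows "(LINT x:K|lborel. complex_of_real (first_var \<tau> \<psi> F f x)) =
     of_real (LINT x|lborel. ip3 (\<lambda>\<alpha> \<rho> \<sigma>. f \<alpha> \<rho> \<sigma> x) (\<lambda>\<alpha> \<rho> \<sigma>. euler_lagrange \<tau> \<psi> F \<alpha> \<rho> \<sigma> x))"
proof -
  let ?E = "\<lambda>x. ip3 (\<lambda>\<alpha> \<rho> \<sigma>. f \<alpha> \<rho> \<sigma> x) (\<lambda>\<alpha> \<rho> \<sigma>. euler_lagrange \<tau> \<psi> F \<alpha> \<rho> \<sigma> x)"
  let ?V = "boundary_flux F f"
  have fv: "first_var \<tau> \<psi> F f x = ?E x + (\<Sum>\<alpha>\<in>UNIV. 128 * \<tau> * pd \<alpha> (?V \<alpha>) x)" for x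
    unfolding first_var_eq[OF F f] euler_lagrange_def sum_distrib_left ..
  have sV: "smooth (?V \<alpha>)" for \<alpha> by (rule smooth_boundary_flux[OF F(1) f])
  have V0: "?V \<alpha> x = 0" if "x \<notin> K" for \<alpha> x
    using 0[OF that] by (simp add: boundary_flux_def F_ddd_eq)
  have pV0: "pd \<alpha> (?V \<alpha>) x = 0" if "x \<notin> K" for \<alpha> x
    using pd_zero_outside[OF K V0 that] .
  have E0: "?E x = 0" if "x \<notin> K" for x using 0[OF that] by (simp add: ip3_def)
  have cE: "continuous_on UNIV ?E"
    unfolding euler_lagrange_def
    by (intro continuous_ip3 continuous_on_diff continuous_on_mult continuous_on_const continuous_current[OF \<psi>]
      smooth_continuous[OF smooth_xi[OF F]] smooth_continuous) (use f in \<open>simp add: smooth_field_def\<close>)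
  have iE: "integrable lborel ?E" by (rule integrable_compact_support[OF cE K E0])
  have iV: "integrable lborel (pd \<alpha> (?V \<alpha>))" for \<alpha>
    by (rule integrable_compact_support[OF smooth_continuous[OF smooth_pd[OF sV]] K pV0])
  have V: "(LINT x|lborel. pd \<alpha> (?V \<alpha>) x) = 0" for \<alpha>
    by (rule integral_pd_zero[OF smooth_differentiable[OF sV] smooth_continuous[OF smooth_pd[OF sV]] K V0])
  have "(LINT x:K|lborel. complex_of_real (first_var \<tau> \<psi> F f x)) = (LINT x|lborel. complex_of_real (first_var \<tau> \<psi> F f x))"
    by (rule set_integral_eq_whole) (simp add: fv E0 pV0)
  also have "\<dots> = of_real (LINT x|lborel. first_var \<tau> \<psi> F f x)" by (rule integral_complex_of_real)
  also have "(LINT x|lborel. first_var \<tau> \<psi> F f x) = (LINT x|lborel. ?E x)"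
    unfolding fv using iE iV by (simp add: V Bochner_Integration.integral_sum)
  finally show ?thesis .
qed

text \<open>The derivative in \<open>s\<close> always exists with a known value, and derivatives are
  unique, so stationarity only says that this value is zero.\<close>

lemma stationary_iff:
  assumes F: "smooth_field F" "Fierz F" and \<psi>: "smooth \<psi>"
  shows "stationary (Lagrangian m \<tau> \<psi>) F \<longleftrightarrow> (\<forall>f K. smooth_field f \<longrightarrow> Fierz f \<longrightarrow> compact K \<longrightarrow>
     (\<forall>\<alpha> \<rho> \<sigma> x. x \<notin> K \<longrightarrow> f \<alpha> \<rho> \<sigma> x = 0) \<longrightarrow>
     (LINT x|lborel. ip3 (\<lambda>\<alpha> \<rho> \<sigma>. f \<alpha> \<rho> \<sigma> x) (\<lambda>\<alpha> \<rho> \<sigma>. euler_lagrange \<tau> \<psi> F \<alpha> \<rho> \<sigma> x)) = 0)"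
proof -
  have "((\<lambda>s. LINT x:K|lborel. Lagrangian m \<tau> \<psi> (perturb F s f) x) has_vector_derivative 0) (at 0) \<longleftrightarrow>
    (LINT x|lborel. ip3 (\<lambda>\<alpha> \<rho> \<sigma>. f \<alpha> \<rho> \<sigma> x) (\<lambda>\<alpha> \<rho> \<sigma>. euler_lagrange \<tau> \<psi> F \<alpha> \<rho> \<sigma> x)) = 0"
    if f: "smooth_field f" "Fierz f" "compact K" "\<forall>\<alpha> \<rho> \<sigma> x. x \<notin> K \<longrightarrow> f \<alpha> \<rho> \<sigma> x = 0" for f K
  proof -
    have d: "((\<lambda>s. LINT x:K|lborel. Lagrangian m \<tau> \<psi> (perturb F s f) x) has_vector_derivative
      of_real (LINT x|lborel. ip3 (\<lambda>\<alpha> \<rho> \<sigma>. f \<alpha> \<rho> \<sigma> x) (\<lambda>\<alpha> \<rho> \<sigma>. euler_lagrange \<tau> \<psi> F \<alpha> \<rho> \<sigma> x))) (at 0)"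
      using Lagrangian_integral_derivative[OF F \<psi> f(1-3)] first_var_integral[OF F \<psi> f(1,3)] f(4) by simp
    show ?thesis
    proof
      assume "((\<lambda>s. LINT x:K|lborel. Lagrangian m \<tau> \<psi> (perturb F s f) x) has_vector_derivative 0) (at 0)"
      from vector_derivative_unique_at[OF d this] show
        "(LINT x|lborel. ip3 (\<lambda>\<alpha> \<rho> \<sigma>. f \<alpha> \<rho> \<sigma> x) (\<lambda>\<alpha> \<rho> \<sigma>. euler_lagrange \<tau> \<psi> F \<alpha> \<rho> \<sigma> x)) = 0"
        by (simp only: of_real_eq_0_iff)
    qed (use d in simp)
  qed
  then show ?thesis unfolding stationary_def by simp
qed

lemma Theta_antisym: "Theta [\<rho>, \<sigma>] = - Theta [\<sigma>, \<rho>]"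
  unfolding Theta_eq delta_delta[of \<rho>] eta_sym[of \<sigma> \<rho>]
  by (simp add: algebra_simps flip: scaleR_add_left)

lemma euler_lagrange_antisym: "euler_lagrange \<tau> \<psi> F \<alpha> \<rho> \<sigma> x = - euler_lagrange \<tau> \<psi> F \<alpha> \<sigma> \<rho> x"
proof -
  have "current \<psi> \<alpha> \<rho> \<sigma> x = - current \<psi> \<alpha> \<sigma> \<rho> x"
    unfolding current_def by (subst Theta_antisym) (simp add: op_apply.minus_left op_apply.minus_right herm.minus_right)
  then show ?thesis by (simp add: euler_lagrange_def xi_def algebra_simps)
qed

text \<open>For necessity the tensor factor of the variation is frozen at the projection taken at
  \<open>x0\<close>, and only its scalar profile varies. This reduces the constrained tensor problem
  to the fundamental lemma for one real function.\<close>

lemma stationary_iff_fierz_proj: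
  assumes F: "smooth_field F" "Fierz F" and \<psi>: "smooth \<psi>"
  shows "stationary (Lagrangian m \<tau> \<psi>) F \<longleftrightarrow>
    (\<forall>x \<alpha> \<rho> \<sigma>. fierz_proj (\<lambda>\<alpha> \<rho> \<sigma>. euler_lagrange \<tau> \<psi> F \<alpha> \<rho> \<sigma> x) \<alpha> \<rho> \<sigma> = 0)"
    (is "?S \<longleftrightarrow> ?P")
proof
  assume ?P
  then have "fierz_proj (\<lambda>\<alpha> \<rho> \<sigma>. euler_lagrange \<tau> \<psi> F \<alpha> \<rho> \<sigma> x) = (\<lambda>_ _ _. 0)" for x
    by (intro ext) blast
  then have "ip3 (\<lambda>\<alpha> \<rho> \<sigma>. f \<alpha> \<rho> \<sigma> x) (\<lambda>\<alpha> \<rho> \<sigma>. euler_lagrange \<tau> \<psi> F \<alpha> \<rho> \<sigma> x) = 0" if "Fierz f" for f x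
    using Fierz_ip3_proj[OF that, of x "\<lambda>\<alpha> \<rho> \<sigma>. euler_lagrange \<tau> \<psi> F \<alpha> \<rho> \<sigma> x"] by (simp add: ip3_def)
  then show ?S unfolding stationary_iff[OF F \<psi>] by simp
next
  assume S: ?S
  show ?P
  proof (rule allI)
    fix x0
    let ?E = "\<lambda>x \<alpha> \<rho> \<sigma>. euler_lagrange \<tau> \<psi> F \<alpha> \<rho> \<sigma> x"
    let ?p = "fierz_proj (?E x0)"
    \<comment> \<open>The Fierz conditions read the same for upper and for lower indices, so the numbers \<open>?p\<close> may be
        used with upper indices; the pairing then becomes a sum of squares instead of an indefinite form.\<close>
    have "ip3 ?p (?E x0) = 0"
    proof (rule continuous_fundamental_lemma[of "\<lambda>x. ip3 ?p (?E x)" x0])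
      show "continuous_on UNIV (\<lambda>x. ip3 ?p (?E x))"
        unfolding euler_lagrange_def
        by (intro continuous_ip3 continuous_on_diff continuous_on_mult continuous_on_const continuous_current[OF \<psi>]
           smooth_continuous[OF smooth_xi[OF F]])
      fix \<phi> :: "spacetime \<Rightarrow> real" and K assume \<phi>: "smooth \<phi>" "compact K" "\<And>x. x \<notin> K \<Longrightarrow> \<phi> x = 0"
      let ?f = "\<lambda>\<alpha> \<rho> \<sigma> x. \<phi> x * ?p \<alpha> \<rho> \<sigma>"
      have "smooth_field ?f" unfolding smooth_field_def by (intro allI smooth_mult \<phi>(1) smooth_const)
      moreover have "Fierz ?f" by (rule Fierz_scaled_fierz_proj) (rule euler_lagrange_antisym)
      ultimately have "(LINT x|lborel. ip3 (\<lambda>\<alpha> \<rho> \<sigma>. ?f \<alpha> \<rho> \<sigma> x) (?E x)) = 0"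
        using S[unfolded stationary_iff[OF F \<psi>], THEN spec[of _ ?f], THEN spec[of _ K]] \<phi> by simp
      then show "(LINT x|lborel. \<phi> x * ip3 ?p (?E x)) = 0"
        by (simp add: ip3_def sum_distrib_left mult.assoc)
    qed
    moreover have "ip3 ?p (?E x0) = ip3 ?p ?p"
      using Fierz_ip3_proj[OF Fierz_scaled_fierz_proj[of "?E x0" "\<lambda>_. 1", OF euler_lagrange_antisym], of "?E x0"]
      by simp
    ultimately have "ip3 ?p ?p = 0" by (simp only:)
    then show "\<forall>\<alpha> \<rho> \<sigma>. ?p \<alpha> \<rho> \<sigma> = 0" by (rule ip3_self_eq_0[THEN iffD1])
  qed
qed

theorem mainTheorem10:
  fixes F :: field3
  assumes "smooth_field F" and "Fierz F"
  shows "(\<forall>x. L_V (X_field F) x =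
            of_real (- 32 * (\<Sum>\<alpha>\<in>UNIV. \<Sum>\<beta>\<in>UNIV. \<Sum>\<rho>\<in>UNIV. \<Sum>\<sigma>\<in>UNIV.
                               curv F \<alpha> \<beta> \<rho> \<sigma> x * curv_up F \<alpha> \<beta> \<rho> \<sigma> x)))
       \<and> (\<forall>(\<psi> :: spacetime \<Rightarrow> form) (m :: real) (\<tau> :: real). smooth \<psi> \<longrightarrow> \<tau> \<noteq> 0 \<longrightarrow>
            (stationary (Lagrangian m \<tau> \<psi>) F \<longleftrightarrow>
             (\<forall>x \<alpha> \<rho> \<sigma>. fierz_part (\<lambda>\<alpha> \<rho> \<sigma>. of_real (xi F \<alpha> \<rho> \<sigma> x)) \<alpha> \<rho> \<sigma> =
                        fierz_part (\<lambda>\<alpha> \<rho> \<sigma>. chi \<tau> \<psi> \<alpha> \<rho> \<sigma> x) \<alpha> \<rho> \<sigma>)))"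
proof (intro conjI allI impI)
  fix x show "L_V (X_field F) x = of_real (- 32 * (\<Sum>\<alpha>\<in>UNIV. \<Sum>\<beta>\<in>UNIV. \<Sum>\<rho>\<in>UNIV. \<Sum>\<sigma>\<in>UNIV.
                               curv F \<alpha> \<beta> \<rho> \<sigma> x * curv_up F \<alpha> \<beta> \<rho> \<sigma> x))"
    by (rule L_V_X_field[OF assms])
next
  fix \<psi> :: "spacetime \<Rightarrow> form" and m \<tau> :: real
  assume \<psi>: "smooth \<psi>" and \<tau>: "\<tau> \<noteq> 0"
  have "fierz_part (\<lambda>\<alpha> \<rho> \<sigma>. of_real (xi F \<alpha> \<rho> \<sigma> x)) \<alpha> \<rho> \<sigma> = fierz_part (\<lambda>\<alpha> \<rho> \<sigma>. chi \<tau> \<psi> \<alpha> \<rho> \<sigma> x) \<alpha> \<rho> \<sigma>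
      \<longleftrightarrow> fierz_proj (\<lambda>\<alpha> \<rho> \<sigma>. euler_lagrange \<tau> \<psi> F \<alpha> \<rho> \<sigma> x) \<alpha> \<rho> \<sigma> = 0" for x \<alpha> \<rho> \<sigma>
  proof -
    let ?c = "\<lambda>\<alpha> \<rho> \<sigma>. current \<psi> \<alpha> \<rho> \<sigma> x / (128 * \<tau>)"
    \<comment> \<open>The nested differences bring the expression into the shape of
      \<open>fierz_proj_diff\<close>, which then applies twice and factors out 128 \<tau>.\<close>
    have "(\<lambda>\<alpha> \<rho> \<sigma>. euler_lagrange \<tau> \<psi> F \<alpha> \<rho> \<sigma> x) =
        (\<lambda>\<alpha> \<rho> \<sigma>. 0 - (- (128 * \<tau>)) * (?c \<alpha> \<rho> \<sigma> - 1 * xi F \<alpha> \<rho> \<sigma> x))"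
      using \<tau> by (intro ext) (simp add: euler_lagrange_def field_simps)
    then have "fierz_proj (\<lambda>\<alpha> \<rho> \<sigma>. euler_lagrange \<tau> \<psi> F \<alpha> \<rho> \<sigma> x) \<alpha> \<rho> \<sigma> = fierz_proj (\<lambda>_ _ _. 0) \<alpha> \<rho> \<sigma>
        - (- (128 * \<tau>)) * (fierz_proj ?c \<alpha> \<rho> \<sigma> - 1 * fierz_proj (\<lambda>\<alpha> \<rho> \<sigma>. xi F \<alpha> \<rho> \<sigma> x) \<alpha> \<rho> \<sigma>)"
      by (simp only: fierz_proj_diff)
    moreover have "fierz_proj (\<lambda>_ _ _. 0) \<alpha> \<rho> \<sigma> = 0"
      by (simp add: fierz_proj_def trace_part_def axial_part_def)
    ultimately have "fierz_proj (\<lambda>\<alpha> \<rho> \<sigma>. euler_lagrange \<tau> \<psi> F \<alpha> \<rho> \<sigma> x) \<alpha> \<rho> \<sigma> =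
       128 * \<tau> * (fierz_proj ?c \<alpha> \<rho> \<sigma> - fierz_proj (\<lambda>\<alpha> \<rho> \<sigma>. xi F \<alpha> \<rho> \<sigma> x) \<alpha> \<rho> \<sigma>)"
      by (simp add: algebra_simps)
    then show ?thesis
      unfolding chi_eq fierz_part_of_real of_real_eq_iff using \<tau> by auto
  qed
  then show "stationary (Lagrangian m \<tau> \<psi>) F \<longleftrightarrow>
             (\<forall>x \<alpha> \<rho> \<sigma>. fierz_part (\<lambda>\<alpha> \<rho> \<sigma>. of_real (xi F \<alpha> \<rho> \<sigma> x)) \<alpha> \<rho> \<sigma> =
                        fierz_part (\<lambda>\<alpha> \<rho> \<sigma>. chi \<tau> \<psi> \<alpha> \<rho> \<sigma> x) \<alpha> \<rho> \<sigma>)"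
    unfolding stationary_iff_fierz_proj[OF assms \<psi>] by simp
qed

end
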